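(* Let $F$ be a field of characteristic $2$ and let $(V,q)$ be a $2n$-dimensional (nondegenerate) quadratic space over $F$. Let $\tau\in O(V,q)$ be an involution with $\mathrm{Res}(\tau)=\mathrm{Fix}(\tau)$. Then the following conditions are equivalent: (1) $(C(q),J_\tau)\simeq(M_{2^n}(F),t)$ as algebras with involution, where $t$ is the transpose involution. (2) $q(x)\in F^2$ for every $x\in\mathrm{Res}(\tau)$. (3) $\omega_\tau(x,x)\in F^2$ for every $x\in\mathrm{Res}(\tau)$. (4) Either $n$ is even and $\omega_\tau\simeq \frac n2\mathbb{H}_{-1}$, or $\omega_\tau\simeq n\langle1\rangle$.
   Context: For a quadratic form $q:V\to F$ on a finite-dimensional vector space, the polar form is $\mathfrak{b}_q(u,v)=q(u+v)-q(u)-q(v)$. $(V,q)$ is called a quadratic space if $\mathfrak{b}_q$ is nondegenerate. $O(V,q)$ is its group of isometries. An involution in $O(V,q)$ is an isometry $\tau$ with $\tau^2=\mathrm{id}$. For $\tau\in O(V,q)$: $\mathrm{Fix}(\tau)=\{x\in V\mid\tau(x)=x\}$ and $\mathrm{Res}(\tau)=\{\tau(x)-x\mid x\in V\}$. The Wall form of $\tau$ is the (well-defined, nondegenerate) bilinear form $\omega_\tau$ on $\mathrm{Res}(\tau)$ given by $\omega_\tau(\tau(x)-x,\tau(y)-y)=\mathfrak{b}_q(\tau(x)-x,y)$ for $x,y\in V$. It is symmetric if $\tau^2=\mathrm{id}$. $C(q)$ is the Clifford algebra of $(V,q)$ (generated by $V$ with $v^2=q(v)$), and $J_\tau$ is the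 unique $F$-linear involution (anti-automorphism) of $C(q)$ with $J_\tau(v)=\tau(v)$ for all $v\in V$. Isomorphisms of algebras with involution are $F$-algebra isomorphisms commuting with the involutions. $F^2=\{a^2\mid a\in F\}$. $\mathbb{H}_{-1}$ is the hyperbolic plane: the $2$-dimensional bilinear form with a basis $(u,v)$ with $\mathfrak b(u,u)=\mathfrak b(v,v)=0$ and $\mathfrak b(u,v)=-\mathfrak b(v,u)=1$ (here $-1=1$). For a bilinear form $\mathfrak b$, $r\mathfrak b$ denotes the orthogonal sum of $r$ copies of $\mathfrak b$. $\langle1\rangle$ is the $1$-dimensional form $(a,b)\mapsto ab$. *)

theory Defs
  imports
    "HOL-Library.Poly_Mapping"
    "HOL-Library.Product_Plus"
    "HOL-Library.FuncSet"
    "HOL-Algebra.Algebra"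
    "HOL-Algebra.Algebraic_Closure_Type"
    "Jordan_Normal_Form.Matrix"
begin

section \<open>Quadratic spaces and isometries\<close>

text \<open>The vector space is the whole type \<open>'v\<close>, with scalar multiplication \<open>scale\<close>.\<close>

definition polar :: "('v::ab_group_add \<Rightarrow> 'f::field) \<Rightarrow> 'v \<Rightarrow> 'v \<Rightarrow> 'f" where
  "polar q u v = q (u + v) - q u - q v"

definition quadratic_form :: "('f::field \<Rightarrow> 'v::ab_group_add \<Rightarrow> 'v) \<Rightarrow> ('v \<Rightarrow> 'f) \<Rightarrow> bool" where
  "quadratic_form scale q \<longleftrightarrow>
     (\<forall>a v. q (scale a v) = a\<^sup>2 * q v) \<and>
     (\<forall>u. Vector_Spaces.linear scale (*) (\<lambda>v. polar q u v)) \<and>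
     (\<forall>v. Vector_Spaces.linear scale (*) (\<lambda>u. polar q u v))"

definition quadratic_space :: "('f::field \<Rightarrow> 'v::ab_group_add \<Rightarrow> 'v) \<Rightarrow> ('v \<Rightarrow> 'f) \<Rightarrow> bool" where
  "quadratic_space scale q \<longleftrightarrow>
     (\<exists>B. finite_dimensional_vector_space scale B) \<and>
     quadratic_form scale q \<and>
     (\<forall>u. (\<forall>v. polar q u v = 0) \<longrightarrow> u = 0)"

definition orthogonal_group ::
    "('f::field \<Rightarrow> 'v::ab_group_add \<Rightarrow> 'v) \<Rightarrow> ('v \<Rightarrow> 'f) \<Rightarrow> ('v \<Rightarrow> 'v) set" where
  "orthogonal_group scale q =
     {\<tau>. Vector_Spaces.linear scale scale \<tau> \<and> bij \<tau> \<and> (\<forall>x. q (\<tau> x) = q x)}"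

definition Fix :: "('v \<Rightarrow> 'v) \<Rightarrow> 'v set" where
  "Fix \<tau> = {x. \<tau> x = x}"

definition Res :: "('v::ab_group_add \<Rightarrow> 'v) \<Rightarrow> 'v set" where
  "Res \<tau> = {\<tau> x - x | x. True}"

text \<open>Only the values on \<open>Res \<tau> \<times> Res \<tau>\<close> are meaningful; they are determined by
  lemma \<open>wall_form_eq\<close> below.\<close>

definition wall_form :: "('v::ab_group_add \<Rightarrow> 'f::field) \<Rightarrow> ('v \<Rightarrow> 'v) \<Rightarrow> 'v \<Rightarrow> 'v \<Rightarrow> 'f" where
  "wall_form q \<tau> u w =
     (THE c. \<exists>x y. u = \<tau> x - x \<and> w = \<tau> y - y \<and> c = polar q (\<tau> x - x) y)"

lemma polar_add_right:
  assumes "quadratic_form scale q"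
  shows "polar q u (v + w) = polar q u v + polar q u w"
  using assms unfolding quadratic_form_def
  by (metis Vector_Spaces.linear_def module_hom.add)

lemma polar_diff_right:
  assumes "quadratic_form scale q"
  shows "polar q u (v - w) = polar q u v - polar q u w"
  using polar_add_right[OF assms, of u "v - w" w] by simp

lemma polar_diff_left:
  assumes "quadratic_form scale q"
  shows "polar q (u - v) w = polar q u w - polar q v w"
proof -
  have "polar q x y = polar q y x" for x y
    by (simp add: polar_def add.commute)
  then show ?thesis
    using polar_diff_right[OF assms] by metis
qed

lemma wall_form_eq:
  assumes q: "quadratic_form scale q" and \<tau>: "\<tau> \<in> orthogonal_group scale q"
  shows "wall_form q \<tau> (\<tau> x - x) (\<tau> y - y) = polar q (\<tau> x - x) y"
proof -
  have add: "\<tau> (u + v) = \<tau> u + \<tau> v" for u v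
    using \<tau> by (auto simp: orthogonal_group_def Vector_Spaces.linear_def module_hom.add)
  have diff: "\<tau> (u - v) = \<tau> u - \<tau> v" for u v
    using add[of "u - v" v] by simp
  have inv: "polar q (\<tau> u) (\<tau> v) = polar q u v" for u v
    using \<tau> by (simp add: polar_def orthogonal_group_def flip: add)
  have "polar q (\<tau> x' - x') y' = polar q (\<tau> x - x) y"
    if x: "\<tau> x - x = \<tau> x' - x'" and y: "\<tau> y - y = \<tau> y' - y'" for x' y'
  proof -
    define d where "d = y' - y"
    have "\<tau> d - d = (\<tau> y' - y') - (\<tau> y - y)"
      by (simp add: d_def diff)
    then have d: "\<tau> d = d"
      using y by simp
    have "polar q (\<tau> x - x) y' - polar q (\<tau> x - x) y = polar q (\<tau> x - x) d"
      by (simp add: d_def polar_diff_right[OF q])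
    also have "\<dots> = polar q (\<tau> x) (\<tau> d) - polar q x d"
      by (simp add: polar_diff_left[OF q] d)
    also have "\<dots> = 0"
      by (simp add: inv)
    finally show ?thesis
      using x by simp
  qed
  then show ?thesis
    unfolding wall_form_def by (intro the_equality) (blast, metis)
qed


section \<open>Bilinear spaces\<close>

record ('f, 'v) bilinear_space =
  bcarrier :: "'v set"
  bscale :: "'f \<Rightarrow> 'v \<Rightarrow> 'v"
  bform :: "'v \<Rightarrow> 'v \<Rightarrow> 'f"

definition isometric ::
    "('f, 'v::plus) bilinear_space \<Rightarrow> ('f, 'w::plus) bilinear_space \<Rightarrow> bool" where
  "isometric V W \<longleftrightarrow>
     (\<exists>\<phi>. bij_betw \<phi> (bcarrier V) (bcarrier W) \<and>
          (\<forall>x\<in>bcarrier V. \<forall>y\<in>bcarrier V. \<phi> (x + y) = \<phi> x + \<phi> y) \<and>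
          (\<forall>a. \<forall>x\<in>bcarrier V. \<phi> (bscale V a x) = bscale W a (\<phi> x)) \<and>
          (\<forall>x\<in>bcarrier V. \<forall>y\<in>bcarrier V. bform W (\<phi> x) (\<phi> y) = bform V x y))"

definition wall_space ::
    "('f::field \<Rightarrow> 'v::ab_group_add \<Rightarrow> 'v) \<Rightarrow> ('v \<Rightarrow> 'f) \<Rightarrow> ('v \<Rightarrow> 'v) \<Rightarrow> ('f, 'v) bilinear_space"
where
  "wall_space scale q \<tau> = \<lparr>bcarrier = Res \<tau>, bscale = scale, bform = wall_form q \<tau>\<rparr>"

text \<open>The distinguished basis of \<open>\<H>\<^sub>-\<^sub>1\<close> is \<open>(1, 0), (0, 1)\<close>.\<close>

definition hyperbolic_plane :: "('f::field, 'f \<times> 'f) bilinear_space" where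
  "hyperbolic_plane =
     \<lparr>bcarrier = UNIV,
      bscale = (\<lambda>c (a, b). (c * a, c * b)),
      bform = (\<lambda>(a, b) (c, d). a * d - b * c)\<rparr>"

definition unit_space :: "('f::field, 'f) bilinear_space" where
  "unit_space = \<lparr>bcarrier = UNIV, bscale = (*), bform = (*)\<rparr>"

text \<open>The orthogonal sum of \<open>r\<close> copies of \<open>B\<close>, realised on \<open>r\<close>-tuples of vectors of \<open>B\<close>.\<close>

definition orthogonal_copies ::
    "nat \<Rightarrow> ('f::field, 'w) bilinear_space \<Rightarrow> ('f, 'w vec) bilinear_space" where
  "orthogonal_copies r B =
     \<lparr>bcarrier = {x \<in> carrier_vec r. \<forall>i<r. x $ i \<in> bcarrier B},
      bscale = (\<lambda>a. map_vec (bscale B a)),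
      bform = (\<lambda>x y. \<Sum>i<r. bform B (x $ i) (y $ i))\<rparr>"


section \<open>Algebras with involution\<close>

text \<open>An \<open>F\<close>-algebra, not necessarily commutative, is given by a record of type \<open>('f, 'a) module\<close>,
  all of whose fields (including the ring multiplication) are used.\<close>

definition algebra_involution :: "('f, 'a) module \<Rightarrow> ('a \<Rightarrow> 'a) \<Rightarrow> bool" where
  "algebra_involution A J \<longleftrightarrow>
     J \<in> carrier A \<rightarrow> carrier A \<and>
     (\<forall>x\<in>carrier A. \<forall>y\<in>carrier A. J (x \<oplus>\<^bsub>A\<^esub> y) = J x \<oplus>\<^bsub>A\<^esub> J y) \<and>
     (\<forall>a. \<forall>x\<in>carrier A. J (a \<odot>\<^bsub>A\<^esub> x) = a \<odot>\<^bsub>A\<^esub> J x) \<and>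
     (\<forall>x\<in>carrier A. \<forall>y\<in>carrier A. J (x \<otimes>\<^bsub>A\<^esub> y) = J y \<otimes>\<^bsub>A\<^esub> J x) \<and>
     (\<forall>x\<in>carrier A. J (J x) = x)"

definition involution_algebra_iso ::
    "('f, 'a) module \<Rightarrow> ('a \<Rightarrow> 'a) \<Rightarrow> ('f, 'b) module \<Rightarrow> ('b \<Rightarrow> 'b) \<Rightarrow> bool" where
  "involution_algebra_iso A J B K \<longleftrightarrow>
     (\<exists>\<phi>\<in>ring_iso A B.
        (\<forall>a. \<forall>x\<in>carrier A. \<phi> (a \<odot>\<^bsub>A\<^esub> x) = a \<odot>\<^bsub>B\<^esub> \<phi> x) \<and>
        (\<forall>x\<in>carrier A. \<phi> (J x) = K (\<phi> x)))"


section \<open>The Clifford algebra\<close>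

text \<open>The free monoid on \<open>'v\<close>, written additively so that finitely supported functions
  \<open>'v free_monoid \<Rightarrow>\<^sub>0 'f\<close> with the convolution product form the free \<open>'f\<close>-algebra on the
  underlying set of \<open>'v\<close>.\<close>

datatype 'v free_monoid = Word (letters: "'v list")

instantiation free_monoid :: (type) monoid_add
begin
definition "0 = Word []"
definition "x + y = Word (letters x @ letters y)"
instance by standard (simp_all add: zero_free_monoid_def plus_free_monoid_def)
end

type_synonym ('f, 'v) free_algebra = "'v free_monoid \<Rightarrow>\<^sub>0 'f"

definition free_const :: "'f \<Rightarrow> ('f::field, 'v) free_algebra" where
  "free_const a = Poly_Mapping.single 0 a"

definition free_gen :: "'v \<Rightarrow> ('f::field, 'v) free_algebra" where
  "free_gen v = Poly_Mapping.single (Word [v]) 1"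

text \<open>The first two families of relations cut the free algebra down to the tensor algebra of the
  vector space \<open>'v\<close>; the third imposes \<open>v\<^sup>2 = q v\<close>.\<close>

definition clifford_relations ::
    "('f::field \<Rightarrow> 'v::ab_group_add \<Rightarrow> 'v) \<Rightarrow> ('v \<Rightarrow> 'f) \<Rightarrow> ('f, 'v) free_algebra set" where
  "clifford_relations scale q =
     {free_gen (u + v) - (free_gen u + free_gen v) | u v. True} \<union>
     {free_gen (scale a v) - free_const a * free_gen v | a v. True} \<union>
     {free_gen v * free_gen v - free_const (q v) | v. True}"

definition clifford_ideal ::
    "('f::field \<Rightarrow> 'v::ab_group_add \<Rightarrow> 'v) \<Rightarrow> ('v \<Rightarrow> 'f) \<Rightarrow> ('f, 'v) free_algebra set" where
  "clifford_ideal scale q = Idl\<^bsub>ring_of_type_algebra\<^esub> (clifford_relations scale q)"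

definition clifford_class ::
    "('f::field \<Rightarrow> 'v::ab_group_add \<Rightarrow> 'v) \<Rightarrow> ('v \<Rightarrow> 'f) \<Rightarrow> ('f, 'v) free_algebra
      \<Rightarrow> ('f, 'v) free_algebra set" where
  "clifford_class scale q x = clifford_ideal scale q +>\<^bsub>ring_of_type_algebra\<^esub> x"

definition clifford_algebra ::
    "('f::field \<Rightarrow> 'v::ab_group_add \<Rightarrow> 'v) \<Rightarrow> ('v \<Rightarrow> 'f)
      \<Rightarrow> ('f, ('f, 'v) free_algebra set) module" where
  "clifford_algebra scale q =
     (let C = ring_of_type_algebra Quot clifford_ideal scale q in
      ring.extend C
        (module.fields (\<lambda>a x. clifford_class scale q (free_const a) \<otimes>\<^bsub>C\<^esub> x)))"

definition clifford_gen ::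
    "('f::field \<Rightarrow> 'v::ab_group_add \<Rightarrow> 'v) \<Rightarrow> ('v \<Rightarrow> 'f) \<Rightarrow> 'v \<Rightarrow> ('f, 'v) free_algebra set" where
  "clifford_gen scale q v = clifford_class scale q (free_gen v)"

text \<open>The involution \<open>J\<^sub>\<tau>\<close>. Extensionality only pins down the values outside the carrier;
  existence and uniqueness are proved in \<open>clifford_involution_ex1\<close>.\<close>

definition is_clifford_involution ::
    "('f::field \<Rightarrow> 'v::ab_group_add \<Rightarrow> 'v) \<Rightarrow> ('v \<Rightarrow> 'f) \<Rightarrow> ('v \<Rightarrow> 'v)
      \<Rightarrow> (('f, 'v) free_algebra set \<Rightarrow> ('f, 'v) free_algebra set) \<Rightarrow> bool" where
  "is_clifford_involution scale q \<tau> J \<longleftrightarrow>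
     J \<in> extensional (carrier (clifford_algebra scale q)) \<and>
     algebra_involution (clifford_algebra scale q) J \<and>
     (\<forall>v. J (clifford_gen scale q v) = clifford_gen scale q (\<tau> v))"

definition clifford_involution ::
    "('f::field \<Rightarrow> 'v::ab_group_add \<Rightarrow> 'v) \<Rightarrow> ('v \<Rightarrow> 'f) \<Rightarrow> ('v \<Rightarrow> 'v)
      \<Rightarrow> ('f, 'v) free_algebra set \<Rightarrow> ('f, 'v) free_algebra set" where
  "clifford_involution scale q \<tau> = (THE J. is_clifford_involution scale q \<tau> J)"

lemma free_algebra_induct [case_names zero add single]:
  fixes p :: "('f::field, 'v) free_algebra"
  assumes "P 0" and "\<And>x y. P x \<Longrightarrow> P y \<Longrightarrow> P (x + y)"
    and "\<And>w c. P (Poly_Mapping.single w c)"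
  shows "P p"
proof (induction p rule: update_induct)
  case const
  have "Abs_poly_mapping (\<lambda>_. 0) = (0 :: ('f, 'v) free_algebra)" by simp
  with assms(1) show ?case by (simp only:)
next
  case (update f w c)
  have "Poly_Mapping.update w c f = f + Poly_Mapping.single w c"
    using update.hyps
    by (intro poly_mapping_eqI) (auto simp: lookup_update lookup_add lookup_single in_keys_iff)
  then show ?case using update assms by simp
qed

lemma ring_ring_of_type_algebra: "ring (ring_of_type_algebra :: 'a::ring_1 ring)"
proof -
  have "\<exists>y. y + x = 0" for x :: 'a
    using add.left_inverse by blast
  then show ?thesis
    by (intro ringI abelian_groupI monoidI)
       (auto simp: ring_of_type_algebra_def algebra_simps)
qed

lemma ideal_clifford: "ideal (clifford_ideal scale q) ring_of_type_algebra"
  unfolding clifford_ideal_def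
  by (intro ring.genideal_ideal ring_ring_of_type_algebra)
     (simp add: ring_of_type_algebra_def)

lemma clifford_class_simps:
  "clifford_class scale q (x + y) = clifford_class scale q x \<oplus>\<^bsub>clifford_algebra scale q\<^esub> clifford_class scale q y"
  "clifford_class scale q (x * y) = clifford_class scale q x \<otimes>\<^bsub>clifford_algebra scale q\<^esub> clifford_class scale q y"
  "clifford_class scale q 1 = \<one>\<^bsub>clifford_algebra scale q\<^esub>"
  "clifford_class scale q (free_const a * x) = a \<odot>\<^bsub>clifford_algebra scale q\<^esub> clifford_class scale q x"
proof -
  interpret I: ideal "clifford_ideal scale q" ring_of_type_algebra by (rule ideal_clifford)
  note h = I.rcos_ring_hom
  show "clifford_class scale q (x + y) = clifford_class scale q x \<oplus>\<^bsub>clifford_algebra scale q\<^esub> clifford_class scale q y"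
    using ring_hom_add[OF h, of x y]
    by (simp add: clifford_class_def clifford_algebra_def Let_def ring.defs ring_of_type_algebra_def)
  show m: "clifford_class scale q (x * y) = clifford_class scale q x \<otimes>\<^bsub>clifford_algebra scale q\<^esub> clifford_class scale q y" for x y
    using ring_hom_mult[OF h, of x y]
    by (simp add: clifford_class_def clifford_algebra_def Let_def ring.defs ring_of_type_algebra_def)
  show "clifford_class scale q 1 = \<one>\<^bsub>clifford_algebra scale q\<^esub>"
    using ring_hom_one[OF h]
    by (simp add: clifford_class_def clifford_algebra_def Let_def ring.defs ring_of_type_algebra_def)
  show "clifford_class scale q (free_const a * x) = a \<odot>\<^bsub>clifford_algebra scale q\<^esub> clifford_class scale q x"
    unfolding m by (simp add: clifford_algebra_def Let_def ring.defs module.defs)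
qed

lemma carrier_clifford: "carrier (clifford_algebra scale q) = range (clifford_class scale q)"
  by (auto simp: clifford_algebra_def Let_def ring.defs FactRing_def A_RCOSETS_def RCOSETS_def
      clifford_class_def a_r_coset_def ring_of_type_algebra_def)

lemma clifford_class_eq_iff:
  fixes scale :: "'a::field \<Rightarrow> 'b::ab_group_add \<Rightarrow> 'b" and q :: "'b \<Rightarrow> 'a"
  shows "clifford_class scale q x = clifford_class scale q y \<longleftrightarrow> x - y \<in> clifford_ideal scale q"
proof -
  interpret R: ring "ring_of_type_algebra :: ('a, 'b) free_algebra ring"
    by (rule ring_ring_of_type_algebra)
  have neg: "\<ominus>\<^bsub>ring_of_type_algebra\<^esub> y = - y" for y :: "('a, 'b) free_algebra"
    by (rule R.minus_equality) (auto simp: ring_of_type_algebra_def)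
  have "x \<ominus>\<^bsub>ring_of_type_algebra\<^esub> y = x - y"
    unfolding a_minus_def neg by (simp add: ring_of_type_algebra_def)
  moreover have "(clifford_class scale q x = clifford_class scale q y) \<longleftrightarrow>
      x \<ominus>\<^bsub>ring_of_type_algebra\<^esub> y \<in> clifford_ideal scale q"
    unfolding clifford_class_def
    by (rule R.quotient_eq_iff_same_a_r_cos[OF ideal_clifford, symmetric])
       (auto simp: ring_of_type_algebra_def)
  ultimately show ?thesis by simp
qed

lemma involution_one:
  fixes scale q
  defines "A \<equiv> clifford_algebra scale q"
  assumes "algebra_involution A J"
  shows "J \<one>\<^bsub>A\<^esub> = \<one>\<^bsub>A\<^esub>"
proof -
  have l: "x \<otimes>\<^bsub>A\<^esub> \<one>\<^bsub>A\<^esub> = x" "\<one>\<^bsub>A\<^esub> \<otimes>\<^bsub>A\<^esub> x = x" if "x \<in> carrier A" for x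
    using that clifford_class_simps(2)[of scale q, where y = 1]
      clifford_class_simps(2)[of scale q 1]
    by (auto simp: A_def carrier_clifford clifford_class_simps(3))
  have o: "\<one>\<^bsub>A\<^esub> \<in> carrier A"
    unfolding A_def carrier_clifford by (metis clifford_class_simps(3) rangeI)
  then have J: "J \<one>\<^bsub>A\<^esub> \<in> carrier A" "J (J \<one>\<^bsub>A\<^esub>) = \<one>\<^bsub>A\<^esub>"
    using assms(2) by (auto simp: algebra_involution_def)
  have "J (J \<one>\<^bsub>A\<^esub> \<otimes>\<^bsub>A\<^esub> \<one>\<^bsub>A\<^esub>) = J \<one>\<^bsub>A\<^esub> \<otimes>\<^bsub>A\<^esub> J (J \<one>\<^bsub>A\<^esub>)"
    using assms(2) J o unfolding algebra_involution_def by blast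
  then show ?thesis using J l by simp
qed

lemma clifford_involution_unique:
  fixes scale :: "'a::field \<Rightarrow> 'b::ab_group_add \<Rightarrow> 'b" and q :: "'b \<Rightarrow> 'a"
  assumes J: "is_clifford_involution scale q \<tau> J" and K: "is_clifford_involution scale q \<tau> K"
  shows "J = K"
proof (rule extensionalityI)
  let ?A = "clifford_algebra scale q" and ?c = "clifford_class scale q"
  show "J \<in> extensional (carrier ?A)" "K \<in> extensional (carrier ?A)"
    using J K by (auto simp: is_clifford_involution_def)
  have c: "?c x \<in> carrier ?A" for x
    by (simp add: carrier_clifford)
  have iJ: "algebra_involution ?A J" and iK: "algebra_involution ?A K"
    and g: "\<And>v. J (?c (free_gen v)) = K (?c (free_gen v))"
    using J K by (auto simp: is_clifford_involution_def clifford_gen_def)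
  have hom_add: "L (?c (x + y)) = L (?c x) \<oplus>\<^bsub>?A\<^esub> L (?c y)"
    and mult: "L (?c (x * y)) = L (?c y) \<otimes>\<^bsub>?A\<^esub> L (?c x)"
    if "algebra_involution ?A L" for L x y
    using that by (simp_all add: algebra_involution_def c clifford_class_simps)
  have smult: "L (?c (free_const a * x)) = a \<odot>\<^bsub>?A\<^esub> L (?c x)"
    if "algebra_involution ?A L" for L x a
    using that by (simp add: algebra_involution_def c clifford_class_simps(4))
  have one: "J (?c 1) = K (?c 1)"
    using involution_one iJ iK by (metis clifford_class_simps(3))
  have word: "J (?c (Poly_Mapping.single (Word w) 1)) = K (?c (Poly_Mapping.single (Word w) 1))" for w
  proof (induction w)
    case Nil
    then show ?case using one by (simp flip: zero_free_monoid_def)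
  next
    case (Cons v w)
    have "Poly_Mapping.single (Word (v # w)) (1::'a) = free_gen v * Poly_Mapping.single (Word w) 1"
      by (simp add: free_gen_def mult_single plus_free_monoid_def)
    then show ?case by (simp add: mult iJ iK Cons.IH g)
  qed
  have "J (?c x) = K (?c x)" for x
  proof (induction x rule: free_algebra_induct)
    case zero
    have "(0 :: ('a, 'b) free_algebra) = free_const 0 * 1"
      by (simp add: free_const_def)
    then show ?case by (metis smult iJ iK one)
  next
    case (add x y)
    then show ?case by (simp add: hom_add iJ iK)
  next
    case (single w k)
    have "Poly_Mapping.single w k = free_const k * Poly_Mapping.single (Word (letters w)) 1"
      by (simp add: free_const_def mult_single)
    then show ?case using word[of "letters w"] by (simp add: smult iJ iK)
  qed
  then show "J S = K S" if "S \<in> carrier ?A" for S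
    using that by (auto simp: carrier_clifford)
qed

lemma clifford_involution_ex1:
  fixes scale :: "'a::field \<Rightarrow> 'b::ab_group_add \<Rightarrow> 'b" and q :: "'b \<Rightarrow> 'a"
  assumes \<tau>: "\<tau> \<in> orthogonal_group scale q" and inv: "\<tau> \<circ> \<tau> = id"
  shows "\<exists>!J. is_clifford_involution scale q \<tau> J"
proof -
  let ?A = "clifford_algebra scale q" and ?c = "clifford_class scale q"
  let ?I = "clifford_ideal scale q"
  define f where "f w = Word (rev (map \<tau> (letters w)))" for w
  define \<rho> where "\<rho> = (Poly_Mapping.map_key f :: ('a, 'b) free_algebra \<Rightarrow> _)"
  have ff: "f (f w) = w" for w
    using inv by (cases w) (simp add: f_def rev_map comp_def fun_eq_iff)
  then have inj: "inj f" by (metis injI)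
  have f_add: "f (x + y) = f y + f x" for x y
    by (simp add: f_def plus_free_monoid_def)
  have rho_add: "\<rho> (x + y) = \<rho> x + \<rho> y" for x y
    unfolding \<rho>_def by (rule map_key_plus[OF inj])
  have rho_single: "\<rho> (Poly_Mapping.single w c) = Poly_Mapping.single (f w) c" for w c
    unfolding \<rho>_def using map_key_single[OF inj, of "f w" c] by (simp add: ff)
  have zero: "\<rho> 0 = 0" by (simp add: \<rho>_def inj)
  have diff: "\<rho> (x - y) = \<rho> x - \<rho> y" for x y
    using rho_add[of "x - y" y] by simp
  have invol: "\<rho> (\<rho> x) = x" for x
    by (induction x rule: free_algebra_induct) (simp_all add: zero rho_add rho_single ff)
  have mult: "\<rho> (x * y) = \<rho> y * \<rho> x" for x y
  proof (induction x rule: free_algebra_induct)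
    case (single w c)
    then show ?case
      by (induction y rule: free_algebra_induct)
         (simp_all add: zero rho_add distrib_left distrib_right mult_single f_add mult.commute
           rho_single)
  qed (simp_all add: zero rho_add distrib_left distrib_right)
  have const: "\<rho> (free_const a) = free_const a" for a
    by (simp add: free_const_def rho_single) (simp add: f_def zero_free_monoid_def)
  have gen: "\<rho> (free_gen v) = free_gen (\<tau> v)" for v
    by (simp add: free_gen_def rho_single) (simp add: f_def)
  have central: "x * free_const a = free_const a * x" for x :: "('a, 'b) free_algebra" and a
    by (induction x rule: free_algebra_induct)
       (simp_all add: distrib_left distrib_right free_const_def mult_single mult.commute)
  have \<tau>_add: "\<tau> (u + v) = \<tau> u + \<tau> v" and \<tau>_scale: "\<tau> (scale a v) = scale a (\<tau> v)"
    and \<tau>_q: "q (\<tau> v) = q v" for u v a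
    using \<tau> by (auto simp: orthogonal_group_def Vector_Spaces.linear_def
        module_hom.add module_hom.scale)
  have rel: "\<rho> x \<in> clifford_relations scale q" if "x \<in> clifford_relations scale q" for x
  proof -
    from that consider u v where "x = free_gen (u + v) - (free_gen u + free_gen v)"
      | a v where "x = free_gen (scale a v) - free_const a * free_gen v"
      | v where "x = free_gen v * free_gen v - free_const (q v)"
      unfolding clifford_relations_def by blast
    then show ?thesis
    proof cases
      case 1
      then have "\<rho> x = free_gen (\<tau> u + \<tau> v) - (free_gen (\<tau> u) + free_gen (\<tau> v))"
        by (simp only: diff rho_add gen \<tau>_add)
      then show ?thesis unfolding clifford_relations_def by blast
    next
      case 2
      then have "\<rho> x = free_gen (scale a (\<tau> v)) - free_const a * free_gen (\<tau> v)"
        by (simp only: diff mult const gen \<tau>_scale central)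
      then show ?thesis unfolding clifford_relations_def by blast
    next
      case 3
      then have "\<rho> x = free_gen (\<tau> v) * free_gen (\<tau> v) - free_const (q (\<tau> v))"
        by (simp only: diff mult const gen \<tau>_q)
      then show ?thesis unfolding clifford_relations_def by blast
    qed
  qed
  interpret R: ring "ring_of_type_algebra :: ('a, 'b) free_algebra ring"
    by (rule ring_ring_of_type_algebra)
  interpret I: ideal ?I ring_of_type_algebra by (rule ideal_clifford)
  have neg: "\<ominus>\<^bsub>ring_of_type_algebra\<^esub> y = - y" for y :: "('a, 'b) free_algebra"
    by (rule R.minus_equality) (auto simp: ring_of_type_algebra_def)
  have I_add: "x + y \<in> ?I" if "x \<in> ?I" "y \<in> ?I" for x y
    using I.a_closed[OF that] by (simp add: ring_of_type_algebra_def)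
  have I_neg: "- x \<in> ?I" if "x \<in> ?I" for x
    using I.a_inv_closed[OF that] by (simp add: neg)
  have I_zero: "0 \<in> ?I"
    using I.zero_closed by (simp add: ring_of_type_algebra_def)
  have I_l: "x * y \<in> ?I" and I_r: "y * x \<in> ?I" if "y \<in> ?I" for x y
    using I.I_l_closed[OF that, of x] I.I_r_closed[OF that, of x]
    by (simp_all add: ring_of_type_algebra_def)
  have rho_neg: "\<rho> (- x) = - \<rho> x" for x
    using diff[of 0 x] by (simp add: zero)
  have "ideal {x. \<rho> x \<in> ?I} ring_of_type_algebra"
  proof (rule idealI[OF ring_ring_of_type_algebra])
    show "subgroup {x. \<rho> x \<in> ?I} (add_monoid ring_of_type_algebra)"
    proof (rule group.subgroupI[OF R.a_group])
      fix a :: "('a, 'b) free_algebra" assume "a \<in> {x. \<rho> x \<in> ?I}"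
      then have "- a \<in> {x. \<rho> x \<in> ?I}" using I_neg rho_neg by simp
      then show "inv\<^bsub>add_monoid ring_of_type_algebra\<^esub> a \<in> {x. \<rho> x \<in> ?I}"
        using neg unfolding a_inv_def by simp
    qed (use I_zero I_add in \<open>auto simp: ring_of_type_algebra_def zero rho_add intro!: exI[of _ 0]\<close>)
  qed (use I_l I_r in \<open>auto simp: ring_of_type_algebra_def mult\<close>)
  then have "?I \<subseteq> {x. \<rho> x \<in> ?I}"
    unfolding clifford_ideal_def
    using rel R.genideal_self[of "clifford_relations scale q"]
    by (intro R.genideal_minimal) (auto simp: ring_of_type_algebra_def)
  then have wd: "?c (\<rho> x) = ?c (\<rho> y)" if "?c x = ?c y" for x y
    using that by (auto simp: clifford_class_eq_iff simp flip: diff)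
  define J where "J = restrict (\<lambda>S. ?c (\<rho> (SOME x. ?c x = S))) (carrier ?A)"
  have J: "J (?c x) = ?c (\<rho> x)" for x
  proof -
    have "?c (SOME y. ?c y = ?c x) = ?c x" by (rule someI) simp
    from wd[OF this] show ?thesis by (simp add: J_def carrier_clifford)
  qed
  have "is_clifford_involution scale q \<tau> J"
    unfolding is_clifford_involution_def algebra_involution_def
  proof (intro conjI ballI allI)
    show "J \<in> extensional (carrier ?A)" by (simp add: J_def)
    show "J \<in> carrier ?A \<rightarrow> carrier ?A" by (auto simp: carrier_clifford J)
    show "J (clifford_gen scale q v) = clifford_gen scale q (\<tau> v)" for v
      by (simp add: clifford_gen_def J gen)
    fix S assume "S \<in> carrier ?A"
    then obtain x where x: "S = ?c x" by (auto simp: carrier_clifford)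
    show "J (J S) = S" by (simp add: x J invol)
    show "J (a \<odot>\<^bsub>?A\<^esub> S) = a \<odot>\<^bsub>?A\<^esub> J S" for a
      by (simp add: x J mult const central flip: clifford_class_simps)
    fix T assume "T \<in> carrier ?A"
    then obtain y where y: "T = ?c y" by (auto simp: carrier_clifford)
    show "J (S \<oplus>\<^bsub>?A\<^esub> T) = J S \<oplus>\<^bsub>?A\<^esub> J T"
      by (simp add: x y J rho_add flip: clifford_class_simps)
    show "J (S \<otimes>\<^bsub>?A\<^esub> T) = J T \<otimes>\<^bsub>?A\<^esub> J S"
      by (simp add: x y J mult flip: clifford_class_simps)
  qed
  then show ?thesis using clifford_involution_unique by blast
qed

end

theory Submission
  imports Defs
begin

text \<open>In characteristic two the Wall form satisfies \<open>\<omega>(x, x) = q x\<close> on \<open>Res \<tau>\<close>, and an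
  isomorphism with \<open>(M\<^sub>N(F), t)\<close> sends a fixed vector \<open>x\<close> to a symmetric matrix with square
  \<open>q x\<close>, so \<open>q x\<close> is the sum of the squares of the first row, hence a square. Conversely,
  if all values \<open>\<omega>(x, x)\<close> are squares, \<open>\<omega>\<close> has an orthonormal or a symplectic basis.
  Since \<open>Res \<tau> = Fix \<tau>\<close> is its own orthogonal complement, this basis extends to a basis of
  \<open>V\<close> on which \<open>q\<close>, its polar form and \<open>\<tau>\<close> decompose into blocks of dimension two or four.
  Each block is modelled by explicit matrices, and the blocks are glued by Kronecker products.
  The resulting homomorphism from the Clifford algebra is injective because that algebra is
  simple.\<close>

text \<open>Signs vanish in characteristic two, so the Clifford algebra of an orthogonal sum is the
  ordinary tensor product of the Clifford algebras and not just a graded one; this is why Kronecker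
  products can glue blocks. If \<open>w = \<tau> y - y\<close>, the polar form of \<open>w\<close>
  and \<open>y\<close> is the Wall form of \<open>w\<close> with itself. In the alternating case
  \<open>y\<close> is therefore never dual to its own \<open>w\<close>, two such pairs have to be
  treated together, and the blocks get dimension four. The dimension of the Clifford algebra is
  never computed. Surjectivity comes from demanding that each block generate its full matrix
  algebra, a property inherited by Kronecker products. Simplicity comes from commutators: they
  reduce an element of a proper ideal, written in ordered products of basis vectors, to a scalar. On
  the side of forms the obstacle is that the complement of a badly chosen unit vector may be
  alternating although the whole form is not; the unit vector then has to be exchanged.\<close>

lemma char_2_add_self:
  fixes a :: "'a::comm_ring_1"
  assumes "CHAR('a) = 2"
  shows "a + a = 0" and "a + (a + b) = b" and "- a = a"
proof -
  have two: "(1::'a) + 1 = 0"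
    using of_nat_CHAR[where 'a='a] by (simp add: assms)
  show *: "a + a = 0"
    using arg_cong[OF two, of "\<lambda>x. a * x"] by (simp only: distrib_left mult_1_right mult_zero_right)
  then show "a + (a + b) = b" by (simp flip: add.assoc)
  from * show "- a = a" by (rule minus_unique)
qed


section \<open>Kronecker products and matrix models\<close>

text \<open>Writing \<open>c = a * k + b\<close> cuts the range into \<open>m\<close> runs of length
  \<open>k\<close>. This is the index bookkeeping behind products of Kronecker matrices.\<close>

lemma sum_div_mod:
  fixes f :: "nat \<Rightarrow> nat \<Rightarrow> 'a::comm_monoid_add"
  shows "(\<Sum>c<m * k. f (c div k) (c mod k)) = (\<Sum>a<m. \<Sum>b<k. f a b)"
proof -
  have "(\<Sum>c<m * k. f (c div k) (c mod k)) =
      (\<Sum>a<m. \<Sum>c\<in>{a * k..<a * k + k}. f (c div k) (c mod k))"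
    by (rule sum.nat_group[symmetric])
  also have "\<dots> = (\<Sum>a<m. \<Sum>b<k. f a b)"
  proof (rule sum.cong[OF refl])
    fix a
    have "(\<Sum>c\<in>{a * k..<a * k + k}. f (c div k) (c mod k)) =
        (\<Sum>b\<in>{0..<k}. f ((b + a * k) div k) ((b + a * k) mod k))"
      using sum.shift_bounds_nat_ivl[of "\<lambda>c. f (c div k) (c mod k)" 0 "a * k" k]
      by (simp add: add.commute)
    also have "\<dots> = (\<Sum>b<k. f a b)"
      by (intro sum.cong) auto
    finally show "(\<Sum>c\<in>{a * k..<a * k + k}. f (c div k) (c mod k)) = (\<Sum>b<k. f a b)" .
  qed
  finally show ?thesis .
qed

definition kron :: "'a::semiring_0 mat \<Rightarrow> 'a mat \<Rightarrow> 'a mat" where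
  "kron A B = mat (dim_row A * dim_row B) (dim_col A * dim_col B)
     (\<lambda>(i, j). A $$ (i div dim_row B, j div dim_col B) * B $$ (i mod dim_row B, j mod dim_col B))"

lemma kron_carrier [simp]:
  "A \<in> carrier_mat a b \<Longrightarrow> B \<in> carrier_mat c d \<Longrightarrow> kron A B \<in> carrier_mat (a * c) (b * d)"
  by (auto simp: kron_def)

lemma div_mod_less_mult:
  fixes i :: nat
  assumes "i < a * b"
  shows "i div b < a" "i mod b < b"
proof -
  from assms have "0 < b" by (cases b) auto
  with assms show "i div b < a" "i mod b < b"
    by (auto simp: less_mult_imp_div_less)
qed

lemma kron_index:
  assumes "A \<in> carrier_mat a b" "B \<in> carrier_mat c d" "i < a * c" "j < b * d"
  shows "kron A B $$ (i, j) = A $$ (i div c, j div d) * B $$ (i mod c, j mod d)"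
  using assms by (auto simp: kron_def)

text \<open>The mixed product rule: the summation index of the matrix product is a pair in disguise,
  so the double sum factors once the two middle entries are interchanged.\<close>

lemma kron_mult:
  fixes A :: "'a::comm_semiring_0 mat"
  assumes "A \<in> carrier_mat a b" "B \<in> carrier_mat a' b'" "C \<in> carrier_mat b c" "D \<in> carrier_mat b' c'"
  shows "kron A B * kron C D = kron (A * C) (B * D)"
proof (rule eq_matI)
  fix i j assume "i < dim_row (kron (A * C) (B * D))" "j < dim_col (kron (A * C) (B * D))"
  with assms have i: "i < a * a'" and j: "j < c * c'" by (auto simp: kron_def)
  note dm = div_mod_less_mult[OF i] div_mod_less_mult[OF j]
  have "(kron A B * kron C D) $$ (i, j) = (\<Sum>k<b * b'. kron A B $$ (i, k) * kron C D $$ (k, j))"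
    using assms i j by (auto simp: scalar_prod_def kron_def atLeast0LessThan)
  also have "\<dots> = (\<Sum>k<b * b'. A $$ (i div a', k div b') * B $$ (i mod a', k mod b') *
      (C $$ (k div b', j div c') * D $$ (k mod b', j mod c')))"
    using assms i j by (intro sum.cong refl) (simp add: kron_index[of _ a b _ a' b'] kron_index[of _ b c _ b' c'])
  also have "\<dots> = (\<Sum>k<b. \<Sum>l<b'. A $$ (i div a', k) * B $$ (i mod a', l) *
      (C $$ (k, j div c') * D $$ (l, j mod c')))"
    by (rule sum_div_mod)
  also have "\<dots> = (\<Sum>k<b. \<Sum>l<b'. (A $$ (i div a', k) * C $$ (k, j div c')) *
      (B $$ (i mod a', l) * D $$ (l, j mod c')))"
    by (simp add: mult_ac)
  also have "\<dots> = (A * C) $$ (i div a', j div c') * (B * D) $$ (i mod a', j mod c')"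
    using assms i j dm by (simp add: scalar_prod_def sum_product atLeast0LessThan)
  also have "\<dots> = kron (A * C) (B * D) $$ (i, j)"
    using assms i j by (simp add: kron_index[of _ a c _ a' c'])
  finally show "(kron A B * kron C D) $$ (i, j) = kron (A * C) (B * D) $$ (i, j)" .
qed (use assms in \<open>auto simp: kron_def\<close>)

lemma kron_one: "kron (1\<^sub>m a) (1\<^sub>m b) = (1\<^sub>m (a * b) :: 'a::semiring_1 mat)"
proof (rule eq_matI)
  fix i j assume "i < dim_row (1\<^sub>m (a * b) :: 'a mat)" "j < dim_col (1\<^sub>m (a * b) :: 'a mat)"
  then have i: "i < a * b" and j: "j < a * b" by auto
  have "i = j \<longleftrightarrow> i div b = j div b \<and> i mod b = j mod b"
    by (metis div_mult_mod_eq)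
  then show "kron (1\<^sub>m a) (1\<^sub>m b) $$ (i, j) = (1\<^sub>m (a * b) :: 'a mat) $$ (i, j)"
    using i j div_mod_less_mult[OF i] div_mod_less_mult[OF j]
    by (simp add: kron_index[of _ a a _ b b])
qed (auto simp: kron_def)

lemma kron_transpose: "transpose_mat (kron A B) = kron (transpose_mat A) (transpose_mat B)"
proof (rule eq_matI)
  fix i j assume "i < dim_row (kron (transpose_mat A) (transpose_mat B))"
    "j < dim_col (kron (transpose_mat A) (transpose_mat B))"
  then have i: "i < dim_col A * dim_col B" and j: "j < dim_row A * dim_row B"
    by (auto simp: kron_def)
  show "transpose_mat (kron A B) $$ (i, j) = kron (transpose_mat A) (transpose_mat B) $$ (i, j)"
    using i j div_mod_less_mult[OF i] div_mod_less_mult[OF j] by (simp add: kron_def)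
qed (auto simp: kron_def)

lemma kron_add_left:
  fixes B :: "'a::semiring_0 mat"
  assumes "A \<in> carrier_mat a b" "A' \<in> carrier_mat a b"
  shows "kron (A + A') B = kron A B + kron A' B"
proof (rule eq_matI)
  fix i j assume "i < dim_row (kron A B + kron A' B)" "j < dim_col (kron A B + kron A' B)"
  with assms have i: "i < a * dim_row B" and j: "j < b * dim_col B" by (auto simp: kron_def)
  show "kron (A + A') B $$ (i, j) = (kron A B + kron A' B) $$ (i, j)"
    using assms i j div_mod_less_mult[OF i] div_mod_less_mult[OF j]
    by (simp add: kron_def distrib_right)
qed (use assms in \<open>auto simp: kron_def\<close>)

lemma kron_add_right:
  fixes A :: "'a::semiring_0 mat"
  assumes "B \<in> carrier_mat a b" "B' \<in> carrier_mat a b"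
  shows "kron A (B + B') = kron A B + kron A B'"
proof (rule eq_matI)
  fix i j assume "i < dim_row (kron A B + kron A B')" "j < dim_col (kron A B + kron A B')"
  with assms have i: "i < dim_row A * a" and j: "j < dim_col A * b" by (auto simp: kron_def)
  show "kron A (B + B') $$ (i, j) = (kron A B + kron A B') $$ (i, j)"
    using assms i j div_mod_less_mult[OF i] div_mod_less_mult[OF j]
    by (simp add: kron_def distrib_left)
qed (use assms in \<open>auto simp: kron_def\<close>)

lemma kron_smult_left: "kron (c \<cdot>\<^sub>m A) B = c \<cdot>\<^sub>m kron A (B :: 'a::comm_semiring_0 mat)"
proof (rule eq_matI)
  fix i j assume "i < dim_row (c \<cdot>\<^sub>m kron A B)" "j < dim_col (c \<cdot>\<^sub>m kron A B)"
  then have i: "i < dim_row A * dim_row B" and j: "j < dim_col A * dim_col B" by (auto simp: kron_def)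
  show "kron (c \<cdot>\<^sub>m A) B $$ (i, j) = (c \<cdot>\<^sub>m kron A B) $$ (i, j)"
    using i j div_mod_less_mult[OF i] div_mod_less_mult[OF j] by (simp add: kron_def mult_ac)
qed (auto simp: kron_def)

lemma kron_smult_right: "kron A (c \<cdot>\<^sub>m B) = c \<cdot>\<^sub>m kron A (B :: 'a::comm_semiring_0 mat)"
proof (rule eq_matI)
  fix i j assume "i < dim_row (c \<cdot>\<^sub>m kron A B)" "j < dim_col (c \<cdot>\<^sub>m kron A B)"
  then have i: "i < dim_row A * dim_row B" and j: "j < dim_col A * dim_col B" by (auto simp: kron_def)
  show "kron A (c \<cdot>\<^sub>m B) $$ (i, j) = (c \<cdot>\<^sub>m kron A B) $$ (i, j)"
    using i j div_mod_less_mult[OF i] div_mod_less_mult[OF j] by (simp add: kron_def mult_ac)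
qed (auto simp: kron_def)

section \<open>Generating full matrix algebras, and matrix models of Clifford relations\<close>

definition matrix_subalgebra :: "nat \<Rightarrow> 'a::semiring_1 mat set \<Rightarrow> bool" where
  "matrix_subalgebra N S \<longleftrightarrow> S \<subseteq> carrier_mat N N \<and> 1\<^sub>m N \<in> S \<and>
     (\<forall>A\<in>S. \<forall>B\<in>S. A + B \<in> S \<and> A * B \<in> S) \<and> (\<forall>c. \<forall>A\<in>S. c \<cdot>\<^sub>m A \<in> S)"

lemma matrix_subalgebraD:
  assumes "matrix_subalgebra N S"
  shows "S \<subseteq> carrier_mat N N" "1\<^sub>m N \<in> S" "A \<in> S \<Longrightarrow> B \<in> S \<Longrightarrow> A + B \<in> S"
    "A \<in> S \<Longrightarrow> B \<in> S \<Longrightarrow> A * B \<in> S" "A \<in> S \<Longrightarrow> c \<cdot>\<^sub>m A \<in> S"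
  using assms by (auto simp: matrix_subalgebra_def)

text \<open>Phrased through all subalgebras rather than through spans of words: it can be applied
  directly to the image of a homomorphism, and subalgebras can be pulled back along
  embeddings.\<close>

definition generates_matrices :: "nat \<Rightarrow> 'a::semiring_1 mat set \<Rightarrow> bool" where
  "generates_matrices N G \<longleftrightarrow> (\<forall>S. matrix_subalgebra N S \<longrightarrow> G \<subseteq> S \<longrightarrow> carrier_mat N N \<subseteq> S)"

definition matrix_unit :: "nat \<Rightarrow> nat \<Rightarrow> nat \<Rightarrow> 'a::semiring_1 mat" where
  "matrix_unit N i j = mat N N (\<lambda>p. if p = (i, j) then 1 else 0)"

lemma matrix_unit_carrier [simp]: "matrix_unit N i j \<in> carrier_mat N N"
  by (simp add: matrix_unit_def)

lemma matrix_units_generate: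
  fixes S :: "'a::comm_ring_1 mat set"
  assumes S: "matrix_subalgebra N S" and U: "\<And>i j. i < N \<Longrightarrow> j < N \<Longrightarrow> matrix_unit N i j \<in> S"
  shows "carrier_mat N N \<subseteq> S"
proof
  fix A :: "'a mat" assume A: "A \<in> carrier_mat N N"
  \<comment> \<open>Induction over the set \<open>T\<close> of positions already filled in, starting
    from the zero matrix, which lies in \<open>S\<close> as a multiple of the identity.\<close>
  have "mat N N (\<lambda>p. if p \<in> T then A $$ p else 0) \<in> S"
    if "finite T" "T \<subseteq> {..<N} \<times> {..<N}" for T
    using that
  proof (induction T rule: finite_induct)
    case empty
    have "mat N N (\<lambda>p. if p \<in> {} then A $$ p else 0) = 0 \<cdot>\<^sub>m 1\<^sub>m N"
      by (rule eq_matI) auto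
    then show ?case using matrix_subalgebraD(2,5)[OF S] by simp
  next
    case (insert p T)
    obtain i j where p: "p = (i, j)" by (cases p)
    with insert have ij: "i < N" "j < N" by auto
    have "mat N N (\<lambda>p'. if p' \<in> insert p T then A $$ p' else 0) =
        mat N N (\<lambda>p. if p \<in> T then A $$ p else 0) + A $$ (i, j) \<cdot>\<^sub>m matrix_unit N i j"
      using insert.hyps p by (intro eq_matI) (auto simp: matrix_unit_def)
    then show ?case
      using insert U[OF ij] matrix_subalgebraD(3,5)[OF S] by simp
  qed
  from this[of "{..<N} \<times> {..<N}"]
  have "mat N N (\<lambda>p. if p \<in> {..<N} \<times> {..<N} then A $$ p else 0) \<in> S" by simp
  also have "mat N N (\<lambda>p. if p \<in> {..<N} \<times> {..<N} then A $$ p else 0) = A"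
    using A by (intro eq_matI) auto
  finally show "A \<in> S" .
qed

text \<open>The preimages \<open>L\<close> and \<open>R\<close> of a subalgebra under the embeddings
  of the two factors are subalgebras that contain the given generators, hence are everything. A
  matrix unit of the product is one from the left factor times one from the right factor.\<close>

lemma generates_matrices_kron:
  fixes G Y :: "'a::comm_ring_1 mat set"
  assumes G: "generates_matrices M G" and Y: "generates_matrices N Y"
    and GM: "G \<subseteq> carrier_mat M M" and YN: "Y \<subseteq> carrier_mat N N"
  shows "generates_matrices (M * N) ((\<lambda>A. kron A (1\<^sub>m N)) ` G \<union> kron (1\<^sub>m M) ` Y)"
  unfolding generates_matrices_def
proof (intro allI impI)
  fix S :: "'a mat set"
  assume S: "matrix_subalgebra (M * N) S"
    and gen: "(\<lambda>A. kron A (1\<^sub>m N)) ` G \<union> kron (1\<^sub>m M) ` Y \<subseteq> S"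
  note S' = matrix_subalgebraD[OF S]
  have LL: "kron (A * B) (1\<^sub>m N) = kron A (1\<^sub>m N) * kron B (1\<^sub>m N)"
    if "A \<in> carrier_mat M M" "B \<in> carrier_mat M M" for A B :: "'a mat"
    using that by (simp add: kron_mult[of _ M M _ N N _ M _ N])
  have RR: "kron (1\<^sub>m M) (A * B) = kron (1\<^sub>m M) A * kron (1\<^sub>m M) B"
    if "A \<in> carrier_mat N N" "B \<in> carrier_mat N N" for A B :: "'a mat"
    using that by (simp add: kron_mult[of _ M M _ N N _ M _ N])
  define L where "L = {A \<in> carrier_mat M M. kron A (1\<^sub>m N) \<in> S}"
  define R where "R = {B \<in> carrier_mat N N. kron (1\<^sub>m M) B \<in> S}"
  have "matrix_subalgebra M L"
    unfolding matrix_subalgebra_def L_def using S'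
    by (auto simp: kron_one kron_add_left kron_smult_left LL)
  moreover have "G \<subseteq> L" using gen GM by (auto simp: L_def)
  ultimately have L: "carrier_mat M M \<subseteq> L" using G by (simp add: generates_matrices_def)
  have "matrix_subalgebra N R"
    unfolding matrix_subalgebra_def R_def using S'
    by (auto simp: kron_one kron_add_right kron_smult_right RR)
  moreover have "Y \<subseteq> R" using gen YN by (auto simp: R_def)
  ultimately have R: "carrier_mat N N \<subseteq> R" using Y by (simp add: generates_matrices_def)
  show "carrier_mat (M * N) (M * N) \<subseteq> S"
  proof (rule matrix_units_generate[OF S])
    fix i j assume i: "i < M * N" and j: "j < M * N"
    let ?A = "matrix_unit M (i div N) (j div N) :: 'a mat"
      and ?B = "matrix_unit N (i mod N) (j mod N) :: 'a mat"
    have "matrix_unit (M * N) i j = kron ?A ?B"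
    proof (rule eq_matI)
      fix k l assume "k < dim_row (kron ?A ?B)" "l < dim_col (kron ?A ?B)"
      then have k: "k < M * N" and l: "l < M * N" by (auto simp: kron_def matrix_unit_def)
      have "k = i \<longleftrightarrow> k div N = i div N \<and> k mod N = i mod N" "l = j \<longleftrightarrow> l div N = j div N \<and> l mod N = j mod N"
        by (metis div_mult_mod_eq)+
      then show "matrix_unit (M * N) i j $$ (k, l) = kron ?A ?B $$ (k, l)"
        using k l div_mod_less_mult[OF k] div_mod_less_mult[OF l]
        by (simp add: kron_index[of _ M M _ N N]) (auto simp: matrix_unit_def)
    qed (auto simp: kron_def matrix_unit_def)
    also have "\<dots> = kron ?A (1\<^sub>m N) * kron (1\<^sub>m M) ?B"
      by (subst kron_mult[of _ M M _ N N _ M _ N]) (auto simp: right_mult_one_mat[of _ M M] left_mult_one_mat[of _ N N])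
    finally have eq: "matrix_unit (M * N) i j = kron ?A (1\<^sub>m N) * kron (1\<^sub>m M) ?B" .
    have "?A \<in> L" "?B \<in> R" using L R matrix_unit_carrier by blast+
    then show "matrix_unit (M * N) i j \<in> S"
      unfolding eq L_def R_def using S'(4) by blast
  qed
qed

text \<open>In a model with an even number of generators the generators come in pairs \<open>(w, y)\<close>, at
  positions \<open>2 i\<close> and \<open>2 i + 1\<close>, where \<open>w\<close> is fixed by \<open>\<tau>\<close> and \<open>\<tau> y = y + w\<close>.\<close>

definition clifford_model ::
    "nat \<Rightarrow> nat \<Rightarrow> (nat \<Rightarrow> 'f::field) \<Rightarrow> (nat \<Rightarrow> nat \<Rightarrow> 'f) \<Rightarrow> (nat \<Rightarrow> 'f mat) \<Rightarrow> bool" where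
  "clifford_model m N c \<beta> G \<longleftrightarrow>
     (\<forall>k<m. G k \<in> carrier_mat N N \<and> G k * G k = c k \<cdot>\<^sub>m 1\<^sub>m N \<and>
        transpose_mat (G k) = (if odd k then G k + G (k - 1) else G k)) \<and>
     (\<forall>k<m. \<forall>l<m. k \<noteq> l \<longrightarrow> G k * G l + G l * G k = \<beta> k l \<cdot>\<^sub>m 1\<^sub>m N) \<and>
     generates_matrices N (G ` {..<m})"

text \<open>The Clifford algebra of the zero space is the field itself; this starts the inductions
  over blocks.\<close>

lemma clifford_model_empty: "clifford_model 0 1 c \<beta> (G :: nat \<Rightarrow> 'f::field mat)"
proof -
  have "generates_matrices 1 ({} :: 'f mat set)"
    unfolding generates_matrices_def
  proof (intro allI impI)
    fix S :: "'f mat set" assume S: "matrix_subalgebra 1 S"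
    have "A \<in> S" if A: "A \<in> carrier_mat 1 1" for A
    proof -
      have "A = A $$ (0, 0) \<cdot>\<^sub>m 1\<^sub>m 1" using A by (intro eq_matI) auto
      then show "A \<in> S" using matrix_subalgebraD(2,5)[OF S] by metis
    qed
    then show "carrier_mat 1 1 \<subseteq> S" by auto
  qed
  then show ?thesis by (simp add: clifford_model_def)
qed

text \<open>Generators from different factors commute, and in characteristic two commuting elements
  also anticommute, as orthogonality requires. Evenness of \<open>m\<close> keeps the parity of
  positions, so that no pair \<open>(w, y)\<close> is torn apart by the shift.\<close>

lemma clifford_model_kron:
  fixes G Y :: "nat \<Rightarrow> 'f::field mat"
  assumes char: "CHAR('f) = 2" and m: "even m"
    and G: "clifford_model m M c \<beta> G"
    and Y: "clifford_model n N (\<lambda>k. c (k + m)) (\<lambda>k l. \<beta> (k + m) (l + m)) Y"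
    and \<beta>: "\<And>k l. k < m \<Longrightarrow> m \<le> l \<Longrightarrow> l < m + n \<Longrightarrow> \<beta> k l = 0 \<and> \<beta> l k = 0"
  shows "clifford_model (m + n) (M * N) c \<beta>
    (\<lambda>k. if k < m then kron (G k) (1\<^sub>m N) else kron (1\<^sub>m M) (Y (k - m)))"
proof -
  let ?Z = "\<lambda>k. if k < m then kron (G k) (1\<^sub>m N) else kron (1\<^sub>m M) (Y (k - m))"
  note dbl = char_2_add_self(1)[OF char]
  have Xc: "G k \<in> carrier_mat M M" "G k * G k = c k \<cdot>\<^sub>m 1\<^sub>m M"
      "transpose_mat (G k) = (if odd k then G k + G (k - 1) else G k)" if "k < m" for k
    using G that by (auto simp: clifford_model_def)
  have Yc: "Y k \<in> carrier_mat N N" "Y k * Y k = c (k + m) \<cdot>\<^sub>m 1\<^sub>m N"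
      "transpose_mat (Y k) = (if odd k then Y k + Y (k - 1) else Y k)" if "k < n" for k
    using Y that by (auto simp: clifford_model_def)
  have Xa: "G k * G l + G l * G k = \<beta> k l \<cdot>\<^sub>m 1\<^sub>m M" if "k < m" "l < m" "k \<noteq> l" for k l
    using G that by (auto simp: clifford_model_def)
  have Ya: "Y k * Y l + Y l * Y k = \<beta> (k + m) (l + m) \<cdot>\<^sub>m 1\<^sub>m N" if "k < n" "l < n" "k \<noteq> l" for k l
    using Y that by (auto simp: clifford_model_def)
  have LL: "kron A (1\<^sub>m N) * kron B (1\<^sub>m N) = kron (A * B) (1\<^sub>m N)"
    if "A \<in> carrier_mat M M" "B \<in> carrier_mat M M" for A B :: "'f mat"
    using that by (simp add: kron_mult[of _ M M _ N N _ M _ N])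
  have RR: "kron (1\<^sub>m M) A * kron (1\<^sub>m M) B = kron (1\<^sub>m M) (A * B)"
    if "A \<in> carrier_mat N N" "B \<in> carrier_mat N N" for A B :: "'f mat"
    using that by (simp add: kron_mult[of _ M M _ N N _ M _ N])
  have LR: "kron A (1\<^sub>m N) * kron (1\<^sub>m M) B + kron (1\<^sub>m M) B * kron A (1\<^sub>m N) = 0 \<cdot>\<^sub>m 1\<^sub>m (M * N)"
    "kron (1\<^sub>m M) B * kron A (1\<^sub>m N) + kron A (1\<^sub>m N) * kron (1\<^sub>m M) B = 0 \<cdot>\<^sub>m 1\<^sub>m (M * N)"
    if "A \<in> carrier_mat M M" "B \<in> carrier_mat N N" for A B :: "'f mat"
  proof -
    have "kron A (1\<^sub>m N) * kron (1\<^sub>m M) B = kron A B" "kron (1\<^sub>m M) B * kron A (1\<^sub>m N) = kron A B"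
      using that by (simp_all add: kron_mult[of _ M M _ N N _ M _ N])
    moreover have "kron A B + kron A B = 0 \<cdot>\<^sub>m 1\<^sub>m (M * N)"
      using kron_carrier[OF that] dbl by (intro eq_matI) auto
    ultimately show "kron A (1\<^sub>m N) * kron (1\<^sub>m M) B + kron (1\<^sub>m M) B * kron A (1\<^sub>m N) = 0 \<cdot>\<^sub>m 1\<^sub>m (M * N)"
      "kron (1\<^sub>m M) B * kron A (1\<^sub>m N) + kron A (1\<^sub>m N) * kron (1\<^sub>m M) B = 0 \<cdot>\<^sub>m 1\<^sub>m (M * N)"
      by simp_all
  qed
  show ?thesis
    unfolding clifford_model_def
  proof (intro conjI allI impI)
    fix k assume k: "k < m + n"
    have kn: "k - m < n" if "\<not> k < m" using that k by simp
    show "?Z k \<in> carrier_mat (M * N) (M * N)"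
      using Xc(1) Yc(1)[OF kn] by simp
    show "?Z k * ?Z k = c k \<cdot>\<^sub>m 1\<^sub>m (M * N)"
      using Xc(1,2)[of k] Yc(1,2)[OF kn]
      by (simp add: LL RR kron_smult_left kron_smult_right kron_one)
    show "transpose_mat (?Z k) = (if odd k then ?Z k + ?Z (k - 1) else ?Z k)"
    proof (cases "k < m")
      case True
      then show ?thesis
        using Xc(1,3)[of k] Xc(1)[of "k - 1"] by (auto simp: kron_transpose kron_add_left[of _ M M])
    next
      case False
      have odd: "odd (k - m) = odd k" using False m by simp
      show ?thesis
      proof (cases "odd k")
        case True
        \<comment> \<open>An odd \<open>k\<close> differs from the even \<open>m\<close>, so the
          predecessor of \<open>k\<close> still belongs to the second factor.\<close>
        with m False have "m < k" by (metis nat_neq_iff)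
        then have "\<not> k - 1 < m" "k - 1 - m = k - m - 1" "k - m - 1 < n"
          using k by auto
        with True False show ?thesis
          using Yc(1,3)[OF kn] Yc(1)[of "k - m - 1"] odd
          by (simp add: kron_transpose kron_add_right[of _ N N])
      qed (use False odd Yc(3)[OF kn] in \<open>simp add: kron_transpose\<close>)
    qed
    fix l assume l: "l < m + n" and kl: "k \<noteq> l"
    have ln: "l - m < n" if "\<not> l < m" using that l by simp
    consider "k < m" "l < m" | "k < m" "\<not> l < m" | "\<not> k < m" "l < m" | "\<not> k < m" "\<not> l < m"
      by blast
    then show "?Z k * ?Z l + ?Z l * ?Z k = \<beta> k l \<cdot>\<^sub>m 1\<^sub>m (M * N)"
    proof cases
      case 1
      then show ?thesis using Xc(1)[of k] Xc(1)[of l] Xa[of k l] kl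
        by (simp add: LL kron_smult_left kron_one flip: kron_add_left[of _ M M])
    next
      case 2
      then show ?thesis using Xc(1)[of k] Yc(1)[OF ln] \<beta>[of k l] l by (simp add: LR)
    next
      case 3
      then show ?thesis using Xc(1)[of l] Yc(1)[OF kn] \<beta>[of l k] k by (simp add: LR)
    next
      case 4
      then show ?thesis using Yc(1)[OF kn] Yc(1)[OF ln] Ya[OF kn ln] kl
        by (simp add: RR kron_smult_right kron_one flip: kron_add_right[of _ N N])
    qed
  next
    have "?Z ` {..<m + n} = (\<lambda>A. kron A (1\<^sub>m N)) ` (G ` {..<m}) \<union> kron (1\<^sub>m M) ` (Y ` {..<n})"
      (is "?P = ?Q")
    proof
      show "?P \<subseteq> ?Q" by (auto intro!: imageI)
      have "kron (1\<^sub>m M) (Y k) \<in> ?P" if "k < n" for k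
        using that by (intro image_eqI[of _ _ "k + m"]) auto
      moreover have "kron (G k) (1\<^sub>m N) \<in> ?P" if "k < m" for k
        using that by (intro image_eqI[of _ _ k]) auto
      ultimately show "?Q \<subseteq> ?P" by auto
    qed
    then show "generates_matrices (M * N) (?Z ` {..<m + n})"
      using generates_matrices_kron[of M "G ` {..<m}" N "Y ` {..<n}"] G Y Xc(1) Yc(1)
      by (auto simp: clifford_model_def image_subset_iff)
  qed
qed

section \<open>Explicit matrices for the blocks of dimension two and four\<close>

lemma eq_mat_2I:
  assumes "dim_row A = 2" "dim_col A = 2" "dim_row B = 2" "dim_col B = 2"
    and "\<forall>i\<in>{0, 1}. \<forall>j\<in>{0, 1}. A $$ (i, j) = B $$ (i, j)"
  shows "A = B"
  using assms by (intro eq_matI) (auto simp: less_2_cases_iff)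

lemma eq_mat_4I:
  assumes "dim_row A = 4" "dim_col A = 4" "dim_row B = 4" "dim_col B = 4"
    and "\<forall>i\<in>{0, 1, 2, 3}. \<forall>j\<in>{0, 1, 2, 3}. A $$ (i, j) = B $$ (i, j)"
  shows "A = B"
proof (rule eq_matI)
  have "i \<in> {0, 1, 2, 3}" if "i < 4" for i :: nat using that by auto
  then show "A $$ (i, j) = B $$ (i, j)" if "i < dim_row B" "j < dim_col B" for i j
    using assms that by auto
qed (use assms in auto)

lemma scalar_prod_2: "dim_vec v = 2 \<Longrightarrow> u \<bullet> v = u $ 0 * v $ 0 + u $ 1 * v $ 1"
  by (simp add: scalar_prod_def eval_nat_numeral)

lemma scalar_prod_4:
  "dim_vec v = 4 \<Longrightarrow> u \<bullet> v = u $ 0 * v $ 0 + u $ 1 * v $ 1 + u $ 2 * v $ 2 + u $ 3 * v $ 3"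
  by (simp add: scalar_prod_def eval_nat_numeral)

definition flip_mat :: "'f::field mat" where
  "flip_mat = mat 2 2 (\<lambda>(i, j). [[0, 1], [1, 0]] ! i ! j)"

definition shift_mat :: "'f::field mat" where
  "shift_mat = mat 2 2 (\<lambda>(i, j). [[0, 0], [1, 0]] ! i ! j)"

text \<open>This is \<open>shift_mat\<close> plus \<open>c\<close> times the all-ones matrix
  \<open>1 + flip_mat\<close>. In characteristic two its trace is 0 and its determinant is
  \<open>c\<close>, so its square is \<open>c\<close>; the off-diagonal entries differ by 1, so
  transposition adds \<open>flip_mat\<close>.\<close>

definition quaternion_mat :: "'f::field \<Rightarrow> 'f mat" where
  "quaternion_mat c = mat 2 2 (\<lambda>(i, j). [[c, c], [c + 1, c]] ! i ! j)"

lemmas mat_2_defs = flip_mat_def shift_mat_def quaternion_mat_def matrix_unit_def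

text \<open>\<open>shift_mat\<close> is itself a matrix unit, and multiplying by
  \<open>flip_mat\<close> on either side moves its entry to the other three positions.\<close>

lemma generates_flip_shift: "generates_matrices 2 {flip_mat, shift_mat :: 'f::field mat}"
  unfolding generates_matrices_def
proof (intro allI impI)
  fix T :: "'f mat set" assume T: "matrix_subalgebra 2 T" and mem: "{flip_mat, shift_mat} \<subseteq> T"
  have u: "matrix_unit 2 1 0 = (shift_mat :: 'f mat)"
    "matrix_unit 2 1 1 = (shift_mat * flip_mat :: 'f mat)"
    "matrix_unit 2 0 0 = (flip_mat * shift_mat :: 'f mat)"
    "matrix_unit 2 0 1 = (flip_mat * shift_mat * flip_mat :: 'f mat)"
    by (rule eq_mat_2I; simp add: mat_2_defs scalar_prod_2)+
  show "carrier_mat 2 2 \<subseteq> T"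
  proof (rule matrix_units_generate[OF T])
    fix i j :: nat assume "i < 2" "j < 2"
    then show "matrix_unit 2 i j \<in> T"
      using u mem matrix_subalgebraD(4)[OF T] by (auto simp: less_2_cases_iff)
  qed
qed

text \<open>\<open>c 0 = 1\<close> is the value of \<open>q\<close> at a vector of an orthonormal
  basis of the Wall form. The second vector lies outside \<open>Res \<tau>\<close>, where
  \<open>q\<close> is uncontrolled, so \<open>c 1\<close> has to stay arbitrary.\<close>

lemma clifford_model_unit_plane:
  fixes c :: "nat \<Rightarrow> 'f::field"
  assumes char: "CHAR('f) = 2" and c: "c 0 = 1" and \<beta>: "\<beta> 0 1 = 1" "\<beta> 1 0 = 1"
  shows "clifford_model 2 2 c \<beta> (\<lambda>k. if k = 0 then flip_mat else quaternion_mat (c 1))"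
proof -
  note ch = char_2_add_self[OF char]
  let ?S = "flip_mat :: 'f mat" and ?Y = "quaternion_mat (c 1)"
  have carr: "?S \<in> carrier_mat 2 2" "?Y \<in> carrier_mat 2 2" by (auto simp: mat_2_defs)
  have rel: "?S * ?S = 1 \<cdot>\<^sub>m 1\<^sub>m 2" "?Y * ?Y = c 1 \<cdot>\<^sub>m 1\<^sub>m 2" "?S * ?Y + ?Y * ?S = 1 \<cdot>\<^sub>m 1\<^sub>m 2"
    "?Y * ?S + ?S * ?Y = 1 \<cdot>\<^sub>m 1\<^sub>m 2" "transpose_mat ?S = ?S" "transpose_mat ?Y = ?Y + ?S"
    by (rule eq_mat_2I; simp add: mat_2_defs scalar_prod_2 algebra_simps ch)+
  have "generates_matrices 2 {?S, ?Y}"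
    unfolding generates_matrices_def
  proof (intro allI impI)
    fix T assume T: "matrix_subalgebra 2 T" and mem: "{?S, ?Y} \<subseteq> T"
    \<comment> \<open>The definition of \<open>quaternion_mat\<close> solved for
      \<open>shift_mat\<close>.\<close>
    have shift: "shift_mat = ?Y + c 1 \<cdot>\<^sub>m (1\<^sub>m 2 + ?S)"
      by (rule eq_mat_2I; simp add: mat_2_defs algebra_simps ch)
    have "shift_mat \<in> T" unfolding shift using mem matrix_subalgebraD[OF T] by simp
    then show "carrier_mat 2 2 \<subseteq> T"
      using generates_flip_shift[where 'f='f] T mem by (simp add: generates_matrices_def)
  qed
  moreover have "{..<2::nat} = {0, 1}" by auto
  then have "(\<lambda>k::nat. if k = 0 then ?S else ?Y) ` {..<2} = {?S, ?Y}" by auto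
  ultimately show ?thesis
    using carr rel c \<beta> by (auto simp: clifford_model_def less_2_cases_iff)
qed

lemma clifford_model_unit:
  fixes c :: "nat \<Rightarrow> 'f::field"
  assumes char: "CHAR('f) = 2" and c: "\<And>i. i < n \<Longrightarrow> c (2 * i) = 1"
    and \<beta>: "\<And>k l. k < 2 * n \<Longrightarrow> l < 2 * n \<Longrightarrow> k \<noteq> l \<Longrightarrow> \<beta> k l = (if k div 2 = l div 2 then 1 else 0)"
  shows "\<exists>G. clifford_model (2 * n) (2 ^ n) c \<beta> G"
  using c \<beta>
proof (induction n arbitrary: c \<beta>)
  case 0
  then show ?case using clifford_model_empty by (auto intro!: exI)
next
  case (Suc n)
  have "\<exists>G. clifford_model (2 * n) (2 ^ n) (\<lambda>k. c (k + 2)) (\<lambda>k l. \<beta> (k + 2) (l + 2)) G"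
  proof (rule Suc.IH)
    show "c (2 * i + 2) = 1" if "i < n" for i using Suc.prems(1)[of "Suc i"] that by simp
    show "\<beta> (k + 2) (l + 2) = (if k div 2 = l div 2 then 1 else 0)"
      if "k < 2 * n" "l < 2 * n" "k \<noteq> l" for k l
      using Suc.prems(2)[of "k + 2" "l + 2"] that by simp
  qed
  then obtain Y where Y: "clifford_model (2 * n) (2 ^ n) (\<lambda>k. c (k + 2)) (\<lambda>k l. \<beta> (k + 2) (l + 2)) Y" ..
  have G: "clifford_model 2 2 c \<beta> (\<lambda>k. if k = 0 then flip_mat else quaternion_mat (c 1))"
    using Suc.prems(1)[of 0] Suc.prems(2)[of 0 1] Suc.prems(2)[of 1 0]
    by (intro clifford_model_unit_plane[OF char]) auto
  have "\<beta> k l = 0 \<and> \<beta> l k = 0" if "k < 2" "2 \<le> l" "l < 2 + 2 * n" for k l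
  proof -
    have "k div 2 \<noteq> l div 2" using that by auto
    then show ?thesis using Suc.prems(2)[of k l] Suc.prems(2)[of l k] that by auto
  qed
  from clifford_model_kron[OF char _ G Y this] show ?case by (auto simp: mult_2)
qed

text \<open>The four matrices below were found by writing \<open>w\<^sub>1 = s\<^sub>1 + s\<^sub>2\<close>, \<open>w\<^sub>2 = s\<^sub>1 + s\<^sub>1 s\<^sub>2\<close> in
  terms of the commuting flips \<open>s\<^sub>1, s\<^sub>2\<close>, and solving for \<open>y\<^sub>1, y\<^sub>2\<close> of the form
  \<open>\<alpha>\<^sub>1 p\<^sub>1 + \<alpha>\<^sub>2 p\<^sub>2 + \<gamma>\<close> with the shifts \<open>p\<^sub>1, p\<^sub>2\<close> and \<open>\<alpha>\<^sub>1, \<alpha>\<^sub>2, \<gamma>\<close> in the algebra of \<open>s\<^sub>1, s\<^sub>2\<close>.\<close>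

definition hyperbolic_mat :: "(nat \<Rightarrow> 'f::field) \<Rightarrow> nat \<Rightarrow> 'f mat" where
  "hyperbolic_mat c k = mat 4 4 (\<lambda>(i, j). (
     [[[0, 1, 1, 0], [1, 0, 0, 1], [1, 0, 0, 1], [0, 1, 1, 0]],
      [[0, 0, c 1, c 1], [1, 1, 1 + c 1, c 1], [1 + c 1, 1 + c 1, 1, 0], [c 1, 1 + c 1, 1, 0]],
      [[0, 0, 1, 1], [0, 0, 1, 1], [1, 1, 0, 0], [1, 1, 0, 0]],
      [[1, 1 + c 3, 1 + c 3, 0], [1 + c 3, 1, 1, c 3], [c 3, 0, 0, c 3], [1, 1 + c 3, c 3, 0]]]) ! k ! i ! j)"

text \<open>Positions 0, 1, 2, 3 hold w_1, y_1, w_2, y_2. The Wall form pairs w_1 with w_2, so each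
  w is dual to the other y, which is the condition \<open>k + l = 3\<close>. The zeros
  \<open>c 0\<close> and \<open>c 2\<close> are the values of the alternating Wall form, while
  \<open>c 1\<close> and \<open>c 3\<close> are arbitrary.\<close>

lemma clifford_model_hyperbolic_plane:
  fixes c :: "nat \<Rightarrow> 'f::field"
  assumes char: "CHAR('f) = 2" and c: "c 0 = 0" "c 2 = 0"
    and \<beta>: "\<And>k l. k < 4 \<Longrightarrow> l < 4 \<Longrightarrow> k \<noteq> l \<Longrightarrow> \<beta> k l = (if k + l = 3 then 1 else 0)"
  shows "clifford_model 4 4 c \<beta> (hyperbolic_mat c)"
proof -
  note ch = char_2_add_self[OF char]
  have lt4: "k < 4 \<longleftrightarrow> k = 0 \<or> k = 1 \<or> k = 2 \<or> k = 3" for k :: nat by auto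
  let ?H = "hyperbolic_mat c" and ?I = "1\<^sub>m 4 :: 'f mat"
  have carr: "?H k \<in> carrier_mat 4 4" for k by (simp add: hyperbolic_mat_def)
  note hm = hyperbolic_mat_def scalar_prod_4 algebra_simps ch
  have sq: "?H 0 * ?H 0 = 0 \<cdot>\<^sub>m ?I" "?H 1 * ?H 1 = c 1 \<cdot>\<^sub>m ?I"
    "?H 2 * ?H 2 = 0 \<cdot>\<^sub>m ?I" "?H 3 * ?H 3 = c 3 \<cdot>\<^sub>m ?I"
    by (rule eq_mat_4I; simp add: hm)+
  have tr: "transpose_mat (?H 0) = ?H 0" "transpose_mat (?H 1) = ?H 1 + ?H 0"
    "transpose_mat (?H 2) = ?H 2" "transpose_mat (?H 3) = ?H 3 + ?H 2"
    by (rule eq_mat_4I; simp add: hm)+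
  have ac: "?H 0 * ?H 1 + ?H 1 * ?H 0 = 0 \<cdot>\<^sub>m ?I" "?H 0 * ?H 2 + ?H 2 * ?H 0 = 0 \<cdot>\<^sub>m ?I"
    "?H 0 * ?H 3 + ?H 3 * ?H 0 = 1 \<cdot>\<^sub>m ?I" "?H 1 * ?H 2 + ?H 2 * ?H 1 = 1 \<cdot>\<^sub>m ?I"
    "?H 1 * ?H 3 + ?H 3 * ?H 1 = 0 \<cdot>\<^sub>m ?I" "?H 2 * ?H 3 + ?H 3 * ?H 2 = 0 \<cdot>\<^sub>m ?I"
    by (rule eq_mat_4I; simp add: hm)+
  \<comment> \<open>The anticommutator is symmetric, so the six relations above cover both orders of
    each pair.\<close>
  have ac': "?H l * ?H k + ?H k * ?H l = ?H k * ?H l + ?H l * ?H k" for k l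
    by (rule comm_add_mat[of _ 4 4]) (simp_all add: carr mult_carrier_mat[of _ 4 4])
  let ?S = "flip_mat :: 'f mat" and ?P = "shift_mat :: 'f mat" and ?J = "1\<^sub>m 2 :: 'f mat"
  have "generates_matrices 4 (?H ` {..<4})"
    unfolding generates_matrices_def
  proof (intro allI impI)
    fix T assume T: "matrix_subalgebra 4 T" and mem: "?H ` {..<4} \<subseteq> T"
    note T' = matrix_subalgebraD(2-5)[OF T]
    have k: "kron A B = mat 4 4 (\<lambda>(i, j). A $$ (i div 2, j div 2) * B $$ (i mod 2, j mod 2))"
      if "A \<in> carrier_mat 2 2" "B \<in> carrier_mat 2 2" for A B :: "'f mat"
      using that by (auto simp: kron_def)
    have carr2: "?S \<in> carrier_mat 2 2" "?P \<in> carrier_mat 2 2" by (auto simp: mat_2_defs)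
    have H: "?H 0 \<in> T" "?H 1 \<in> T" "?H 2 \<in> T" "?H 3 \<in> T" using mem by auto
    \<comment> \<open>The generators are recovered from the four matrices. With w_1 = s_1 + s_2, w_2
      = s_1 + s_1 s_2 and s_i of square 1, everything in the expansion of (1 + w_1)(1 + w_2) cancels
      except s_1.\<close>
    have S1: "kron ?S ?J = (?I + ?H 0) * (?I + ?H 2)"
      by (rule eq_mat_4I; simp add: hm k carr2; simp add: mat_2_defs)
    have S2: "kron ?J ?S = kron ?S ?J + ?H 0"
      by (rule eq_mat_4I; simp add: hm k carr2; simp add: mat_2_defs ch)
    \<comment> \<open>As w_1 has square 0, the factor 1 + w_1 is its own inverse, and the identity
      amounts to y_1 = (1 + w_1)(p_1 + p_2) + c_1 w_2. Likewise the next one amounts to y_2 = p_1 +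
      w_2 (p_1 + p_2) + c_3 w_1.\<close>
    have P12: "kron ?P ?J + kron ?J ?P = (?I + ?H 0) * (?H 1 + c 1 \<cdot>\<^sub>m ?H 2)"
      by (rule eq_mat_4I; simp add: hm k carr2; simp add: mat_2_defs ch)
    have P1: "kron ?P ?J = ?H 3 + c 3 \<cdot>\<^sub>m ?H 0 + ?H 2 * (kron ?P ?J + kron ?J ?P)"
      by (rule eq_mat_4I; simp add: hm k carr2; simp add: mat_2_defs ch)
    have P2: "kron ?J ?P = kron ?P ?J + (kron ?P ?J + kron ?J ?P)"
      by (rule eq_mat_4I; simp add: hm k carr2; simp add: mat_2_defs ch)
    have "kron ?S ?J \<in> T" unfolding S1 using H T' by simp
    moreover from this have "kron ?J ?S \<in> T" unfolding S2 using H T' by simp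
    moreover have P12T: "kron ?P ?J + kron ?J ?P \<in> T" unfolding P12 using H T' by simp
    \<comment> \<open>The right side of \<open>P1\<close> contains \<open>kron ?P ?J\<close> again,
      but only within the sum already known to lie in \<open>T\<close>; a single rewrite is
      therefore enough and must not be repeated.\<close>
    then have P1T: "kron ?P ?J \<in> T" by (subst P1) (use H T' in simp)
    moreover from this P12T have "kron ?J ?P \<in> T" by (subst P2) (use T' in simp)
    moreover have "generates_matrices (2 * 2)
        ((\<lambda>A. kron A ?J) ` {?S, ?P} \<union> kron ?J ` {?S, ?P})"
      by (rule generates_matrices_kron) (auto simp: generates_flip_shift carr2)
    ultimately show "carrier_mat 4 4 \<subseteq> T" using T by (simp add: generates_matrices_def)
  qed
  then show ?thesis
    unfolding clifford_model_def using carr sq tr ac ac' c \<beta>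
    by (auto simp: lt4)
qed

lemma clifford_model_hyperbolic:
  fixes c :: "nat \<Rightarrow> 'f::field"
  assumes char: "CHAR('f) = 2" and c: "\<And>i. i < 2 * m \<Longrightarrow> c (2 * i) = 0"
    and \<beta>: "\<And>k l. k < 4 * m \<Longrightarrow> l < 4 * m \<Longrightarrow> k \<noteq> l \<Longrightarrow>
      \<beta> k l = (if k div 4 = l div 4 \<and> k mod 4 + l mod 4 = 3 then 1 else 0)"
  shows "\<exists>G. clifford_model (4 * m) (4 ^ m) c \<beta> G"
  using c \<beta>
proof (induction m arbitrary: c \<beta>)
  case 0
  then show ?case using clifford_model_empty by (auto intro!: exI)
next
  case (Suc m)
  have "\<exists>G. clifford_model (4 * m) (4 ^ m) (\<lambda>k. c (k + 4)) (\<lambda>k l. \<beta> (k + 4) (l + 4)) G"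
  proof (rule Suc.IH)
    show "c (2 * i + 4) = 0" if "i < 2 * m" for i using Suc.prems(1)[of "i + 2"] that by (simp add: distrib_left del: add_2_eq_Suc')
    show "\<beta> (k + 4) (l + 4) = (if k div 4 = l div 4 \<and> k mod 4 + l mod 4 = 3 then 1 else 0)"
      if "k < 4 * m" "l < 4 * m" "k \<noteq> l" for k l
      using Suc.prems(2)[of "k + 4" "l + 4"] that by simp
  qed
  then obtain Y where Y: "clifford_model (4 * m) (4 ^ m) (\<lambda>k. c (k + 4)) (\<lambda>k l. \<beta> (k + 4) (l + 4)) Y" ..
  have G: "clifford_model 4 4 c \<beta> (hyperbolic_mat c)"
    using Suc.prems(1)[of 0] Suc.prems(1)[of 1] Suc.prems(2)
    by (intro clifford_model_hyperbolic_plane[OF char]) auto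
  have "\<beta> k l = 0 \<and> \<beta> l k = 0" if "k < 4" "4 \<le> l" "l < 4 + 4 * m" for k l
  proof -
    have "k div 4 \<noteq> l div 4" using that by auto
    then show ?thesis using Suc.prems(2)[of k l] Suc.prems(2)[of l k] that by auto
  qed
  from clifford_model_kron[OF char _ G Y this] show ?case by auto
qed

section \<open>The Clifford algebra in characteristic two\<close>

lemma type_algebra_uminus: "\<ominus>\<^bsub>ring_of_type_algebra\<^esub> (y :: 'a::ring_1) = - y"
proof -
  interpret R: ring "ring_of_type_algebra :: 'a ring" by (rule ring_ring_of_type_algebra)
  show ?thesis by (rule R.minus_equality) (auto simp: ring_of_type_algebra_def)
qed

text \<open>Translates carrier-based ideals into the type-class operations of the free algebra, so
  that congruences can be proved by ring identities.\<close>

lemma ideal_type_algebraD: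
  fixes K :: "'a::ring_1 set"
  assumes "ideal K ring_of_type_algebra"
  shows "0 \<in> K" "x \<in> K \<Longrightarrow> y \<in> K \<Longrightarrow> x + y \<in> K" "x \<in> K \<Longrightarrow> - x \<in> K"
    "x \<in> K \<Longrightarrow> y \<in> K \<Longrightarrow> x - y \<in> K" "y \<in> K \<Longrightarrow> x * y \<in> K" "y \<in> K \<Longrightarrow> y * x \<in> K"
proof -
  interpret R: ring "ring_of_type_algebra :: 'a ring" by (rule ring_ring_of_type_algebra)
  interpret I: ideal K ring_of_type_algebra by fact
  show "0 \<in> K" using I.zero_closed by (simp add: ring_of_type_algebra_def)
  show add: "x \<in> K \<Longrightarrow> y \<in> K \<Longrightarrow> x + y \<in> K" for x y
    using I.a_closed[of x y] by (simp add: ring_of_type_algebra_def)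
  show neg: "x \<in> K \<Longrightarrow> - x \<in> K" for x
    using I.a_inv_closed[of x] by (simp add: type_algebra_uminus)
  show "x \<in> K \<Longrightarrow> y \<in> K \<Longrightarrow> x - y \<in> K"
    using add[of x "- y"] neg[of y] by simp
  show "y \<in> K \<Longrightarrow> x * y \<in> K" "y \<in> K \<Longrightarrow> y * x \<in> K"
    using I.I_l_closed[of y x] I.I_r_closed[of y x] by (simp_all add: ring_of_type_algebra_def)
qed

lemma ideal_type_algebraI:
  fixes K :: "'a::ring_1 set"
  assumes zero: "0 \<in> K" and add: "\<And>x y. x \<in> K \<Longrightarrow> y \<in> K \<Longrightarrow> x + y \<in> K"
    and l: "\<And>x y. y \<in> K \<Longrightarrow> x * y \<in> K" and r: "\<And>x y. y \<in> K \<Longrightarrow> y * x \<in> K"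
  shows "ideal K ring_of_type_algebra"
proof -
  interpret R: ring "ring_of_type_algebra :: 'a ring" by (rule ring_ring_of_type_algebra)
  have neg: "- y \<in> K" if "y \<in> K" for y using l[OF that, of "- 1"] by simp
  show ?thesis
  proof (rule idealI[OF ring_ring_of_type_algebra])
    show "subgroup K (add_monoid ring_of_type_algebra)"
    proof (rule group.subgroupI[OF R.a_group])
      fix a assume "a \<in> K"
      then show "inv\<^bsub>add_monoid ring_of_type_algebra\<^esub> a \<in> K"
        using neg type_algebra_uminus[of a] unfolding a_inv_def by simp
    qed (use zero add in \<open>auto simp: ring_of_type_algebra_def\<close>)
  qed (use l r in \<open>auto simp: ring_of_type_algebra_def\<close>)
qed

lemma free_const_simps:
  "free_const (a + b) = free_const a + free_const b"
  "free_const (a - b) = free_const a - free_const b"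
  "free_const (a * b) = free_const a * free_const b"
  "free_const 0 = 0" "free_const 1 = 1" "free_const (- a) = - free_const a"
  by (simp_all add: free_const_def single_add single_diff single_uminus mult_single)

lemma free_const_central: "x * free_const a = free_const a * (x :: ('f::field, 'v) free_algebra)"
  by (induction x rule: free_algebra_induct)
    (simp_all add: distrib_left distrib_right free_const_def mult_single mult.commute)

lemma free_const_left_commute:
  "x * (free_const a * y) = free_const a * (x * y :: ('f::field, 'v) free_algebra)"
  by (metis free_const_central mult.assoc)

lemma free_algebra_add_self:
  fixes x :: "('f::field, 'v) free_algebra"
  assumes "CHAR('f) = 2"
  shows "x + x = 0"
proof -
  have "x + x = free_const (1 + 1) * x"
    by (simp only: free_const_simps(1,5) distrib_right mult_1_left)
  also have "(1::'f) + 1 = 0" by (rule char_2_add_self(1)[OF assms])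
  finally show ?thesis by (simp add: free_const_simps)
qed

section \<open>Ordered products in the Clifford algebra and its simplicity\<close>

context
  fixes scale :: "'f::field \<Rightarrow> 'v::ab_group_add \<Rightarrow> 'v" and q :: "'v \<Rightarrow> 'f"
begin

lemmas clifford_ideal_closed = ideal_type_algebraD[OF ideal_clifford[of scale q]]

lemma clifford_ideal_relations:
  "free_gen (u + v) - (free_gen u + free_gen v) \<in> clifford_ideal scale q"
  "free_gen (scale a v) - free_const a * free_gen v \<in> clifford_ideal scale q"
  "free_gen v * free_gen v - free_const (q v) \<in> clifford_ideal scale q"
proof -
  interpret R: ring "ring_of_type_algebra :: ('f, 'v) free_algebra ring"
    by (rule ring_ring_of_type_algebra)
  have "clifford_relations scale q \<subseteq> clifford_ideal scale q"
    unfolding clifford_ideal_def by (rule R.genideal_self) (simp add: ring_of_type_algebra_def)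
  then show "free_gen (u + v) - (free_gen u + free_gen v) \<in> clifford_ideal scale q"
    "free_gen (scale a v) - free_const a * free_gen v \<in> clifford_ideal scale q"
    "free_gen v * free_gen v - free_const (q v) \<in> clifford_ideal scale q"
    unfolding clifford_relations_def by blast+
qed

text \<open>Polarisation of the square relation. In the free algebra the generator \<open>?w\<close>
  of a sum is not the sum \<open>?s\<close> of the generators, so \<open>?w * ?w - ?s * ?s\<close>
  is split as \<open>(?w - ?s) * ?w + ?s * (?w - ?s)\<close>, a combination of additivity
  relations.\<close>

lemma clifford_ideal_polar:
  "free_gen u * free_gen v + free_gen v * free_gen u - free_const (polar q u v) \<in> clifford_ideal scale q"
proof -
  let ?s = "free_gen u + free_gen v :: ('f, 'v) free_algebra" and ?w = "free_gen (u + v) :: ('f, 'v) free_algebra"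
  have "free_gen u * free_gen v + free_gen v * free_gen u - free_const (polar q u v) =
      (?w * ?w - free_const (q (u + v))) - (?w - ?s) * ?w - ?s * (?w - ?s)
      - (free_gen u * free_gen u - free_const (q u)) - (free_gen v * free_gen v - free_const (q v))"
    by (simp add: polar_def free_const_simps algebra_simps)
  then show ?thesis
    using clifford_ideal_relations clifford_ideal_closed(4-6) by (simp only:)
qed

text \<open>Modulo the ideal, these are the linear combinations of products of subsequences of the
  list, taken in its order. The recursion on the first vector replaces an indexing by subsets and
  gives each element the shape \<open>p + v * r\<close> needed by the commutator argument.\<close>

primrec clifford_span :: "'v list \<Rightarrow> ('f, 'v) free_algebra set" where
  "clifford_span [] = {x. \<exists>a. x - free_const a \<in> clifford_ideal scale q}"
| "clifford_span (v # vs) = {x. \<exists>p\<in>clifford_span vs. \<exists>r\<in>clifford_span vs.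
     x - (p + free_gen v * r) \<in> clifford_ideal scale q}"

lemma clifford_span_cong:
  assumes "x \<in> clifford_span vs" "y - x \<in> clifford_ideal scale q"
  shows "y \<in> clifford_span vs"
proof -
  have *: "y - z \<in> clifford_ideal scale q" if "x - z \<in> clifford_ideal scale q" for z
    using clifford_ideal_closed(2)[OF assms(2) that] by simp
  show ?thesis using assms(1) * by (cases vs) auto
qed

lemma clifford_span_add:
  "x \<in> clifford_span vs \<Longrightarrow> y \<in> clifford_span vs \<Longrightarrow> x + y \<in> clifford_span vs"
proof (induction vs arbitrary: x y)
  case Nil
  then obtain a b where "x - free_const a \<in> clifford_ideal scale q"
    "y - free_const b \<in> clifford_ideal scale q" by auto
  from clifford_ideal_closed(2)[OF this]
  have "x + y - free_const (a + b) \<in> clifford_ideal scale q"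
    by (simp add: free_const_simps algebra_simps)
  then show ?case by auto
next
  case (Cons v vs)
  from Cons.prems obtain p r p' r' where m: "p \<in> clifford_span vs" "r \<in> clifford_span vs"
    "p' \<in> clifford_span vs" "r' \<in> clifford_span vs"
    and "x - (p + free_gen v * r) \<in> clifford_ideal scale q"
    "y - (p' + free_gen v * r') \<in> clifford_ideal scale q"
    by auto
  from clifford_ideal_closed(2)[OF this(5,6)]
  have "x + y - ((p + p') + free_gen v * (r + r')) \<in> clifford_ideal scale q"
    by (simp add: algebra_simps)
  then show ?case using Cons.IH m by auto
qed

lemma clifford_span_const_mult: "x \<in> clifford_span vs \<Longrightarrow> free_const a * x \<in> clifford_span vs"
proof (induction vs arbitrary: x)
  case Nil
  then obtain b where "x - free_const b \<in> clifford_ideal scale q" by auto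
  from clifford_ideal_closed(5)[OF this, of "free_const a"]
  have "free_const a * x - free_const (a * b) \<in> clifford_ideal scale q"
    by (simp add: free_const_simps right_diff_distrib)
  then show ?case by auto
next
  case (Cons v vs)
  from Cons.prems obtain p r where m: "p \<in> clifford_span vs" "r \<in> clifford_span vs"
    and "x - (p + free_gen v * r) \<in> clifford_ideal scale q"
    by auto
  from clifford_ideal_closed(5)[OF this(3), of "free_const a"]
  have "free_const a * x - (free_const a * p + free_gen v * (free_const a * r)) \<in> clifford_ideal scale q"
    by (simp add: algebra_simps free_const_left_commute)
  then show ?case using Cons.IH m by auto
qed

lemma clifford_span_zero: "0 \<in> clifford_span vs"
proof (induction vs)
  case Nil
  then show ?case using clifford_ideal_closed(1) by (auto intro: exI[of _ 0] simp: free_const_simps)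
next
  case (Cons v vs)
  then show ?case using clifford_ideal_closed(1) by (auto intro!: bexI[of _ 0])
qed

lemma clifford_span_one: "1 \<in> clifford_span vs"
proof (induction vs)
  case Nil
  then show ?case using clifford_ideal_closed(1) by (auto intro: exI[of _ 1] simp: free_const_simps)
next
  case (Cons v vs)
  show ?case
    unfolding clifford_span.simps
    by (rule CollectI, rule bexI[OF _ Cons], rule bexI[OF _ clifford_span_zero])
      (simp add: clifford_ideal_closed(1))
qed

text \<open>A new factor \<open>u\<close> either meets the leading vector and collapses to
  \<open>q u\<close>, or moves past it at the cost of a scalar term and is then absorbed by the
  tail.\<close>

lemma clifford_span_gen_mult:
  "u \<in> set vs \<Longrightarrow> x \<in> clifford_span vs \<Longrightarrow> free_gen u * x \<in> clifford_span vs"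
proof (induction vs arbitrary: x)
  case (Cons v vs)
  from Cons.prems(2) obtain p r where m: "p \<in> clifford_span vs" "r \<in> clifford_span vs"
    and x: "x - (p + free_gen v * r) \<in> clifford_ideal scale q"
    by auto
  show ?case
  proof (cases "u = v")
    case True
    have "free_gen v * x - (free_const (q v) * r + free_gen v * p) =
      free_gen v * (x - (p + free_gen v * r)) + (free_gen v * free_gen v - free_const (q v)) * r"
      by (simp add: algebra_simps)
    also have "\<dots> \<in> clifford_ideal scale q"
      using clifford_ideal_closed(2,5,6) x clifford_ideal_relations(3) by blast
    finally show ?thesis using m clifford_span_const_mult True by auto
  next
    case False
    then have u: "u \<in> set vs" using Cons.prems by simp
    have "free_gen u * x - ((free_gen u * p + free_const (polar q u v) * r)
          + free_gen v * (free_const (- 1) * (free_gen u * r))) =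
        free_gen u * (x - (p + free_gen v * r))
          + (free_gen u * free_gen v + free_gen v * free_gen u - free_const (polar q u v)) * r"
      by (simp add: algebra_simps free_const_simps)
    also have "\<dots> \<in> clifford_ideal scale q"
      using clifford_ideal_closed(2,5,6) x clifford_ideal_polar by blast
    finally have eq: "free_gen u * x - ((free_gen u * p + free_const (polar q u v) * r)
          + free_gen v * (free_const (- 1) * (free_gen u * r))) \<in> clifford_ideal scale q" .
    have p: "free_gen u * p + free_const (polar q u v) * r \<in> clifford_span vs"
      and r: "free_const (- 1) * (free_gen u * r) \<in> clifford_span vs"
      by (intro clifford_span_add clifford_span_const_mult Cons.IH[OF u] m)+
    show ?thesis
      unfolding clifford_span.simps
      by (rule CollectI, rule bexI[OF _ p], rule bexI[OF _ r], rule eq)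
  qed
qed simp

text \<open>The vectors whose left multiplication preserves the span form a subspace containing the
  list, hence all vectors. Every word is then reached from 1 by left multiplications.\<close>

lemma clifford_span_UNIV:
  assumes vs: "vector_space scale" and span: "module.span scale (set vs) = UNIV"
  shows "clifford_span vs = UNIV"
proof -
  interpret vector_space scale by fact
  define T where "T = {u. \<forall>x\<in>clifford_span vs. free_gen u * x \<in> clifford_span vs}"
  have sc: "scale a u \<in> T" if "u \<in> T" for a u
    unfolding T_def
  proof safe
    fix x assume x: "x \<in> clifford_span vs"
    have "free_gen (scale a u) * x - free_const a * (free_gen u * x) \<in> clifford_ideal scale q"
      using clifford_ideal_closed(6)[OF clifford_ideal_relations(2)[of a u], of x]
      by (simp add: algebra_simps)
    then show "free_gen (scale a u) * x \<in> clifford_span vs"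
      using clifford_span_cong clifford_span_const_mult that x unfolding T_def by blast
  qed
  have ad: "u + v \<in> T" if "u \<in> T" "v \<in> T" for u v
    unfolding T_def
  proof safe
    fix x assume x: "x \<in> clifford_span vs"
    have "free_gen (u + v) * x - (free_gen u * x + free_gen v * x) \<in> clifford_ideal scale q"
      using clifford_ideal_closed(6)[OF clifford_ideal_relations(1)[of u v], of x]
      by (simp add: algebra_simps)
    then show "free_gen (u + v) * x \<in> clifford_span vs"
      using clifford_span_cong clifford_span_add that x unfolding T_def by blast
  qed
  have T: "set vs \<subseteq> T" using clifford_span_gen_mult by (auto simp: T_def)
  \<comment> \<open>The generator attached to the zero vector is not zero in the free algebra; only
    the relation for \<open>scale 0 0\<close> kills it.\<close>
  have z: "0 \<in> T"
  proof -
    have "free_gen (0::'v) * x \<in> clifford_span vs" for x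
    proof (rule clifford_span_cong[OF clifford_span_zero])
      show "free_gen (0::'v) * x - 0 \<in> clifford_ideal scale q"
        using clifford_ideal_closed(6)[OF clifford_ideal_relations(2)[of 0 0], of x]
        by (simp add: free_const_simps)
    qed
    then show ?thesis by (simp add: T_def)
  qed
  have "subspace T" by (rule subspaceI) (use z ad sc in auto)
  from span_minimal[OF T this] have gen: "free_gen u * x \<in> clifford_span vs"
    if "x \<in> clifford_span vs" for u x
    using that span by (auto simp: T_def)
  have word: "Poly_Mapping.single (Word w) 1 \<in> clifford_span vs" for w
  proof (induction w)
    case Nil
    then show ?case using clifford_span_one by (simp flip: zero_free_monoid_def)
  next
    case (Cons v w)
    have "Poly_Mapping.single (Word (v # w)) (1::'f) = free_gen v * Poly_Mapping.single (Word w) 1"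
      by (simp add: free_gen_def mult_single plus_free_monoid_def)
    then show ?case using gen[OF Cons.IH] by simp
  qed
  have "x \<in> clifford_span vs" for x
  proof (induction x rule: free_algebra_induct)
    case (single w c)
    have "Poly_Mapping.single w c = free_const c * Poly_Mapping.single (Word (letters w)) 1"
      by (simp add: free_const_def mult_single)
    then show ?case using clifford_span_const_mult[OF word, of c "letters w"] by simp
  qed (use clifford_span_zero clifford_span_add in auto)
  then show ?thesis by auto
qed

text \<open>In characteristic two the commutator with \<open>z\<close> is a derivation with values \<open>polar q z v\<close>
  on vectors, so it strips the factor \<open>v\<close> when \<open>z\<close> is dual to \<open>v\<close>.\<close>

lemma clifford_commutator:
  assumes char: "CHAR('f) = 2"
    and p: "free_gen z * p - p * free_gen z \<in> clifford_ideal scale q"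
    and r: "free_gen z * r - r * free_gen z \<in> clifford_ideal scale q"
    and x: "x - (p + free_gen v * r) \<in> clifford_ideal scale q"
  shows "free_gen z * x - x * free_gen z - free_const (polar q z v) * r \<in> clifford_ideal scale q"
proof -
  let ?z = "free_gen z :: ('f, 'v) free_algebra" and ?v = "free_gen v :: ('f, 'v) free_algebra"
  let ?y = "x - (p + ?v * r)"
  have "?z * x - x * ?z - free_const (polar q z v) * r =
     (?z * ?y - ?y * ?z) + (?z * p - p * ?z) + (?z * ?v + ?v * ?z - free_const (polar q z v)) * r
     + ?v * (?z * r - r * ?z) - (?v * ?z * r + ?v * ?z * r)"
    by (simp add: algebra_simps)
  also have "?v * ?z * r + ?v * ?z * r = 0" by (rule free_algebra_add_self[OF char])
  also have "(?z * ?y - ?y * ?z) + (?z * p - p * ?z) + (?z * ?v + ?v * ?z - free_const (polar q z v)) * r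
     + ?v * (?z * r - r * ?z) - 0 \<in> clifford_ideal scale q"
    by (intro clifford_ideal_closed p r x clifford_ideal_polar)
  finally show ?thesis .
qed

text \<open>Anticommuting and commuting coincide in characteristic two, so a vector orthogonal to
  all factors commutes with every product of them.\<close>

lemma clifford_span_commute:
  assumes char: "CHAR('f) = 2"
  shows "\<forall>u\<in>set vs. polar q z u = 0 \<Longrightarrow> x \<in> clifford_span vs \<Longrightarrow>
    free_gen z * x - x * free_gen z \<in> clifford_ideal scale q"
proof (induction vs arbitrary: x)
  case Nil
  then obtain a where x: "x - free_const a \<in> clifford_ideal scale q" by auto
  have "free_gen z * x - x * free_gen z =
      free_gen z * (x - free_const a) - (x - free_const a) * free_gen z"
    by (simp add: algebra_simps free_const_central)
  then show ?case using x clifford_ideal_closed(4-6) by simp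
next
  case (Cons v vs)
  from Cons.prems(2) obtain p r where m: "p \<in> clifford_span vs" "r \<in> clifford_span vs"
    and x: "x - (p + free_gen v * r) \<in> clifford_ideal scale q"
    by auto
  have "free_gen z * x - x * free_gen z - free_const (polar q z v) * r \<in> clifford_ideal scale q"
    using Cons m by (intro clifford_commutator[OF char _ _ x]) auto
  then show ?case using Cons.prems(1) by (simp add: free_const_simps)
qed

text \<open>Simplicity of the Clifford algebra. For \<open>x = p + v * r\<close> in
  \<open>K\<close>, the commutator with a \<open>z\<close> that is dual to \<open>v\<close> and
  orthogonal to the later vectors puts \<open>r\<close>, and then \<open>p\<close>, into
  \<open>K\<close>. The list shrinks until a scalar remains, which must be 0 since \<open>K\<close>
  is proper. Quantifying over all splittings of the list makes the duality hypothesis pass to its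
  tail.\<close>

lemma clifford_span_proper_ideal:
  assumes char: "CHAR('f) = 2"
    and K: "ideal K ring_of_type_algebra" "clifford_ideal scale q \<subseteq> K" "1 \<notin> K"
  shows "\<forall>us v ws. vs = us @ v # ws \<longrightarrow> (\<exists>z. polar q z v = 1 \<and> (\<forall>w\<in>set ws. polar q z w = 0)) \<Longrightarrow>
    x \<in> clifford_span vs \<Longrightarrow> x \<in> K \<Longrightarrow> x \<in> clifford_ideal scale q"
proof (induction vs arbitrary: x)
  case Nil
  then obtain a where x: "x - free_const a \<in> clifford_ideal scale q" by auto
  have a: "free_const a \<in> K"
    using ideal_type_algebraD(4)[OF K(1) Nil(3), of "x - free_const a"] x K(2) by auto
  have "a = 0"
  proof (rule ccontr)
    assume "a \<noteq> 0"
    then have "free_const (inverse a) * free_const a = (1 :: ('f, 'v) free_algebra)"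
      by (simp flip: free_const_simps(3,5))
    then show False using ideal_type_algebraD(5)[OF K(1) a] K(3) by metis
  qed
  then show ?case using x by (simp add: free_const_simps)
next
  case (Cons v vs)
  note IK = ideal_type_algebraD[OF K(1)]
  from Cons.prems(2) obtain p r where m: "p \<in> clifford_span vs" "r \<in> clifford_span vs"
    and x: "x - (p + free_gen v * r) \<in> clifford_ideal scale q"
    by auto
  have IH: "y \<in> clifford_span vs \<Longrightarrow> y \<in> K \<Longrightarrow> y \<in> clifford_ideal scale q" for y
  proof (rule Cons.IH)
    show "\<forall>us v ws. vs = us @ v # ws \<longrightarrow> (\<exists>z. polar q z v = 1 \<and> (\<forall>w\<in>set ws. polar q z w = 0))"
      using Cons.prems(1) by (metis append_Cons)
  qed
  obtain z where z: "polar q z v = 1" "\<forall>w\<in>set vs. polar q z w = 0"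
    using Cons.prems(1) by (metis append_Nil)
  have "free_gen z * x - x * free_gen z - free_const (polar q z v) * r \<in> clifford_ideal scale q"
    using z m by (intro clifford_commutator[OF char _ _ x] clifford_span_commute[OF char, of vs]) auto
  then have "free_gen z * x - x * free_gen z - r \<in> K"
    using K(2) by (auto simp: z free_const_simps)
  moreover have "free_gen z * x - x * free_gen z \<in> K" using IK(4-6) Cons.prems(3) by blast
  ultimately have "free_gen z * x - x * free_gen z - (free_gen z * x - x * free_gen z - r) \<in> K"
    using IK(4) by blast
  then have "r \<in> K" by simp
  then have r: "r \<in> clifford_ideal scale q" using IH m by blast
  have "x - (x - (p + free_gen v * r)) - free_gen v * r \<in> K"
    by (rule IK(4)[OF IK(4)[OF Cons.prems(3) subsetD[OF K(2) x]] IK(5)[OF \<open>r \<in> K\<close>]])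
  then have p: "p \<in> clifford_ideal scale q" using IH m by simp
  have "(x - (p + free_gen v * r)) + (p + free_gen v * r) \<in> clifford_ideal scale q"
    by (rule clifford_ideal_closed(2)[OF x clifford_ideal_closed(2)[OF p clifford_ideal_closed(5)[OF r]]])
  then show ?case by simp
qed

end

section \<open>Evaluation of the free algebra in matrices, and the isomorphism criterion\<close>

fun word_mat :: "nat \<Rightarrow> ('v \<Rightarrow> 'f::field mat) \<Rightarrow> 'v list \<Rightarrow> 'f mat" where
  "word_mat N M [] = 1\<^sub>m N"
| "word_mat N M (v # vs) = M v * word_mat N M vs"

text \<open>The homomorphism of the free algebra that extends \<open>M\<close>. The sum over words
  is taken entry by entry because the size \<open>N\<close> is a value and not part of the
  type.\<close>

definition matrix_eval :: "nat \<Rightarrow> ('v \<Rightarrow> 'f::field mat) \<Rightarrow> ('f, 'v) free_algebra \<Rightarrow> 'f mat" where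
  "matrix_eval N M p = mat N N (\<lambda>ij. \<Sum>w\<in>Poly_Mapping.keys p. Poly_Mapping.lookup p w * word_mat N M (letters w) $$ ij)"

lemma matrix_eval_carrier [simp]: "matrix_eval N M p \<in> carrier_mat N N"
  by (simp add: matrix_eval_def)

lemma matrix_eval_superset:
  assumes "finite A" "Poly_Mapping.keys p \<subseteq> A"
  shows "matrix_eval N M p = mat N N (\<lambda>ij. \<Sum>w\<in>A. Poly_Mapping.lookup p w * word_mat N M (letters w) $$ ij)"
  unfolding matrix_eval_def
  using assms by (intro arg_cong[where f = "mat N N"] ext sum.mono_neutral_left) (auto simp: in_keys_iff)

lemma matrix_eval_add: "matrix_eval N M (x + y) = matrix_eval N M x + matrix_eval N M y"
proof -
  let ?A = "Poly_Mapping.keys x \<union> Poly_Mapping.keys y"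
  have "Poly_Mapping.keys (x + y) \<subseteq> ?A" by (rule Poly_Mapping.keys_add)
  then show ?thesis
    by (subst (1 2 3) matrix_eval_superset[of ?A])
      (auto intro!: eq_matI simp: lookup_add distrib_right sum.distrib)
qed

context
  fixes N :: nat and M :: "'v::ab_group_add \<Rightarrow> 'f::field mat"
  assumes carr: "\<And>v. M v \<in> carrier_mat N N"
begin

lemma word_mat_carrier: "word_mat N M vs \<in> carrier_mat N N"
  by (induction vs) (auto intro: mult_carrier_mat carr)

lemma word_mat_append: "word_mat N M (us @ vs) = word_mat N M us * word_mat N M vs"
  by (induction us)
    (simp_all add: left_mult_one_mat[OF word_mat_carrier]
      assoc_mult_mat[OF carr word_mat_carrier word_mat_carrier])

lemma matrix_eval_single:
  "matrix_eval N M (Poly_Mapping.single w c) = c \<cdot>\<^sub>m word_mat N M (letters w)"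
  using word_mat_carrier[of "letters w"]
  by (subst matrix_eval_superset[of "{w}"]) (auto intro!: eq_matI)

lemma matrix_eval_zero: "matrix_eval N M 0 = 0\<^sub>m N N"
  by (rule eq_matI) (simp_all add: matrix_eval_def)

lemma matrix_eval_mult: "matrix_eval N M (x * y) = matrix_eval N M x * matrix_eval N M y"
proof (induction x rule: free_algebra_induct)
  case zero
  then show ?case by (simp add: matrix_eval_zero left_mult_zero_mat[of _ N N])
next
  case (add x x')
  then show ?case
    by (simp add: distrib_right matrix_eval_add add_mult_distrib_mat[of _ N N _ _ N])
next
  case (single w c)
  show ?case
  proof (induction y rule: free_algebra_induct)
    case zero
    then show ?case by (simp add: matrix_eval_zero right_mult_zero_mat[of _ N N])
  next
    case (add y y')
    then show ?case
      by (simp add: distrib_left matrix_eval_add mult_add_distrib_mat[of _ N N _ N])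
  next
    case (single w' c')
    show ?case
    proof -
      let ?A = "word_mat N M (letters w)" and ?B = "word_mat N M (letters w')"
      have A: "?A \<in> carrier_mat N N" and B: "?B \<in> carrier_mat N N" by (rule word_mat_carrier)+
      have "(c \<cdot>\<^sub>m ?A) * (c' \<cdot>\<^sub>m ?B) = c' \<cdot>\<^sub>m (c \<cdot>\<^sub>m (?A * ?B))"
        using A B by (simp only: mult_smult_assoc_mat[of _ N N _ N] mult_smult_distrib[of _ N N _ N] smult_carrier_mat)
      also have "\<dots> = (c * c') \<cdot>\<^sub>m (?A * ?B)"
        by (rule eq_matI) (simp_all add: mult_ac del: index_mult_mat(1))
      finally show ?thesis
        by (simp add: mult_single matrix_eval_single plus_free_monoid_def word_mat_append)
    qed
  qed
qed

lemma matrix_eval_const: "matrix_eval N M (free_const a) = a \<cdot>\<^sub>m 1\<^sub>m N"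
  by (simp add: free_const_def matrix_eval_single zero_free_monoid_def)

lemma matrix_eval_gen: "matrix_eval N M (free_gen v) = M v"
  using carr[of v] by (auto simp: free_gen_def matrix_eval_single intro!: eq_matI)

lemma matrix_eval_diff: "matrix_eval N M (x - y) = matrix_eval N M x - matrix_eval N M y"
proof -
  have "matrix_eval N M (x - y) + matrix_eval N M y = matrix_eval N M x"
    by (simp flip: matrix_eval_add)
  moreover have "matrix_eval N M (x - y) = matrix_eval N M (x - y) + matrix_eval N M y - matrix_eval N M y"
    by (rule eq_matI) (auto simp: carrier_matD[OF matrix_eval_carrier])
  ultimately show ?thesis by simp
qed

lemma ideal_matrix_eval_kernel: "ideal {x. matrix_eval N M x = 0\<^sub>m N N} ring_of_type_algebra"
  by (rule ideal_type_algebraI)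
    (simp_all add: matrix_eval_zero matrix_eval_add matrix_eval_mult
      left_mult_zero_mat[of _ N N] right_mult_zero_mat[of _ N N])

text \<open>Half of the universal property: the defining relations evaluate to zero and the kernel
  is an ideal.\<close>

lemma clifford_ideal_subset_kernel:
  assumes add: "\<And>u v. M (u + v) = M u + M v" and sc: "\<And>a v. M (scale a v) = a \<cdot>\<^sub>m M v"
    and sq: "\<And>v. M v * M v = q v \<cdot>\<^sub>m 1\<^sub>m N"
  shows "clifford_ideal scale q \<subseteq> {x. matrix_eval N M x = 0\<^sub>m N N}"
proof -
  interpret R: ring "ring_of_type_algebra :: ('f, 'v) free_algebra ring"
    by (rule ring_ring_of_type_algebra)
  have "a \<cdot>\<^sub>m 1\<^sub>m N * M v = a \<cdot>\<^sub>m M v" for a v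
    using carr[of v] by (simp add: mult_smult_assoc_mat[of _ N N _ N])
  then have "clifford_relations scale q \<subseteq> {x. matrix_eval N M x = 0\<^sub>m N N}"
    unfolding clifford_relations_def using carr add_carrier_mat[OF carr]
    by (auto simp: matrix_eval_diff matrix_eval_add matrix_eval_mult matrix_eval_gen matrix_eval_const add sc sq
        minus_r_inv_mat[of _ N N])
  then show ?thesis
    unfolding clifford_ideal_def by (rule R.genideal_minimal[OF ideal_matrix_eval_kernel])
qed

end

lemma diff_mat_eq_zero_iff:
  fixes A :: "'a::ab_group_add mat"
  assumes "A \<in> carrier_mat m n" "B \<in> carrier_mat m n"
  shows "A - B = 0\<^sub>m m n \<longleftrightarrow> A = B"
proof
  assume eq: "A - B = 0\<^sub>m m n"
  show "A = B"
  proof (rule eq_matI)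
    fix i j assume ij: "i < dim_row B" "j < dim_col B"
    then have "(A - B) $$ (i, j) = A $$ (i, j) - B $$ (i, j)" by (rule index_minus_mat(1))
    moreover have "(A - B) $$ (i, j) = 0" using eq ij assms by simp
    ultimately show "A $$ (i, j) = B $$ (i, j)" by simp
  qed (use assms in auto)
qed (use assms in \<open>auto intro: eq_matI\<close>)

text \<open>The image of the evaluation is a subalgebra containing \<open>range M\<close>, hence
  everything by \<open>gen\<close>. Both \<open>J_\<tau>\<close> and transposition reverse products,
  so their agreement on vectors spreads to words and by linearity to all elements.\<close>

lemma clifford_algebra_iso_matrices:
  fixes scale :: "'f::field \<Rightarrow> 'v::ab_group_add \<Rightarrow> 'v" and q :: "'v \<Rightarrow> 'f" and M :: "'v \<Rightarrow> 'f mat"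
  assumes char: "CHAR('f) = 2" and vs: "vector_space scale"
    and \<tau>: "\<tau> \<in> orthogonal_group scale q" "\<tau> \<circ> \<tau> = id"
    and N: "0 < N" and carr: "\<And>v. M v \<in> carrier_mat N N"
    and add: "\<And>u v. M (u + v) = M u + M v" and sc: "\<And>a v. M (scale a v) = a \<cdot>\<^sub>m M v"
    and sq: "\<And>v. M v * M v = q v \<cdot>\<^sub>m 1\<^sub>m N"
    and tr: "\<And>v. M (\<tau> v) = transpose_mat (M v)"
    and span: "module.span scale (set xs) = UNIV"
    and dual: "\<forall>us v ws. xs = us @ v # ws \<longrightarrow> (\<exists>z. polar q z v = 1 \<and> (\<forall>w\<in>set ws. polar q z w = 0))"
    and gen: "generates_matrices N (range M)"
  shows "involution_algebra_iso (clifford_algebra scale q) (clifford_involution scale q \<tau>)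
    (module_mat TYPE('f) N N) transpose_mat"
proof -
  let ?A = "clifford_algebra scale q" and ?c = "clifford_class scale q" and ?I = "clifford_ideal scale q"
  let ?ev = "matrix_eval N M" and ?J = "clifford_involution scale q \<tau>"
  let ?K = "{x. ?ev x = 0\<^sub>m N N}"
  note ev_const = matrix_eval_const[where N = N and M = M, OF carr]
    and ev_mult = matrix_eval_mult[where N = N and M = M, OF carr]
    and ev_gen = matrix_eval_gen[where N = N and M = M, OF carr]
  have sub: "?I \<subseteq> ?K" by (rule clifford_ideal_subset_kernel[OF carr add sc sq])
  have K: "ideal ?K ring_of_type_algebra" by (rule ideal_matrix_eval_kernel[OF carr])
  have "?ev 1 = 1\<^sub>m N"
    using ev_const[of 1] by (auto simp: free_const_simps intro!: eq_matI)
  note ev_one = this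
  have one: "1 \<notin> ?K"
  proof
    assume "1 \<in> ?K"
    then have "(1\<^sub>m N :: 'f mat) $$ (0, 0) = 0\<^sub>m N N $$ (0, 0)" using ev_one by simp
    then show False using N by simp
  qed
  have ker: "x \<in> ?I" if "?ev x = 0\<^sub>m N N" for x
    by (rule clifford_span_proper_ideal[OF char K sub one dual])
      (use that clifford_span_UNIV[OF vs span, of q] in auto)
  \<comment> \<open>One direction makes \<open>\<phi>\<close> independent of the chosen
    representative, the other makes it injective.\<close>
  have ev_eq: "?ev x = ?ev y \<longleftrightarrow> ?c x = ?c y" for x y
    using diff_mat_eq_zero_iff[of "?ev x" N N "?ev y"] matrix_eval_diff[where N = N and M = M, OF carr, of x y] ker[of "x - y"] sub
    by (auto simp: clifford_class_eq_iff)
  define \<phi> where "\<phi> S = ?ev (SOME x. ?c x = S)" for S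
  have phi: "\<phi> (?c x) = ?ev x" for x
  proof -
    have "?c (SOME y. ?c y = ?c x) = ?c x" by (rule someI) simp
    then show ?thesis by (simp add: \<phi>_def ev_eq)
  qed
  have "matrix_subalgebra N (range ?ev)"
    unfolding matrix_subalgebra_def
  proof (intro conjI ballI allI)
    show "range ?ev \<subseteq> carrier_mat N N" by auto
    show "1\<^sub>m N \<in> range ?ev" using ev_one by (metis rangeI)
    fix A assume "A \<in> range ?ev"
    then obtain x where x: "A = ?ev x" by blast
    have "c \<cdot>\<^sub>m A = ?ev (free_const c * x)" for c
      using mult_smult_assoc_mat[of "1\<^sub>m N" N N "?ev x" N c]
      by (simp add: x ev_mult ev_const left_mult_one_mat[of _ N N])
    then show "c \<cdot>\<^sub>m A \<in> range ?ev" for c by blast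
    fix B assume "B \<in> range ?ev"
    then obtain y where y: "B = ?ev y" by blast
    show "A + B \<in> range ?ev" unfolding x y by (metis matrix_eval_add rangeI)
    show "A * B \<in> range ?ev" unfolding x y by (metis ev_mult rangeI)
  qed
  moreover have "range M \<subseteq> range ?ev"
    using ev_gen by (metis image_subsetI rangeI)
  ultimately have surj: "range ?ev = carrier_mat N N"
    using gen matrix_eval_carrier unfolding generates_matrices_def by blast
  have J: "is_clifford_involution scale q \<tau> ?J"
    unfolding clifford_involution_def by (rule theI'[OF clifford_involution_ex1[OF \<tau>]])
  then have alg: "algebra_involution ?A ?J" and Jg: "?J (?c (free_gen v)) = ?c (free_gen (\<tau> v))" for v
    by (auto simp: is_clifford_involution_def clifford_gen_def)
  have c: "?c x \<in> carrier ?A" for x by (simp add: carrier_clifford)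
  have "?J \<in> carrier ?A \<rightarrow> carrier ?A" using alg unfolding algebra_involution_def by (rule conjunct1)
  then have Jc: "?J (?c x) \<in> carrier ?A" for x by (rule funcset_mem[OF _ c])
  have J_add: "?J (?c (x + y)) = ?J (?c x) \<oplus>\<^bsub>?A\<^esub> ?J (?c y)"
    and J_mult: "?J (?c (x * y)) = ?J (?c y) \<otimes>\<^bsub>?A\<^esub> ?J (?c x)"
    for x y
    using alg by (simp_all add: algebra_involution_def c clifford_class_simps(1,2))
  have J_smult: "?J (?c (free_const a * x)) = a \<odot>\<^bsub>?A\<^esub> ?J (?c x)" for x a
    using alg by (simp add: algebra_involution_def c clifford_class_simps(4))
  have phi_add: "\<phi> (S \<oplus>\<^bsub>?A\<^esub> T) = \<phi> S + \<phi> T" and phi_mult: "\<phi> (S \<otimes>\<^bsub>?A\<^esub> T) = \<phi> S * \<phi> T"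
    if "S \<in> carrier ?A" "T \<in> carrier ?A" for S T
    using that
    by (auto simp: carrier_clifford phi matrix_eval_add ev_mult simp flip: clifford_class_simps)
  have phi_smult: "\<phi> (a \<odot>\<^bsub>?A\<^esub> S) = a \<cdot>\<^sub>m \<phi> S" if S: "S \<in> carrier ?A" for S a
  proof -
    obtain x where x: "S = ?c x" using S by (auto simp: carrier_clifford)
    have "\<phi> (a \<odot>\<^bsub>?A\<^esub> S) = ?ev (free_const a * x)"
      by (simp add: x phi flip: clifford_class_simps)
    also have "\<dots> = a \<cdot>\<^sub>m ?ev x"
      using mult_smult_assoc_mat[of "1\<^sub>m N" N N "?ev x" N a]
      by (simp add: ev_mult ev_const left_mult_one_mat[of _ N N])
    finally show ?thesis by (simp add: x phi)
  qed
  have J_one: "?J (?c 1) = ?c 1"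
    using involution_one[OF alg] by (simp add: clifford_class_simps(3))
  have word: "\<phi> (?J (?c (Poly_Mapping.single (Word w) 1))) = transpose_mat (?ev (Poly_Mapping.single (Word w) 1))" for w
  proof (induction w)
    case Nil
    then show ?case using J_one ev_one by (simp add: phi flip: zero_free_monoid_def)
  next
    case (Cons v w)
    have e: "Poly_Mapping.single (Word (v # w)) (1::'f) = free_gen v * Poly_Mapping.single (Word w) 1"
      by (simp add: free_gen_def mult_single plus_free_monoid_def)
    let ?W = "?ev (Poly_Mapping.single (Word w) 1)"
    have "\<phi> (?J (?c (free_gen v * Poly_Mapping.single (Word w) 1))) = transpose_mat ?W * transpose_mat (M v)"
      unfolding J_mult phi_mult[OF Jc Jc] unfolding Cons.IH Jg phi ev_gen tr ..
    also have "\<dots> = transpose_mat (M v * ?W)"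
      by (rule transpose_mult[symmetric, of _ N N _ N]) (simp_all add: carr)
    finally show ?case unfolding e ev_mult ev_gen .
  qed
  have phiJ: "\<phi> (?J (?c x)) = transpose_mat (?ev x)" for x
  proof (induction x rule: free_algebra_induct)
    case zero
    have "\<phi> (?J (?c (free_const 0 * 1))) = transpose_mat (?ev (free_const 0 * 1))"
      unfolding J_smult J_one phi_smult[OF c] phi ev_one
      by (auto simp: ev_mult ev_const ev_one intro!: eq_matI)
    then show ?case by (simp add: free_const_simps)
  next
    case (add x y)
    show ?case
      unfolding J_add phi_add[OF Jc Jc] unfolding add matrix_eval_add
      by (rule transpose_add[symmetric, of _ N N]) simp_all
  next
    case (single w k)
    have e: "Poly_Mapping.single w k = free_const k * Poly_Mapping.single (Word (letters w)) 1"
      by (simp add: free_const_def mult_single)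
    have "?ev (Poly_Mapping.single w k) = k \<cdot>\<^sub>m ?ev (Poly_Mapping.single (Word (letters w)) 1)"
      unfolding e using phi_smult[OF c] by (metis clifford_class_simps(4) phi)
    moreover have "\<phi> (?J (?c (Poly_Mapping.single w k))) = k \<cdot>\<^sub>m transpose_mat (?ev (Poly_Mapping.single (Word (letters w)) 1))"
      unfolding e J_smult phi_smult[OF Jc] unfolding word ..
    ultimately show ?case by (auto intro!: eq_matI)
  qed
  have "\<phi> \<in> ring_iso ?A (module_mat TYPE('f) N N)"
    unfolding ring_iso_def
  proof (intro CollectI conjI)
    show "\<phi> \<in> Ring.ring_hom ?A (module_mat TYPE('f) N N)"
    proof (rule ring_hom_memI)
      show "\<phi> S \<in> carrier (module_mat TYPE('f) N N)" if "S \<in> carrier ?A" for S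
        using that by (auto simp: carrier_clifford phi module_mat_simps)
      show "\<phi> (\<one>\<^bsub>?A\<^esub>) = \<one>\<^bsub>module_mat TYPE('f) N N\<^esub>"
        by (simp add: phi ev_one module_mat_simps flip: clifford_class_simps(3))
    qed (simp_all add: phi_add phi_mult module_mat_simps)
    show "bij_betw \<phi> (carrier ?A) (carrier (module_mat TYPE('f) N N))"
      unfolding bij_betw_def
    proof
      show "inj_on \<phi> (carrier ?A)"
        by (auto simp: inj_on_def carrier_clifford phi ev_eq)
      show "\<phi> ` carrier ?A = carrier (module_mat TYPE('f) N N)"
        by (simp add: carrier_clifford image_image phi surj module_mat_simps)
    qed
  qed
  moreover have "\<phi> (a \<odot>\<^bsub>?A\<^esub> S) = a \<odot>\<^bsub>module_mat TYPE('f) N N\<^esub> \<phi> S" if "S \<in> carrier ?A" for a S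
    using phi_smult[OF that] by (simp add: module_mat_simps)
  moreover have "\<phi> (?J S) = transpose_mat (\<phi> S)" if "S \<in> carrier ?A" for S
    using that phiJ by (auto simp: carrier_clifford phi)
  ultimately show ?thesis unfolding involution_algebra_iso_def by blast
qed

text \<open>Additivity of the Frobenius map: the cross terms carry a factor 2.\<close>

lemma sum_squares_char_2:
  fixes g :: "'i \<Rightarrow> 'a::comm_ring_1"
  assumes "CHAR('a) = 2"
  shows "(\<Sum>i\<in>A. (g i)\<^sup>2) = (\<Sum>i\<in>A. g i)\<^sup>2"
proof (induction A rule: infinite_finite_induct)
  case (insert x A)
  have "2 * g x * sum g A = 0"
    using char_2_add_self(1)[OF assms, of "g x * sum g A"] by (simp add: mult_2 algebra_simps)
  then show ?case using insert by (simp add: power2_sum)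
qed auto

lemma square_if_involution_algebra_iso:
  fixes scale :: "'f::field \<Rightarrow> 'v::ab_group_add \<Rightarrow> 'v" and q :: "'v \<Rightarrow> 'f"
  assumes char: "CHAR('f) = 2" and N: "0 < N"
    and \<tau>: "\<tau> \<in> orthogonal_group scale q" "\<tau> \<circ> \<tau> = id" and x: "\<tau> x = x"
    and iso: "involution_algebra_iso (clifford_algebra scale q) (clifford_involution scale q \<tau>)
      (module_mat TYPE('f) N N) transpose_mat"
  shows "\<exists>a. q x = a\<^sup>2"
proof -
  let ?A = "clifford_algebra scale q" and ?c = "clifford_class scale q" and ?J = "clifford_involution scale q \<tau>"
  obtain \<phi> where phi: "\<phi> \<in> ring_iso ?A (module_mat TYPE('f) N N)"
    and sc: "\<And>a S. S \<in> carrier ?A \<Longrightarrow> \<phi> (a \<odot>\<^bsub>?A\<^esub> S) = a \<cdot>\<^sub>m \<phi> S"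
    and tr: "\<And>S. S \<in> carrier ?A \<Longrightarrow> \<phi> (?J S) = transpose_mat (\<phi> S)"
    using iso by (auto simp: involution_algebra_iso_def module_mat_simps)
  then have hom: "\<phi> \<in> Ring.ring_hom ?A (module_mat TYPE('f) N N)" by (simp add: ring_iso_def)
  have "is_clifford_involution scale q \<tau> ?J"
    unfolding clifford_involution_def by (rule theI'[OF clifford_involution_ex1[OF \<tau>]])
  then have J: "?J (?c (free_gen x)) = ?c (free_gen x)"
    by (simp add: is_clifford_involution_def clifford_gen_def x)
  have c: "?c y \<in> carrier ?A" for y by (simp add: carrier_clifford)
  define X' where "X' = \<phi> (?c (free_gen x))"
  have X: "X' \<in> carrier_mat N N" using ring_hom_closed[OF hom c] by (simp add: X'_def module_mat_simps)
  have sym: "transpose_mat X' = X'" using tr[OF c, of "free_gen x"] J by (simp add: X'_def)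
  have "X' * X' = \<phi> (?c (free_gen x * free_gen x))"
    using ring_hom_mult[OF hom c c] by (simp add: X'_def module_mat_simps clifford_class_simps)
  \<comment> \<open>The factor 1 exhibits the constant as a scalar acting on the unit, where
    \<open>\<phi>\<close> is known.\<close>
  also have "?c (free_gen x * free_gen x) = ?c (free_const (q x) * 1)"
    using clifford_ideal_relations(3)[of x q scale] by (simp add: clifford_class_eq_iff)
  also have "\<phi> \<dots> = q x \<cdot>\<^sub>m 1\<^sub>m N"
    unfolding clifford_class_simps(4) sc[OF c] unfolding clifford_class_simps(3)
    using ring_hom_one[OF hom] by (simp add: module_mat_simps)
  finally have "(X' * X') $$ (0, 0) = (q x \<cdot>\<^sub>m 1\<^sub>m N) $$ (0, 0)" by simp
  moreover have "(X' * X') $$ (0, 0) = (\<Sum>j<N. X' $$ (0, j) * X' $$ (j, 0))"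
    using X N by (simp add: scalar_prod_def atLeast0LessThan)
  moreover have "\<dots> = (\<Sum>j<N. (X' $$ (0, j))\<^sup>2)"
  proof (rule sum.cong[OF refl])
    fix j assume "j \<in> {..<N}"
    then have "transpose_mat X' $$ (0, j) = X' $$ (j, 0)" using X N by simp
    then show "X' $$ (0, j) * X' $$ (j, 0) = (X' $$ (0, j))\<^sup>2" by (simp add: sym power2_eq_square)
  qed
  ultimately have "q x = (\<Sum>j<N. (X' $$ (0, j))\<^sup>2)" using N by simp
  then show ?thesis unfolding sum_squares_char_2[OF char] by blast
qed

section \<open>Symmetric bilinear forms in characteristic two\<close>

text \<open>All conditions are relative to \<open>U\<close>, because the values of
  \<open>wall_form\<close> are meaningful only on \<open>Res \<tau>\<close>.\<close>

definition symmetric_form_on ::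
    "('f::field \<Rightarrow> 'v::ab_group_add \<Rightarrow> 'v) \<Rightarrow> 'v set \<Rightarrow> ('v \<Rightarrow> 'v \<Rightarrow> 'f) \<Rightarrow> bool" where
  "symmetric_form_on scale U \<omega> \<longleftrightarrow> module.subspace scale U \<and>
     (\<forall>x\<in>U. \<forall>y\<in>U. \<omega> x y = \<omega> y x) \<and>
     (\<forall>x\<in>U. \<forall>y\<in>U. \<forall>z\<in>U. \<omega> (x + y) z = \<omega> x z + \<omega> y z) \<and>
     (\<forall>a. \<forall>x\<in>U. \<forall>y\<in>U. \<omega> (scale a x) y = a * \<omega> x y) \<and>
     (\<forall>x\<in>U. (\<forall>y\<in>U. \<omega> x y = 0) \<longrightarrow> x = 0)"

text \<open>The Gram matrix is the permutation matrix of \<sigma>: the identity describes an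
  orthonormal basis and \<open>partner\<close> a symplectic one. For an involution \<sigma> the dual
  of \<open>w i\<close> is \<open>w (\<sigma> i)\<close>, which explains the coefficients in the
  last clause.\<close>

definition monomial_basis ::
    "('f::field \<Rightarrow> 'v::ab_group_add \<Rightarrow> 'v) \<Rightarrow> 'v set \<Rightarrow> ('v \<Rightarrow> 'v \<Rightarrow> 'f) \<Rightarrow> nat \<Rightarrow>
      (nat \<Rightarrow> nat) \<Rightarrow> (nat \<Rightarrow> 'v) \<Rightarrow> bool" where
  "monomial_basis scale U \<omega> k \<sigma> w \<longleftrightarrow>
     (\<forall>i<k. w i \<in> U) \<and>
     (\<forall>i<k. \<forall>j<k. \<omega> (w i) (w j) = (if j = \<sigma> i then 1 else 0)) \<and>
     (\<forall>x\<in>U. x = (\<Sum>i<k. scale (\<omega> x (w (\<sigma> i))) (w i)))"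

definition partner :: "nat \<Rightarrow> nat" where
  "partner i = (if even i then Suc i else i - 1)"

lemma partner_partner [simp]: "partner (partner i) = i"
  by (auto simp: partner_def elim: oddE)

lemma partner_less: "even k \<Longrightarrow> i < k \<Longrightarrow> partner i < k"
  by (auto simp: partner_def elim!: evenE oddE)

context finite_dimensional_vector_space
begin

context
  fixes U :: "'b set" and \<omega> :: "'b \<Rightarrow> 'b \<Rightarrow> 'a"
  assumes form: "symmetric_form_on scale U \<omega>"
begin

lemma form_subspace: "subspace U"
  using form by (simp add: symmetric_form_on_def)

lemma form_sym: "x \<in> U \<Longrightarrow> y \<in> U \<Longrightarrow> \<omega> x y = \<omega> y x"
  using form by (simp add: symmetric_form_on_def)

lemma form_add: "x \<in> U \<Longrightarrow> y \<in> U \<Longrightarrow> z \<in> U \<Longrightarrow> \<omega> (x + y) z = \<omega> x z + \<omega> y z"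
  using form by (simp add: symmetric_form_on_def)

lemma form_scale: "x \<in> U \<Longrightarrow> y \<in> U \<Longrightarrow> \<omega> (a *s x) y = a * \<omega> x y"
  using form by (simp add: symmetric_form_on_def)

lemma form_nondegenerate: "x \<in> U \<Longrightarrow> (\<And>y. y \<in> U \<Longrightarrow> \<omega> x y = 0) \<Longrightarrow> x = 0"
  using form by (simp add: symmetric_form_on_def)

lemma form_diff: "x \<in> U \<Longrightarrow> y \<in> U \<Longrightarrow> z \<in> U \<Longrightarrow> \<omega> (x - y) z = \<omega> x z - \<omega> y z"
  using form_add[of "x - y" y z] subspace_diff[OF form_subspace] by simp

lemma form_add_right: "x \<in> U \<Longrightarrow> y \<in> U \<Longrightarrow> z \<in> U \<Longrightarrow> \<omega> x (y + z) = \<omega> x y + \<omega> x z"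
  using form_add[of y z x] form_sym subspace_add[OF form_subspace] by simp

lemma form_scale_right: "x \<in> U \<Longrightarrow> y \<in> U \<Longrightarrow> \<omega> x (a *s y) = a * \<omega> x y"
  using form_scale[of y x a] form_sym subspace_scale[OF form_subspace] by simp

lemma form_zero: "y \<in> U \<Longrightarrow> \<omega> 0 y = 0"
  using form_scale[of 0 y 0] subspace_0[OF form_subspace] by simp

lemma form_sum: "(\<And>i. i \<in> A \<Longrightarrow> g i \<in> U) \<Longrightarrow> y \<in> U \<Longrightarrow> \<omega> (sum g A) y = (\<Sum>i\<in>A. \<omega> (g i) y)"
  by (induction A rule: infinite_finite_induct)
    (simp_all add: form_zero form_add subspace_sum[OF form_subspace])

text \<open>A vector of the complement of \<open>E\<close> that is orthogonal to this complement is
  also orthogonal to \<open>span E\<close>. By \<open>proj\<close> these two parts make up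
  \<open>U\<close>, so nondegeneracy passes to the complement.\<close>

lemma symmetric_form_on_orthogonal:
  assumes E: "E \<subseteq> U"
    and proj: "\<And>x. x \<in> U \<Longrightarrow> \<exists>p\<in>span E. x - p \<in> {x \<in> U. \<forall>e\<in>E. \<omega> x e = 0}"
  shows "symmetric_form_on scale {x \<in> U. \<forall>e\<in>E. \<omega> x e = 0} \<omega>"
proof -
  let ?U = "{x \<in> U. \<forall>e\<in>E. \<omega> x e = 0}"
  have sub: "subspace ?U"
    using E form_subspace
    by (intro subspaceI) (auto simp: form_zero form_add form_scale subspace_0 subspace_add subspace_scale subset_iff)
  have nd: "x = 0" if x: "x \<in> ?U" and 0: "\<And>y. y \<in> ?U \<Longrightarrow> \<omega> x y = 0" for x
  proof (rule form_nondegenerate)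
    show "x \<in> U" using x by simp
    fix y assume y: "y \<in> U"
    obtain p where p: "p \<in> span E" "y - p \<in> ?U" using proj[OF y] by blast
    have "E \<subseteq> {z \<in> U. \<omega> x z = 0}" using E x by auto
    moreover have "subspace {z \<in> U. \<omega> x z = 0}"
      using x form_subspace form_sym[of x 0]
      by (intro subspaceI) (auto simp: form_zero form_add_right form_scale_right subspace_0 subspace_add subspace_scale)
    ultimately have "p \<in> U" "\<omega> x p = 0" using span_minimal[of E] p(1) by auto
    then show "\<omega> x y = 0"
      using form_add_right[of x "y - p" p] 0[OF p(2)] p(2) x by simp
  qed
  show ?thesis
    unfolding symmetric_form_on_def
    using sub nd form_sym form_add form_scale by blast
qed

lemma unit_vector_split:
  assumes e: "e \<in> U" "\<omega> e e = 1"
  defines "U' \<equiv> {x \<in> U. \<forall>e\<in>{e}. \<omega> x e = 0}"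
  shows "symmetric_form_on scale U' \<omega>" "dim U = Suc (dim U')"
    "x \<in> U \<Longrightarrow> x - \<omega> x e *s e \<in> U'"
proof -
  note sub = subspace_0[OF form_subspace] subspace_add[OF form_subspace] subspace_diff[OF form_subspace]
    subspace_scale[OF form_subspace]
  show proj: "x - \<omega> x e *s e \<in> U'" if "x \<in> U" for x
    using that e by (simp add: U'_def form_diff form_scale sub)
  show form': "symmetric_form_on scale U' \<omega>"
    unfolding U'_def
  proof (rule symmetric_form_on_orthogonal)
    fix x assume "x \<in> U"
    moreover have "\<omega> x e *s e \<in> span {e}"
      by (intro span_scale span_base) auto
    ultimately show "\<exists>p\<in>span {e}. x - p \<in> {x \<in> U. \<forall>e\<in>{e}. \<omega> x e = 0}"
      using proj unfolding U'_def by blast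
  qed (use e in auto)
  then have sub': "subspace U'" by (simp add: symmetric_form_on_def)
  have "span (insert e U') = U"
  proof
    show "span (insert e U') \<subseteq> U"
      using e by (intro span_minimal form_subspace) (auto simp: U'_def)
    show "U \<subseteq> span (insert e U')"
    proof
      fix x assume "x \<in> U"
      then have "x - \<omega> x e *s e \<in> span (insert e U')"
        using proj by (intro span_base) simp
      moreover have "\<omega> x e *s e \<in> span (insert e U')" by (intro span_scale span_base) simp
      ultimately have "x - \<omega> x e *s e + \<omega> x e *s e \<in> span (insert e U')" by (rule span_add)
      then show "x \<in> span (insert e U')" by simp
    qed
  qed
  moreover have "e \<notin> span U'" using e sub' by (simp add: span_eq_iff[THEN iffD2] U'_def)
  ultimately show "dim U = Suc (dim U')" using dim_insert[of e U'] dim_span by (metis Suc_eq_plus1)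
qed

text \<open>The coordinates are crossed since \<open>e\<close> and \<open>f\<close> are dual to each
  other: the coefficient of \<open>e\<close> is the product with \<open>f\<close>, and
  conversely.\<close>

lemma hyperbolic_pair_split:
  assumes e: "e \<in> U" "f \<in> U" "\<omega> e e = 0" "\<omega> f f = 0" "\<omega> e f = 1"
  defines "U' \<equiv> {x \<in> U. \<forall>e\<in>{e, f}. \<omega> x e = 0}"
  shows "symmetric_form_on scale U' \<omega>" "dim U = Suc (Suc (dim U'))"
    "x \<in> U \<Longrightarrow> x - (\<omega> x f *s e + \<omega> x e *s f) \<in> U'"
proof -
  note sub = subspace_0[OF form_subspace] subspace_add[OF form_subspace] subspace_diff[OF form_subspace]
    subspace_scale[OF form_subspace]
  have fe: "\<omega> f e = 1" using e form_sym by simp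
  show proj: "x - (\<omega> x f *s e + \<omega> x e *s f) \<in> U'" if "x \<in> U" for x
    using that e fe by (simp add: U'_def form_diff form_add form_scale sub)
  show form': "symmetric_form_on scale U' \<omega>"
    unfolding U'_def
  proof (rule symmetric_form_on_orthogonal)
    fix x assume "x \<in> U"
    moreover have "\<omega> x f *s e + \<omega> x e *s f \<in> span {e, f}"
      by (intro span_add span_scale span_base) auto
    ultimately show "\<exists>p\<in>span {e, f}. x - p \<in> {x \<in> U. \<forall>e\<in>{e, f}. \<omega> x e = 0}"
      using proj unfolding U'_def by blast
  qed (use e in auto)
  then have sub': "subspace U'" by (simp add: symmetric_form_on_def)
  have "span (insert f (insert e U')) = U" (is "?S = U")
  proof
    show "?S \<subseteq> U"
      using e by (intro span_minimal form_subspace) (auto simp: U'_def)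
    show "U \<subseteq> ?S"
    proof
      fix x assume "x \<in> U"
      then have "x - (\<omega> x f *s e + \<omega> x e *s f) \<in> ?S"
        using proj by (intro span_base) simp
      moreover have "\<omega> x f *s e + \<omega> x e *s f \<in> ?S" by (intro span_add span_scale span_base) auto
      ultimately have "x - (\<omega> x f *s e + \<omega> x e *s f) + (\<omega> x f *s e + \<omega> x e *s f) \<in> ?S" by (rule span_add)
      then show "x \<in> ?S" by simp
    qed
  qed
  moreover have "e \<notin> span U'" using e sub' by (simp add: span_eq_iff[THEN iffD2] U'_def)
  \<comment> \<open>Everything in this span is orthogonal to \<open>e\<close>, whereas
    \<open>\<omega> f e = 1\<close>.\<close>
  moreover have "f \<notin> span (insert e U')"
  proof -
    have "subspace {x \<in> U. \<omega> x e = 0}"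
      using e by (intro subspaceI) (auto simp: form_zero form_add form_scale sub)
    then have "span (insert e U') \<subseteq> {x \<in> U. \<omega> x e = 0}"
      using e by (intro span_minimal) (auto simp: U'_def)
    then show ?thesis using fe by auto
  qed
  ultimately show "dim U = Suc (Suc (dim U'))"
    using dim_insert[of e U'] dim_insert[of f "insert e U'"] dim_span by (metis Suc_eq_plus1)
qed

end

lemma dim_zero_subspace: "subspace U \<Longrightarrow> dim U = 0 \<Longrightarrow> U = {0}"
  using dim_eq_0[of U] subspace_0 by auto

text \<open>A unit vector is split off, but the induction needs a complement that is zero or again
  not alternating. If the complement of \<open>e0\<close> is nonzero and alternating, it contains
  \<open>x\<close>, \<open>z'\<close> with \<open>\<omega> x z' = 1\<close>. Then
  \<open>e0 + x\<close> is still a unit vector, and \<open>e0 + z'\<close> is a unit vector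
  orthogonal to it. This is the isometry of <1> plus a hyperbolic plane with 3<1>.\<close>

lemma unit_basis_exists:
  assumes char: "CHAR('a) = 2"
  shows "symmetric_form_on scale U \<omega> \<Longrightarrow> \<forall>x\<in>U. \<exists>a. \<omega> x x = a\<^sup>2 \<Longrightarrow>
    dim U = 0 \<or> (\<exists>x\<in>U. \<omega> x x \<noteq> 0) \<Longrightarrow> \<exists>w. monomial_basis scale U \<omega> (dim U) (\<lambda>i. i) w"
proof (induction "dim U" arbitrary: U)
  case 0
  have "U = {0}" using 0 form_subspace[OF 0(2)] dim_zero_subspace by metis
  then have "dim U = 0" "U = {0}" using 0 by auto
  then show ?case by (auto simp: monomial_basis_def)
next
  case (Suc k)
  note ch = char_2_add_self[OF char]
  note form = Suc.prems(1)
  note sub = subspace_add[OF form_subspace[OF form]] subspace_scale[OF form_subspace[OF form]]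
  have "dim U \<noteq> 0" using Suc(2) by linarith
  then obtain u where u: "u \<in> U" "\<omega> u u \<noteq> 0" using Suc.prems(3) by metis
  obtain a where a: "\<omega> u u = a\<^sup>2" using Suc.prems(2) u by blast
  \<comment> \<open>Dividing by a square root of \<open>\<omega> u u\<close> normalises the value to
    1; this is where the hypothesis on squares enters.\<close>
  define e0 where "e0 = inverse a *s u"
  have e0: "e0 \<in> U" "\<omega> e0 e0 = 1"
    using u a by (auto simp: e0_def sub form_scale[OF form] form_scale_right[OF form] power2_eq_square field_simps)
  define perp where "perp e = {x \<in> U. \<forall>e\<in>{e}. \<omega> x e = 0}" for e
  note split = unit_vector_split[OF form, folded perp_def]
  obtain e where e: "e \<in> U" "\<omega> e e = 1" "k = 0 \<or> (\<exists>x\<in>perp e. \<omega> x x \<noteq> 0)"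
  proof (cases "k = 0 \<or> (\<exists>x\<in>perp e0. \<omega> x x \<noteq> 0)")
    case True
    then show ?thesis using that e0 by blast
  next
    case False
    then have alt: "\<omega> x x = 0" if "x \<in> perp e0" for x using that by auto
    note split0 = split[OF e0]
    have "dim (perp e0) = k" using split0(2) Suc(2) by simp
    with False have "perp e0 \<noteq> {0}" using dim_eq_0[of "perp e0"] by simp
    then obtain x where x: "x \<in> perp e0" "x \<noteq> 0"
      using subspace_0[OF form_subspace[OF split0(1)]] by auto
    then obtain z where z: "z \<in> perp e0" "\<omega> x z \<noteq> 0"
      using form_nondegenerate[OF split0(1), of x] by auto
    define z' where "z' = inverse (\<omega> x z) *s z"
    have z': "z' \<in> perp e0" "\<omega> x z' = 1"
      using z x subspace_scale[OF form_subspace[OF split0(1)]]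
      by (auto simp: z'_def form_scale_right[OF split0(1)])
    have U: "x \<in> U" "z' \<in> U" "\<omega> x e0 = 0" "\<omega> z' e0 = 0" using x z' by (auto simp: perp_def)
    then have U': "\<omega> e0 x = 0" "\<omega> e0 z' = 0" "\<omega> z' x = 1" using form_sym[OF form] e0 z' by auto
    show ?thesis
    proof
      show "e0 + x \<in> U" using e0 U sub by simp
      show "\<omega> (e0 + x) (e0 + x) = 1"
        using e0 U U' sub alt[OF x(1)] by (simp add: form_add[OF form] form_add_right[OF form])
      \<comment> \<open>The first value is
        \<open>\<omega> e0 e0 + \<omega> z' x = 1 + 1\<close>.\<close>
      have "\<omega> (e0 + z') (e0 + x) = 0" "\<omega> (e0 + z') (e0 + z') = 1"
        using e0 U U' sub alt[OF z'(1)] ch(1)[of 1]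
        by (simp_all add: form_add[OF form] form_add_right[OF form] del: one_add_one)
      then show "k = 0 \<or> (\<exists>y\<in>perp (e0 + x). \<omega> y y \<noteq> 0)"
        using e0 U sub by (intro disjI2 bexI[of _ "e0 + z'"]) (auto simp: perp_def)
    qed
  qed
  note split = split[OF e(1,2)]
  have k: "k = dim (perp e)" using split(2) Suc(2) by simp
  obtain w where w: "monomial_basis scale (perp e) \<omega> k (\<lambda>i. i) w"
    using Suc.hyps(1)[OF k split(1)] Suc.prems(2) e(3) k by (auto simp: perp_def)
  have wU: "w i \<in> U" "\<omega> (w i) e = 0" "\<omega> e (w i) = 0" if "i < k" for i
    using w that form_sym[OF form] e by (auto simp: monomial_basis_def perp_def)
  have "monomial_basis scale U \<omega> (Suc k) (\<lambda>i. i) (w(k := e))"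
    unfolding monomial_basis_def
  proof (intro conjI allI impI ballI)
    show "(w(k := e)) i \<in> U" if "i < Suc k" for i using that wU e by (auto simp: less_Suc_eq)
    show "\<omega> ((w(k := e)) i) ((w(k := e)) j) = (if j = i then 1 else 0)" if "i < Suc k" "j < Suc k" for i j
      using that w wU e by (auto simp: less_Suc_eq monomial_basis_def)
    fix x assume x: "x \<in> U"
    let ?x = "x - \<omega> x e *s e"
    have "?x = (\<Sum>i<k. \<omega> ?x (w i) *s w i)"
      using w split(3)[OF x] by (simp add: monomial_basis_def)
    also have "\<dots> = (\<Sum>i<k. \<omega> x (w i) *s w i)"
      using x e wU by (intro sum.cong) (auto simp: form_diff[OF form] form_scale[OF form] sub)
    finally have "x = (\<Sum>i<k. \<omega> x (w i) *s w i) + \<omega> x e *s e" by (simp add: algebra_simps)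
    then show "x = (\<Sum>i<Suc k. \<omega> x ((w(k := e)) i) *s (w(k := e)) i)" by simp
  qed
  then show ?case using Suc(2) by auto
qed

text \<open>Nondegeneracy supplies a partner for any nonzero vector, and both are isotropic because
  the form is alternating. Splitting off the pair lowers the dimension by two, hence the
  well-founded induction.\<close>

lemma symplectic_basis_exists:
  shows "symmetric_form_on scale U \<omega> \<Longrightarrow> \<forall>x\<in>U. \<omega> x x = 0 \<Longrightarrow>
    even (dim U) \<and> (\<exists>w. monomial_basis scale U \<omega> (dim U) partner w)"
proof (induction "dim U" arbitrary: U rule: less_induct)
  case less
  note form = less.prems(1)
  note sub = subspace_add[OF form_subspace[OF form]] subspace_scale[OF form_subspace[OF form]]
  show ?case
  proof (cases "dim U = 0")
    case True
    have "U = {0}" using True form_subspace[OF form] dim_zero_subspace by metis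
    then show ?thesis using True by (auto simp: monomial_basis_def)
  next
    case False
    then have "U \<noteq> {0}" using dim_eq_0[of U] by simp
    then obtain e where e: "e \<in> U" "e \<noteq> 0" using subspace_0[OF form_subspace[OF form]] by auto
    then obtain z where z: "z \<in> U" "\<omega> e z \<noteq> 0" using form_nondegenerate[OF form, of e] by auto
    define f where "f = inverse (\<omega> e z) *s z"
    have f: "f \<in> U" "\<omega> e f = 1" using z e sub by (auto simp: f_def form_scale_right[OF form])
    have fe: "\<omega> f e = 1" using f e form_sym[OF form] by simp
    have ef: "\<omega> e e = 0" "\<omega> f f = 0" using less.prems(2) e f by auto
    define U' where "U' = {x \<in> U. \<forall>e\<in>{e, f}. \<omega> x e = 0}"
    note split = hyperbolic_pair_split[OF form e(1) f(1) ef f(2), folded U'_def]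
    define k where "k = dim U'"
    have "even k \<and> (\<exists>w. monomial_basis scale U' \<omega> k partner w)"
      unfolding k_def by (rule less.hyps) (use split less.prems(2) in \<open>auto simp: U'_def\<close>)
    then obtain w where k: "even k" and w: "monomial_basis scale U' \<omega> k partner w" by auto
    have wU: "w i \<in> U" "\<omega> (w i) e = 0" "\<omega> e (w i) = 0" "\<omega> (w i) f = 0" "\<omega> f (w i) = 0" if "i < k" for i
      using w that form_sym[OF form] e f by (auto simp: monomial_basis_def U'_def)
    \<comment> \<open>Since \<open>k\<close> is even, the two appended positions are partners of
      each other and the older ones keep theirs.\<close>
    have pk: "partner k = Suc k" "partner (Suc k) = k" using k by (auto simp: partner_def)
    have pi: "partner i < k" if "i < k" for i using partner_less k that by blast
    let ?w = "w(k := e, Suc k := f)"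
    have "monomial_basis scale U \<omega> (Suc (Suc k)) partner ?w"
      unfolding monomial_basis_def
    proof (intro conjI allI impI ballI)
      show "?w i \<in> U" if "i < Suc (Suc k)" for i using that wU e f by (auto simp: less_Suc_eq)
      show "\<omega> (?w i) (?w j) = (if j = partner i then 1 else 0)" if "i < Suc (Suc k)" "j < Suc (Suc k)" for i j
      proof -
        from that consider "i < k" | "i = k" | "i = Suc k" by linarith
        then show ?thesis
        proof cases
          case 1
          then show ?thesis using that(2) w wU pi[of i] by (auto simp: less_Suc_eq monomial_basis_def)
        qed (use that(2) wU e f fe ef pk in \<open>auto simp: less_Suc_eq\<close>)
      qed
      fix x assume x: "x \<in> U"
      let ?x = "x - (\<omega> x f *s e + \<omega> x e *s f)"
      have "?x = (\<Sum>i<k. \<omega> ?x (w (partner i)) *s w i)"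
        using w split(3)[OF x] by (simp add: monomial_basis_def)
      also have "\<dots> = (\<Sum>i<k. \<omega> x (w (partner i)) *s w i)"
        using x e f wU pi by (intro sum.cong) (auto simp: form_diff[OF form] form_add[OF form] form_scale[OF form] sub)
      also have "\<dots> = (\<Sum>i<k. \<omega> x (?w (partner i)) *s ?w i)"
      proof (rule sum.cong[OF refl])
        fix i assume "i \<in> {..<k}"
        then have "i < k" "partner i < k" using pi by auto
        then show "\<omega> x (w (partner i)) *s w i = \<omega> x (?w (partner i)) *s ?w i" by simp
      qed
      finally have "x = (\<Sum>i<k. \<omega> x (?w (partner i)) *s ?w i) + \<omega> x f *s e + \<omega> x e *s f"
        by (simp add: algebra_simps)
      then show "x = (\<Sum>i<Suc (Suc k). \<omega> x (?w (partner i)) *s ?w i)" by (simp add: pk)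
    qed
    then show ?thesis using k split(2) unfolding k_def by auto
  qed
qed

end

section \<open>Involutions whose residual space is the fixed space\<close>

locale residual_involution =
  fixes scale :: "'f::field \<Rightarrow> 'v::ab_group_add \<Rightarrow> 'v" and q :: "'v \<Rightarrow> 'f" and \<tau> :: "'v \<Rightarrow> 'v"
  assumes char: "CHAR('f) = 2" and space: "quadratic_space scale q"
    and orthogonal: "\<tau> \<in> orthogonal_group scale q" and involution: "\<tau> \<circ> \<tau> = id"
    and Res_eq_Fix: "Res \<tau> = Fix \<tau>"
begin

lemma finite_dimensional: "\<exists>B. finite_dimensional_vector_space scale B"
  using space by (simp add: quadratic_space_def)

lemma vector_space: "vector_space scale"
  using finite_dimensional by (auto simp: finite_dimensional_vector_space_def)

text \<open>Only the plain vector space is interpreted here. A finite basis is merely known to exist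
  and is chosen inside the proofs that use one.\<close>

sublocale vector_space scale by (rule vector_space)

lemma form: "quadratic_form scale q"
  using space by (simp add: quadratic_space_def)

lemma q_scale: "q (scale a v) = a\<^sup>2 * q v"
  using form by (simp add: quadratic_form_def)

lemma polar_sym: "polar q u v = polar q v u"
  by (simp add: polar_def add.commute)

lemma polar_add: "polar q (u + v) w = polar q u w + polar q v w"
  by (metis polar_add_right[OF form] polar_sym)

lemma polar_scale_right: "polar q u (scale a v) = a * polar q u v"
  using form unfolding quadratic_form_def by (metis Vector_Spaces.linear_def module_hom.scale)

lemma polar_scale: "polar q (scale a u) v = a * polar q u v"
  by (metis polar_scale_right polar_sym)

lemma polar_zero: "polar q 0 v = 0"
  using polar_scale[of 0 0 v] by simp

lemma polar_sum: "polar q (sum g A) v = (\<Sum>i\<in>A. polar q (g i) v)"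
  by (induction A rule: infinite_finite_induct) (simp_all add: polar_zero polar_add)

lemma polar_nondegenerate: "(\<And>v. polar q u v = 0) \<Longrightarrow> u = 0"
  using space by (simp add: quadratic_space_def)

lemma vector_add_self: "v + v = (0 :: 'v)"
proof -
  have "v + v = scale (1 + 1) v" by (simp only: scale_left_distrib scale_one)
  then show ?thesis by (simp only: char_2_add_self(1)[OF char] scale_zero_left)
qed

lemma polar_self: "polar q v v = 0"
  using q_scale[of 0 0] by (simp add: polar_def vector_add_self char_2_add_self[OF char] flip: diff_diff_eq)

lemma q_add: "q (u + v) = q u + q v + polar q u v"
  by (simp add: polar_def)

lemma tau_add: "\<tau> (u + v) = \<tau> u + \<tau> v" and tau_scale: "\<tau> (scale a v) = scale a (\<tau> v)"
  and tau_q: "q (\<tau> v) = q v"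
  using orthogonal by (auto simp: orthogonal_group_def Vector_Spaces.linear_def module_hom.add module_hom.scale)

lemma tau_tau: "\<tau> (\<tau> v) = v"
  using involution by (simp add: fun_eq_iff)

text \<open>An isometry that is its own inverse is self-adjoint.\<close>

lemma polar_tau: "polar q (\<tau> u) v = polar q u (\<tau> v)"
proof -
  have "polar q (\<tau> u) (\<tau> (\<tau> v)) = polar q u (\<tau> v)"
    by (simp add: polar_def tau_q flip: tau_add)
  then show ?thesis by (simp add: tau_tau)
qed

lemma Res_iff_fixed: "x \<in> Res \<tau> \<longleftrightarrow> \<tau> x = x"
  by (simp add: Res_eq_Fix Fix_def)

lemma Res_obtain:
  assumes "x \<in> Res \<tau>"
  obtains y where "x = \<tau> y - y"
  using assms by (auto simp: Res_def)

text \<open>By self-adjointness the product of \<open>x\<close> with \<open>\<tau> y - y\<close>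
  equals that of \<open>\<tau> x - x\<close> with \<open>y\<close>. It vanishes for every
  \<open>y\<close> exactly when \<open>x\<close> is fixed.\<close>

lemma Res_iff_orthogonal: "x \<in> Res \<tau> \<longleftrightarrow> (\<forall>w\<in>Res \<tau>. polar q x w = 0)"
proof
  assume "x \<in> Res \<tau>"
  then have x: "\<tau> x = x" by (simp add: Res_iff_fixed)
  show "\<forall>w\<in>Res \<tau>. polar q x w = 0"
  proof
    fix w assume "w \<in> Res \<tau>"
    then obtain y where w: "w = \<tau> y - y" by (rule Res_obtain)
    show "polar q x w = 0"
      using polar_tau[of x y] by (simp add: w x polar_diff_right[OF form])
  qed
next
  assume *: "\<forall>w\<in>Res \<tau>. polar q x w = 0"
  have "polar q (\<tau> x - x) y = 0" for y
    using * polar_tau[of x y] by (auto simp: Res_def polar_diff_right[OF form] polar_diff_left[OF form])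
  then have "\<tau> x - x = 0" by (rule polar_nondegenerate)
  then show "x \<in> Res \<tau>" by (simp add: Res_iff_fixed)
qed

lemma wall_eq: "u \<in> Res \<tau> \<Longrightarrow> wall_form q \<tau> u (\<tau> y - y) = polar q u y"
  using wall_form_eq[OF form orthogonal] by (auto simp: Res_def)

text \<open>With \<open>\<tau> y = x + y\<close>, invariance gives \<open>q y = q (x + y)\<close>;
  expanding leaves \<open>q x\<close> plus the polar value equal to 0, and the sign
  disappears.\<close>

lemma wall_self:
  assumes "x \<in> Res \<tau>"
  shows "wall_form q \<tau> x x = q x"
proof -
  obtain y where y: "x = \<tau> y - y" using assms by (rule Res_obtain)
  then have xy: "\<tau> y = x + y" by simp
  have "wall_form q \<tau> x x = polar q x y" using wall_eq[OF assms, of y] y by simp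
  also have "\<dots> = q (\<tau> y) - q x - q y" by (simp add: polar_def xy)
  also have "\<dots> = q x" using char_2_add_self(3)[OF char, of "q x"] by (simp add: tau_q)
  finally show ?thesis .
qed

lemma subspace_Res: "subspace (Res \<tau>)"
  by (intro subspaceI) (auto simp: Res_iff_fixed tau_add tau_scale intro: tau_scale[of 0 0, simplified])

text \<open>Symmetry is the self-adjointness of \<tau> again. Nondegeneracy is inherited from the
  polar form, because every \<open>y\<close> represents the element \<open>\<tau> y - y\<close> of
  \<open>Res \<tau>\<close>.\<close>

lemma wall_symmetric_form: "symmetric_form_on scale (Res \<tau>) (wall_form q \<tau>)"
  unfolding symmetric_form_on_def
proof (intro conjI ballI allI impI)
  show "subspace (Res \<tau>)" by (rule subspace_Res)
  fix x assume x: "x \<in> Res \<tau>"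
  then obtain x' where x': "x = \<tau> x' - x'" by (rule Res_obtain)
  show "x = 0" if "\<forall>y\<in>Res \<tau>. wall_form q \<tau> x y = 0"
  proof (rule polar_nondegenerate)
    fix y
    have "\<tau> y - y \<in> Res \<tau>" by (auto simp: Res_def)
    then show "polar q x y = 0" using that wall_eq[OF x, of y] by simp
  qed
  fix y assume y: "y \<in> Res \<tau>"
  then obtain y' where y': "y = \<tau> y' - y'" by (rule Res_obtain)
  have "polar q x y' = polar q x' y"
    by (simp add: x' y' polar_diff_right[OF form] polar_diff_left[OF form] polar_tau)
  then show "wall_form q \<tau> x y = wall_form q \<tau> y x"
    using wall_eq[OF x, of y'] wall_eq[OF y, of x'] by (simp add: x' y' polar_sym)
  show "wall_form q \<tau> (scale a x) y = a * wall_form q \<tau> x y" for a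
    using wall_eq[OF x, of y'] wall_eq[OF subspace_scale[OF subspace_Res x], of a y']
    by (simp add: y' polar_scale)
  fix z assume z: "z \<in> Res \<tau>"
  then obtain z' where z': "z = \<tau> z' - z'" by (rule Res_obtain)
  show "wall_form q \<tau> (x + y) z = wall_form q \<tau> x z + wall_form q \<tau> y z"
    using wall_eq[OF x, of z'] wall_eq[OF y, of z'] wall_eq[OF subspace_add[OF subspace_Res x y], of z']
    by (simp add: z' polar_add)
qed

text \<open>Subtracting from preimages of the \<open>w i\<close> suitable elements of the totally isotropic
  space \<open>Res \<tau>\<close> makes them pairwise orthogonal, as in the Gram--Schmidt process.\<close>

lemma adapted_basis:
  assumes w: "monomial_basis scale (Res \<tau>) (wall_form q \<tau>) n \<sigma> w"
    and \<sigma>: "\<And>i. i < n \<Longrightarrow> \<sigma> i < n" "\<And>i. i < n \<Longrightarrow> \<sigma> (\<sigma> i) = i"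
  obtains y where "\<And>i. i < n \<Longrightarrow> \<tau> (y i) = y i + w i"
    and "\<And>i j. i < n \<Longrightarrow> j < n \<Longrightarrow> polar q (w i) (y j) = (if j = \<sigma> i then 1 else 0)"
    and "\<And>i j. i < n \<Longrightarrow> j < n \<Longrightarrow> polar q (w i) (w j) = 0"
    and "\<And>i j. i < n \<Longrightarrow> j < n \<Longrightarrow> polar q (y i) (y j) = 0"
    and "\<And>v. v = (\<Sum>i<n. scale (polar q v (y (\<sigma> i))) (w i)) + (\<Sum>i<n. scale (polar q v (w (\<sigma> i))) (y i))"
proof -
  have wR: "w i \<in> Res \<tau>" if "i < n" for i using w that by (simp add: monomial_basis_def)
  have ww: "polar q (w i) (w j) = 0" if "i < n" "j < n" for i j
    using Res_iff_orthogonal[of "w i"] wR that by blast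
  obtain z where z: "w i = \<tau> (z i) - z i" if "i < n" for i
    using wR unfolding Res_def by (simp; metis)
  have wz: "polar q (w i) (z j) = (if j = \<sigma> i then 1 else 0)" if "i < n" "j < n" for i j
  proof -
    have "wall_form q \<tau> (w i) (w j) = polar q (w i) (z j)"
      using wall_eq[OF wR[OF that(1)], of "z j"] by (simp only: z[OF that(2), symmetric])
    then show ?thesis using w that by (simp add: monomial_basis_def)
  qed
  \<comment> \<open>\<open>w (\<sigma> k)\<close> is dual to \<open>z k\<close>, so the correction
    at \<open>i\<close> contributes the product of \<open>z i\<close> and \<open>z k\<close> for
    \<open>k < i\<close> only. Each unordered pair is thus corrected once, and the original value
    plus its copy is zero. The corrections lie in the fixed, isotropic space
    \<open>Res \<tau>\<close>, hence change neither \<open>\<tau> y - y\<close> nor the products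
    with the \<open>w j\<close>.\<close>
  define y where "y i = z i + (\<Sum>k<i. scale (polar q (z i) (z k)) (w (\<sigma> k)))" for i
  have yR: "(\<Sum>k<i. scale (polar q (z i) (z k)) (w (\<sigma> k))) \<in> Res \<tau>" if "i < n" for i
    using that \<sigma> by (intro subspace_sum[OF subspace_Res] subspace_scale[OF subspace_Res] wR) auto
  have ty: "\<tau> (y i) = y i + w i" if "i < n" for i
    using z[OF that] yR[OF that] by (simp add: y_def tau_add Res_iff_fixed algebra_simps)
  have wy: "polar q (w i) (y j) = (if j = \<sigma> i then 1 else 0)" if "i < n" "j < n" for i j
    using Res_iff_orthogonal[of "w i"] wR[OF that(1)] yR[OF that(2)] wz[OF that]
    by (simp add: y_def polar_add_right[OF form])
  have yz: "polar q (\<Sum>k<i. scale (polar q (z i) (z k)) (w (\<sigma> k))) (z j) = (if j < i then polar q (z i) (z j) else 0)"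
    if "i < n" "j < n" for i j
  proof -
    have "polar q (\<Sum>k<i. scale (polar q (z i) (z k)) (w (\<sigma> k))) (z j) =
        (\<Sum>k<i. polar q (z i) (z k) * polar q (w (\<sigma> k)) (z j))"
      by (simp add: polar_sum polar_scale)
    also have "\<dots> = (\<Sum>k<i. if k = j then polar q (z i) (z j) else 0)"
      using that by (intro sum.cong) (auto simp: wz \<sigma>)
    finally show ?thesis by simp
  qed
  have yy: "polar q (y i) (y j) = 0" if "i < n" "j < n" for i j
  proof -
    let ?s = "\<lambda>i. \<Sum>k<i. scale (polar q (z i) (z k)) (w (\<sigma> k))"
    have "polar q (?s i) (?s j) = 0" using Res_iff_orthogonal[of "?s i"] yR that by blast
    moreover have "polar q (z i) (?s j) = (if i < j then polar q (z i) (z j) else 0)"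
      using yz[OF that(2,1)] polar_sym[of "z i" "?s j"] polar_sym[of "z i" "z j"] by simp
    ultimately have "polar q (y i) (y j) = polar q (z i) (z j) + (if i < j then polar q (z i) (z j) else 0)
        + (if j < i then polar q (z i) (z j) else 0)"
      using yz[OF that] by (simp add: y_def polar_add polar_add_right[OF form])
    then show ?thesis
      using char_2_add_self(1)[OF char, of "polar q (z i) (z j)"] polar_self[of "z i"]
      by (cases i j rule: linorder_cases) auto
  qed
  have expand: "v = (\<Sum>i<n. scale (polar q v (y (\<sigma> i))) (w i)) + (\<Sum>i<n. scale (polar q v (w (\<sigma> i))) (y i))" (is "v = ?v") for v
  proof -
    have vw: "polar q ?v (w j) = polar q v (w j)" if j: "j < n" for j
    proof -
      have "polar q ?v (w j) = (\<Sum>i<n. polar q v (w (\<sigma> i)) * polar q (w j) (y i))"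
        using j by (simp add: polar_add polar_sum polar_scale ww polar_sym[of "y _"])
      also have "\<dots> = (\<Sum>i<n. if i = \<sigma> j then polar q v (w j) else 0)"
        using j by (intro sum.cong) (auto simp: wy \<sigma>)
      finally show ?thesis using \<sigma> j by simp
    qed
    have vy: "polar q ?v (y j) = polar q v (y j)" if j: "j < n" for j
    proof -
      have "polar q ?v (y j) = (\<Sum>i<n. polar q v (y (\<sigma> i)) * polar q (w i) (y j))"
        using j by (simp add: polar_add polar_sum polar_scale yy)
      also have "\<dots> = (\<Sum>i<n. if i = \<sigma> j then polar q v (y j) else 0)"
        using j \<sigma> by (intro sum.cong) (auto simp: wy)
      finally show ?thesis using \<sigma> j by simp
    qed
    define d where "d = v - ?v"
    have dw: "polar q d (w j) = 0" and dy: "polar q d (y j) = 0" if "j < n" for j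
      using vw vy that by (simp_all add: d_def polar_diff_left[OF form])
    \<comment> \<open>Orthogonality to all \<open>w j\<close> puts the defect \<open>d\<close> into
      \<open>Res \<tau>\<close>; orthogonality to the \<open>y j\<close> then makes all its Wall
      coordinates vanish.\<close>
    have d: "d \<in> Res \<tau>"
    proof (subst Res_iff_orthogonal, intro ballI)
      fix x assume "x \<in> Res \<tau>"
      then have x: "x = (\<Sum>i<n. scale (wall_form q \<tau> x (w (\<sigma> i))) (w i))"
        using w by (simp add: monomial_basis_def)
      show "polar q d x = 0"
        by (subst x, subst polar_sym) (simp add: polar_sum polar_scale dw polar_sym[of "w _" d])
    qed
    then have "d = (\<Sum>i<n. scale (wall_form q \<tau> d (w (\<sigma> i))) (w i))"
      using w by (simp add: monomial_basis_def)
    moreover have "wall_form q \<tau> d (w i) = 0" if "i < n" for i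
    proof -
      have "w i = \<tau> (y i) - y i" using ty[OF that] by simp
      then show ?thesis using wall_eq[OF d, of "y i"] dy[OF that] by simp
    qed
    ultimately have "d = 0" using \<sigma> by simp
    then show ?thesis by (simp add: d_def)
  qed
  from that[OF ty wy ww yy expand] show ?thesis .
qed

end

section \<open>Interleaved bases and the passage from matrix models to Clifford algebras\<close>

lemma sum_even_odd:
  fixes f :: "nat \<Rightarrow> 'a::comm_monoid_add"
  shows "(\<Sum>k<2 * n. f k) = (\<Sum>i<n. f (2 * i)) + (\<Sum>i<n. f (Suc (2 * i)))"
  by (induction n) (simp_all add: ac_simps)

text \<open>In the interleaved order w_0, y_0, w_1, y_1, ... this is the position dual to
  \<open>k\<close> for the polar form: w_i is dual to y with index \<open>\<sigma> i\<close>, and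
  conversely.\<close>

definition pairing :: "(nat \<Rightarrow> nat) \<Rightarrow> nat \<Rightarrow> nat" where
  "pairing \<sigma> k = 2 * \<sigma> (k div 2) + (if even k then 1 else 0)"

lemma pairing_unit: "k \<noteq> l \<Longrightarrow> l = pairing (\<lambda>i. i) k \<longleftrightarrow> k div 2 = l div 2"
  unfolding pairing_def by presburger

text \<open>Inside a block of four positions the dual of offset \<open>r\<close> is
  \<open>3 - r\<close>, the convention of the hyperbolic model.\<close>

lemma pairing_partner: "l = pairing partner k \<longleftrightarrow> k div 4 = l div 4 \<and> k mod 4 + l mod 4 = 3"
proof -
  obtain a r where k: "k = 4 * a + r" "r < 4"
    by (metis mod_less_divisor mult_div_mod_eq zero_less_numeral)
  obtain b s where l: "l = 4 * b + s" "s < 4"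
    by (metis mod_less_divisor mult_div_mod_eq zero_less_numeral)
  from k(2) consider "r = 0" | "r = 1" | "r = 2" | "r = 3" by linarith
  moreover have "(4 * a + 3) div 2 = Suc (2 * a)" by presburger
  ultimately have "pairing partner k = 4 * a + (3 - r)"
    by cases (simp_all add: k pairing_def partner_def)
  moreover have "4 * b + s = 4 * a + (3 - r) \<longleftrightarrow> a = b \<and> r + s = 3"
    using k(2) l(2) by arith
  ultimately show ?thesis using k l by simp
qed

context residual_involution
begin

text \<open>Puts \<open>w i\<close> at position \<open>2 * i\<close> and \<open>y i\<close> right
  after it, the order expected by \<open>clifford_model\<close>. The values of \<open>q\<close> at
  even positions are the diagonal of the Gram matrix of the Wall form.\<close>

lemma monomial_basis_isotropic_splitting:
  assumes w: "monomial_basis scale (Res \<tau>) (wall_form q \<tau>) n \<sigma> w"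
    and \<sigma>: "\<And>i. i < n \<Longrightarrow> \<sigma> i < n" "\<And>i. i < n \<Longrightarrow> \<sigma> (\<sigma> i) = i"
  obtains x where "\<And>k. k < 2 * n \<Longrightarrow> \<tau> (x k) = (if odd k then x k + x (k - 1) else x k)"
    and "\<And>k l. k < 2 * n \<Longrightarrow> l < 2 * n \<Longrightarrow> polar q (x k) (x l) = (if l = pairing \<sigma> k then 1 else 0)"
    and "\<And>v. v = (\<Sum>k<2 * n. scale (polar q v (x (pairing \<sigma> k))) (x k))"
    and "\<And>i. i < n \<Longrightarrow> q (x (2 * i)) = (if \<sigma> i = i then 1 else 0)"
proof -
  obtain y where y: "\<And>i. i < n \<Longrightarrow> \<tau> (y i) = y i + w i"
    "\<And>i j. i < n \<Longrightarrow> j < n \<Longrightarrow> polar q (w i) (y j) = (if j = \<sigma> i then 1 else 0)"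
    "\<And>i j. i < n \<Longrightarrow> j < n \<Longrightarrow> polar q (w i) (w j) = 0"
    "\<And>i j. i < n \<Longrightarrow> j < n \<Longrightarrow> polar q (y i) (y j) = 0"
    "\<And>v. v = (\<Sum>i<n. scale (polar q v (y (\<sigma> i))) (w i)) + (\<Sum>i<n. scale (polar q v (w (\<sigma> i))) (y i))"
    using adapted_basis[OF w \<sigma>] by blast
  have wR: "w i \<in> Res \<tau>" if "i < n" for i using w that by (simp add: monomial_basis_def)
  define x where "x k = (if even k then w (k div 2) else y (k div 2))" for k
  show ?thesis
  proof
    show "\<tau> (x k) = (if odd k then x k + x (k - 1) else x k)" if "k < 2 * n" for k
    proof -
      have "k div 2 < n" using that by simp
      then show ?thesis
        using y(1) wR by (auto simp: x_def Res_iff_fixed elim!: oddE)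
    qed
    show "polar q (x k) (x l) = (if l = pairing \<sigma> k then 1 else 0)" if "k < 2 * n" "l < 2 * n" for k l
    proof -
      have kl: "k div 2 < n" "l div 2 < n" using that by simp_all
      have "l = 2 * s + 1 \<longleftrightarrow> odd l \<and> l div 2 = s" "l = 2 * s \<longleftrightarrow> even l \<and> l div 2 = s" for s
        by presburger+
      note this[of "\<sigma> (k div 2)"]
      then have eq: "l = pairing \<sigma> k \<longleftrightarrow> even k = odd l \<and> l div 2 = \<sigma> (k div 2)"
        unfolding pairing_def by (cases "even k") simp_all
      have "k div 2 = \<sigma> (l div 2) \<longleftrightarrow> l div 2 = \<sigma> (k div 2)" using \<sigma> kl by metis
      then have "polar q (y (k div 2)) (w (l div 2)) = (if l div 2 = \<sigma> (k div 2) then 1 else 0)"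
        using y(2)[OF kl(2,1)] polar_sym[of "y (k div 2)" "w (l div 2)"] by simp
      then show ?thesis
        unfolding eq x_def using y(2)[OF kl] y(3)[OF kl] y(4)[OF kl]
        by (cases "l div 2 = \<sigma> (k div 2)") simp_all
    qed
    show "v = (\<Sum>k<2 * n. scale (polar q v (x (pairing \<sigma> k))) (x k))" for v
      using y(5)[of v] by (simp add: sum_even_odd pairing_def x_def)
    show "q (x (2 * i)) = (if \<sigma> i = i then 1 else 0)" if "i < n" for i
      using w wall_self[OF wR[OF that]] that by (auto simp: x_def monomial_basis_def)
  qed
qed

context
  fixes m :: nat and x :: "nat \<Rightarrow> 'v" and \<theta> :: "nat \<Rightarrow> nat"
  assumes \<theta>: "\<And>k. k < m \<Longrightarrow> \<theta> k < m" "\<And>k. k < m \<Longrightarrow> \<theta> (\<theta> k) = k"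
    and polar_x: "\<And>k l. k < m \<Longrightarrow> l < m \<Longrightarrow> polar q (x k) (x l) = (if l = \<theta> k then 1 else 0)"
    and expand: "\<And>v. v = (\<Sum>k<m. scale (polar q v (x (\<theta> k))) (x k))"
begin

lemma polar_dual: "k < m \<Longrightarrow> l < m \<Longrightarrow> polar q (x (\<theta> k)) (x l) = (if l = k then 1 else 0)"
  using polar_x[of "\<theta> k" l] \<theta> by simp

lemma inj_on_basis: "inj_on x {..<m}"
proof (rule inj_onI)
  fix k l assume "k \<in> {..<m}" "l \<in> {..<m}" "x k = x l"
  then show "k = l" by (metis polar_dual lessThan_iff zero_neq_one)
qed

lemma span_basis: "span (x ` {..<m}) = UNIV"
proof -
  have "v \<in> span (x ` {..<m})" for v
    by (subst expand[of v]) (intro span_sum span_scale span_base, simp)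
  then show ?thesis by auto
qed

text \<open>Serves to identify the number of pairs \<open>(w, y)\<close> with the \<open>n\<close>
  of the theorem. Independence is read off by pairing with dual vectors.\<close>

lemma dim_UNIV_basis: "dim (UNIV :: 'v set) = m"
proof -
  have "independent (x ` {..<m})"
  proof (rule independent_if_scalars_zero)
    fix f v assume 0: "(\<Sum>v\<in>x ` {..<m}. scale (f v) v) = 0" and "v \<in> x ` {..<m}"
    then obtain l where l: "l < m" "v = x l" by auto
    have "0 = polar q (\<Sum>k<m. scale (f (x k)) (x k)) (x (\<theta> l))"
      using 0 by (simp add: sum.reindex[OF inj_on_basis] polar_zero)
    also have "\<dots> = (\<Sum>k<m. if k = l then f (x l) else 0)"
      unfolding polar_sum polar_scale using l polar_dual[OF l(1)]
      by (intro sum.cong) (auto simp: polar_sym[of _ "x (\<theta> l)"])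
    finally show "f v = 0" using l by simp
  qed simp
  then have "dim (UNIV :: 'v set) = card (x ` {..<m})"
    using dim_eq_card[of "x ` {..<m}" UNIV] span_basis by (simp add: span_UNIV)
  then show ?thesis by (simp add: card_image inj_on_basis)
qed

lemma basis_induct:
  assumes "\<And>k. k < m \<Longrightarrow> P (x k)" "P 0" "\<And>u v. P u \<Longrightarrow> P v \<Longrightarrow> P (u + v)" "\<And>a v. P v \<Longrightarrow> P (scale a v)"
  shows "P v"
proof -
  have "span (x ` {..<m}) \<subseteq> {v. P v}"
    by (rule span_minimal) (use assms in \<open>auto intro!: subspaceI\<close>)
  then show ?thesis using span_basis by auto
qed

text \<open>The model prescribes matrices for basis vectors only. The Clifford relation and the
  compatibility with \<tau> are extended to all vectors by \<open>basis_induct\<close>.\<close>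

lemma clifford_iso_of_model:
  assumes N: "0 < N" and G: "clifford_model m N (\<lambda>k. q (x k)) (\<lambda>k l. polar q (x k) (x l)) G"
    and tau_x: "\<And>k. k < m \<Longrightarrow> \<tau> (x k) = (if odd k then x k + x (k - 1) else x k)"
  shows "involution_algebra_iso (clifford_algebra scale q) (clifford_involution scale q \<tau>)
    (module_mat TYPE('f) N N) transpose_mat"
proof -
  \<comment> \<open>The linear extension of \<open>x k \<mapsto> G k\<close>: the
    \<open>k\<close>-th coordinate of \<open>v\<close> is its product with the dual vector
    \<open>x (\<theta> k)\<close>.\<close>
  define M where "M v = mat N N (\<lambda>ij. \<Sum>k<m. polar q v (x (\<theta> k)) * G k $$ ij)" for v
  have Gc: "G k \<in> carrier_mat N N" "G k * G k = q (x k) \<cdot>\<^sub>m 1\<^sub>m N"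
    "transpose_mat (G k) = (if odd k then G k + G (k - 1) else G k)" if "k < m" for k
    using G that by (auto simp: clifford_model_def)
  have Ga: "G k * G l + G l * G k = polar q (x k) (x l) \<cdot>\<^sub>m 1\<^sub>m N" if "k < m" "l < m" "k \<noteq> l" for k l
    using G that by (auto simp: clifford_model_def)
  have carr: "M v \<in> carrier_mat N N" for v by (simp add: M_def)
  have add: "M (u + v) = M u + M v" for u v
    by (rule eq_matI) (simp_all add: M_def polar_add distrib_right sum.distrib)
  have sc: "M (scale a v) = a \<cdot>\<^sub>m M v" for a v
    by (rule eq_matI) (simp_all add: M_def polar_scale sum_distrib_left mult.assoc)
  have M0: "M 0 = 0\<^sub>m N N"
    by (rule eq_matI) (simp_all add: M_def polar_zero)
  have Mx: "M (x k) = G k" if "k < m" for k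
  proof (rule eq_matI)
    fix i j assume "i < dim_row (G k)" "j < dim_col (G k)"
    then have ij: "i < N" "j < N" using Gc(1)[OF that] by auto
    then have "M (x k) $$ (i, j) = (\<Sum>l<m. polar q (x k) (x (\<theta> l)) * G l $$ (i, j))"
      by (simp add: M_def)
    also have "\<dots> = (\<Sum>l<m. if l = k then G k $$ (i, j) else 0)"
      using that by (intro sum.cong) (auto simp: polar_sym[of "x k"] polar_dual)
    finally show "M (x k) $$ (i, j) = G k $$ (i, j)" using that by simp
  qed (use Gc(1)[OF that] in \<open>simp_all add: M_def\<close>)
  have prod: "M u * M v \<in> carrier_mat N N" for u v using mult_carrier_mat[OF carr carr] .
  \<comment> \<open>The polarised relation is needed before the squares, because the square at a sum
    produces an anticommutator. On equal basis vectors both sides vanish in characteristic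
    two.\<close>
  have ac: "M u * M v + M v * M u = polar q u v \<cdot>\<^sub>m 1\<^sub>m N" for u v
  proof (induction v rule: basis_induct)
    case (1 l)
    show ?case
    proof (induction u rule: basis_induct)
      case (1 k)
      show ?case
      proof (cases "k = l")
        case True
        then show ?thesis
          using \<open>l < m\<close> by (auto simp: Mx Gc polar_self char_2_add_self[OF char] intro!: eq_matI)
      qed (use 1 \<open>l < m\<close> in \<open>simp add: Mx Ga\<close>)
    next
      case 2
      show ?case by (rule eq_matI) (simp_all add: M0 left_mult_zero_mat[OF carr] right_mult_zero_mat[OF carr]
            polar_zero)
    next
      case (3 u u')
      have "M (u + u') * M (x l) + M (x l) * M (u + u') =
          (M u * M (x l) + M (x l) * M u) + (M u' * M (x l) + M (x l) * M u')"
        unfolding add add_mult_distrib_mat[OF carr carr carr] mult_add_distrib_mat[OF carr carr carr]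
        using prod[of u "x l"] prod[of "x l" u] prod[of u' "x l"] prod[of "x l" u'] by (intro eq_matI) auto
      then show ?case unfolding 3 by (auto simp: polar_add intro!: eq_matI)
    next
      case (4 a u)
      have "M (scale a u) * M (x l) + M (x l) * M (scale a u) = a \<cdot>\<^sub>m (M u * M (x l) + M (x l) * M u)"
        unfolding sc mult_smult_assoc_mat[OF carr carr] mult_smult_distrib[OF carr carr]
          add_smult_distrib_left_mat[OF prod prod] ..
      then show ?case unfolding 4 by (auto simp: polar_scale intro!: eq_matI)
    qed
  next
    case 2
    show ?case
      by (rule eq_matI) (simp_all add: M0 left_mult_zero_mat[OF carr] right_mult_zero_mat[OF carr]
          polar_sym[of u 0] polar_zero)
  next
    case (3 v v')
    have "M u * M (v + v') + M (v + v') * M u = (M u * M v + M v * M u) + (M u * M v' + M v' * M u)"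
      unfolding add add_mult_distrib_mat[OF carr carr carr] mult_add_distrib_mat[OF carr carr carr]
      using prod[of u v] prod[of v u] prod[of u v'] prod[of v' u] by (intro eq_matI) auto
    then show ?case unfolding 3 by (auto simp: polar_add_right[OF form] intro!: eq_matI)
  next
    case (4 a v)
    have "M u * M (scale a v) + M (scale a v) * M u = a \<cdot>\<^sub>m (M u * M v + M v * M u)"
      unfolding sc mult_smult_assoc_mat[OF carr carr] mult_smult_distrib[OF carr carr]
        add_smult_distrib_left_mat[OF prod prod] ..
    then show ?case unfolding 4 by (auto simp: polar_scale_right intro!: eq_matI)
  qed
  have rearrange: "(A + B) + (C + D) = (A + D) + (B + C)"
    if "A \<in> carrier_mat N N" "B \<in> carrier_mat N N" "C \<in> carrier_mat N N" "D \<in> carrier_mat N N"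
    for A B C D :: "'f mat"
    using that by (intro eq_matI) (auto simp: ac_simps)
  have sq: "M v * M v = q v \<cdot>\<^sub>m 1\<^sub>m N" for v
  proof (induction v rule: basis_induct)
    case (1 k)
    then show ?case by (simp add: Mx Gc)
  next
    case 2
    show ?case
      using q_scale[of 0 0] by (auto simp: M0 intro!: eq_matI)
  next
    case (3 u v)
    have "M (u + v) * M (u + v) = (M u * M u + M v * M v) + (M u * M v + M v * M u)"
      unfolding add add_mult_distrib_mat[OF carr carr add_carrier_mat[OF carr]]
        mult_add_distrib_mat[OF carr carr carr]
      by (rule rearrange[OF prod prod prod prod])
    then show ?case unfolding 3 ac by (auto simp: q_add intro!: eq_matI)
  next
    case (4 a v)
    have "M (scale a v) * M (scale a v) = a \<cdot>\<^sub>m (a \<cdot>\<^sub>m (M v * M v))"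
      unfolding sc mult_smult_assoc_mat[OF carr smult_carrier_mat[OF carr]] mult_smult_distrib[OF carr carr] ..
    then show ?case unfolding 4 by (auto simp: q_scale power2_eq_square intro!: eq_matI)
  qed
  have tr: "M (\<tau> v) = transpose_mat (M v)" for v
  proof (induction v rule: basis_induct)
    case (1 k)
    then show ?case using Mx[of "k - 1"] by (auto simp: tau_x add Mx Gc(3))
  next
    case 2
    show ?case using tau_scale[of 0 0] by (auto simp: M0 intro!: eq_matI)
  next
    case (3 u v)
    then show ?case by (simp add: tau_add add transpose_add[OF carr carr])
  next
    case (4 a v)
    then show ?case using carr[of v] by (auto simp: tau_scale sc intro!: eq_matI)
  qed
  have "generates_matrices N (G ` {..<m})" using G by (simp add: clifford_model_def)
  moreover have "G ` {..<m} \<subseteq> range M" using Mx by (metis image_subsetI lessThan_iff rangeI)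
  ultimately have gen: "generates_matrices N (range M)"
    unfolding generates_matrices_def by (meson subset_trans)
  \<comment> \<open>The vector \<open>x (\<theta> k)\<close> is orthogonal to every basis vector
    other than \<open>x k\<close>, in particular to the later ones.\<close>
  have dual: "\<exists>z. polar q z v = 1 \<and> (\<forall>u\<in>set ws. polar q z u = 0)"
    if split: "map x [0..<m] = us @ v # ws" for us v ws
  proof -
    let ?k = "length us"
    have len: "m = ?k + Suc (length ws)" using arg_cong[OF split, of length] by simp
    then have v: "v = x ?k" using arg_cong[OF split, of "\<lambda>l. l ! ?k"] by (simp del: upt_Suc)
    have ws: "ws = map x [Suc ?k..<m]"
      using arg_cong[OF split, of "drop (Suc ?k)"] by (simp add: drop_map)
    show ?thesis
    proof (intro exI conjI ballI)
      show "polar q (x (\<theta> ?k)) v = 1" using polar_dual[of ?k ?k] len by (simp add: v)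
      fix u assume "u \<in> set ws"
      then obtain l where "u = x l" "?k < l" "l < m" by (auto simp: ws)
      then show "polar q (x (\<theta> ?k)) u = 0" using polar_dual[of ?k l] by simp
    qed
  qed
  have set: "set (map x [0..<m]) = x ` {..<m}" by auto
  show ?thesis
    by (rule clifford_algebra_iso_matrices[OF char vector_space orthogonal involution N carr add sc sq tr _ _ gen, of "map x [0..<m]"])
      (use dual span_basis set in auto)
qed

end

end

section \<open>Isometry type of the Wall form and the equivalence\<close>

context residual_involution
begin

lemma wall_sum:
  assumes "\<And>i. i \<in> A \<Longrightarrow> g i \<in> Res \<tau>" "y \<in> Res \<tau>"
  shows "wall_form q \<tau> (sum g A) y = (\<Sum>i\<in>A. wall_form q \<tau> (g i) y)"
proof -
  obtain B where "finite_dimensional_vector_space scale B" using finite_dimensional by blast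
  then interpret fd: finite_dimensional_vector_space scale B .
  show ?thesis using assms by (intro fd.form_sum[OF wall_symmetric_form]) auto
qed

lemma wall_sym: "x \<in> Res \<tau> \<Longrightarrow> y \<in> Res \<tau> \<Longrightarrow> wall_form q \<tau> x y = wall_form q \<tau> y x"
  and wall_add: "x \<in> Res \<tau> \<Longrightarrow> y \<in> Res \<tau> \<Longrightarrow> z \<in> Res \<tau> \<Longrightarrow>
    wall_form q \<tau> (x + y) z = wall_form q \<tau> x z + wall_form q \<tau> y z"
  and wall_scale: "x \<in> Res \<tau> \<Longrightarrow> y \<in> Res \<tau> \<Longrightarrow> wall_form q \<tau> (scale a x) y = a * wall_form q \<tau> x y"
  using wall_symmetric_form by (simp_all add: symmetric_form_on_def)

context
  fixes n :: nat and \<sigma> :: "nat \<Rightarrow> nat" and w :: "nat \<Rightarrow> 'v"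
  assumes w: "monomial_basis scale (Res \<tau>) (wall_form q \<tau>) n \<sigma> w"
    and \<sigma>: "\<And>i. i < n \<Longrightarrow> \<sigma> i < n" "\<And>i. i < n \<Longrightarrow> \<sigma> (\<sigma> i) = i"
begin

lemma basis_Res: "i < n \<Longrightarrow> w i \<in> Res \<tau>"
  using w by (simp add: monomial_basis_def)

lemma combination_Res: "(\<Sum>i<n. scale (c i) (w i)) \<in> Res \<tau>"
  by (intro subspace_sum[OF subspace_Res] subspace_scale[OF subspace_Res] basis_Res) simp

lemma basis_expand: "x \<in> Res \<tau> \<Longrightarrow> x = (\<Sum>i<n. scale (wall_form q \<tau> x (w (\<sigma> i))) (w i))"
  using w by (simp add: monomial_basis_def)

lemma wall_combination: "y \<in> Res \<tau> \<Longrightarrow>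
    wall_form q \<tau> (\<Sum>i<n. scale (c i) (w i)) y = (\<Sum>i<n. c i * wall_form q \<tau> (w i) y)"
  by (subst wall_sum) (auto intro!: sum.cong simp: wall_scale basis_Res subspace_scale[OF subspace_Res])

lemma wall_coordinate:
  assumes "j < n"
  shows "wall_form q \<tau> (\<Sum>i<n. scale (c i) (w i)) (w j) = c (\<sigma> j)"
proof -
  have "wall_form q \<tau> (\<Sum>i<n. scale (c i) (w i)) (w j) = (\<Sum>i<n. if i = \<sigma> j then c (\<sigma> j) else 0)"
    unfolding wall_combination[OF basis_Res[OF assms]]
    using assms w \<sigma> by (intro sum.cong) (auto simp: monomial_basis_def)
  then show ?thesis using \<sigma> assms by simp
qed

lemma wall_expand:
  assumes x: "x \<in> Res \<tau>" and y: "y \<in> Res \<tau>"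
  shows "wall_form q \<tau> x y = (\<Sum>i<n. wall_form q \<tau> x (w (\<sigma> i)) * wall_form q \<tau> y (w i))"
proof -
  have "wall_form q \<tau> x y = (\<Sum>i<n. wall_form q \<tau> x (w (\<sigma> i)) * wall_form q \<tau> (w i) y)"
    by (subst basis_expand[OF x], rule wall_combination[OF y])
  also have "\<dots> = (\<Sum>i<n. wall_form q \<tau> x (w (\<sigma> i)) * wall_form q \<tau> y (w i))"
    using y basis_Res wall_sym by (intro sum.cong) auto
  finally show ?thesis .
qed

end

lemma isometric_unit:
  assumes w: "monomial_basis scale (Res \<tau>) (wall_form q \<tau>) n (\<lambda>i. i) w"
  shows "isometric (wall_space scale q \<tau>) (orthogonal_copies n unit_space)"
proof -
  note wR = basis_Res[OF w]
  define \<phi> where "\<phi> x = vec n (\<lambda>i. wall_form q \<tau> x (w i))" for x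
  define \<psi> where "\<psi> v = (\<Sum>i<n. scale (v $ i) (w i))" for v :: "'f vec"
  have "bij_betw \<phi> (Res \<tau>) (carrier_vec n)"
  proof (rule bij_betw_byWitness[where f' = \<psi>])
    show "\<forall>x\<in>Res \<tau>. \<psi> (\<phi> x) = x" using basis_expand[OF w] by (simp add: \<phi>_def \<psi>_def)
    show "\<forall>v\<in>carrier_vec n. \<phi> (\<psi> v) = v"
      using wall_coordinate[OF w] by (auto simp: \<phi>_def \<psi>_def intro!: eq_vecI)
    show "\<phi> ` Res \<tau> \<subseteq> carrier_vec n" by (auto simp: \<phi>_def)
    show "\<psi> ` carrier_vec n \<subseteq> Res \<tau>" using combination_Res[OF w] by (auto simp: \<psi>_def)
  qed
  moreover have "(\<Sum>i<n. \<phi> x $ i * \<phi> y $ i) = wall_form q \<tau> x y" if "x \<in> Res \<tau>" "y \<in> Res \<tau>" for x y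
    using wall_expand[OF w _ _ that] by (simp add: \<phi>_def)
  ultimately show ?thesis
    unfolding isometric_def wall_space_def orthogonal_copies_def unit_space_def
    by (intro exI[of _ \<phi>])
      (auto simp: \<phi>_def wall_add wall_scale wR intro!: eq_vecI cong: conj_cong)
qed

lemma isometric_hyperbolic:
  assumes w: "monomial_basis scale (Res \<tau>) (wall_form q \<tau>) (2 * h) partner w"
  shows "isometric (wall_space scale q \<tau>) (orthogonal_copies h hyperbolic_plane)"
proof -
  have lt: "partner i < 2 * h" if "i < 2 * h" for i using partner_less that by simp
  have wR: "w (2 * j) \<in> Res \<tau>" "w (Suc (2 * j)) \<in> Res \<tau>" if "j < h" for j
    using basis_Res[OF w lt] that by simp_all
  \<comment> \<open>The first component is the coefficient of \<open>w (2 * j)\<close>, which is the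
    Wall product with its partner \<open>w (Suc (2 * j))\<close>; the second is the reverse.\<close>
  define \<phi> where "\<phi> x = vec h (\<lambda>j. (wall_form q \<tau> x (w (Suc (2 * j))), wall_form q \<tau> x (w (2 * j))))" for x
  define c where "c v i = (if even i then fst (v $ (i div 2)) else snd (v $ (i div 2)))" for v :: "('f \<times> 'f) vec" and i
  define \<psi> where "\<psi> v = (\<Sum>i<2 * h. scale (c v i) (w i))" for v
  have p: "partner (2 * j) = Suc (2 * j)" "partner (Suc (2 * j)) = 2 * j" for j by (simp_all add: partner_def)
  have "bij_betw \<phi> (Res \<tau>) (carrier_vec h)"
  proof (rule bij_betw_byWitness[where f' = \<psi>])
    show "\<forall>x\<in>Res \<tau>. \<psi> (\<phi> x) = x"
    proof
      fix x assume x: "x \<in> Res \<tau>"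
      have "\<psi> (\<phi> x) = (\<Sum>i<2 * h. scale (wall_form q \<tau> x (w (partner i))) (w i))"
        by (simp add: \<psi>_def \<phi>_def c_def sum_even_odd p)
      then show "\<psi> (\<phi> x) = x" using basis_expand[OF w lt _ x] by simp
    qed
    show "\<forall>v\<in>carrier_vec h. \<phi> (\<psi> v) = v"
      using wall_coordinate[OF w lt] by (auto simp: \<phi>_def \<psi>_def c_def p intro!: eq_vecI)
    show "\<phi> ` Res \<tau> \<subseteq> carrier_vec h" by (auto simp: \<phi>_def)
    show "\<psi> ` carrier_vec h \<subseteq> Res \<tau>" using combination_Res[OF w lt] by (auto simp: \<psi>_def)
  qed
  moreover have "(\<Sum>j<h. fst (\<phi> x $ j) * snd (\<phi> y $ j) - snd (\<phi> x $ j) * fst (\<phi> y $ j)) = wall_form q \<tau> x y"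
    if "x \<in> Res \<tau>" "y \<in> Res \<tau>" for x y
  proof -
    \<comment> \<open>The standard hyperbolic form is written with a difference, while the Gram
      matrix of \<open>partner\<close> yields a sum.\<close>
    have minus: "a - b = a + b" for a b :: 'f using char_2_add_self(3)[OF char, of b] by (metis diff_conv_add_uminus)
    show ?thesis
      unfolding minus using wall_expand[OF w lt _ that] by (simp add: \<phi>_def sum_even_odd p sum.distrib)
  qed
  ultimately show ?thesis
    unfolding isometric_def wall_space_def orthogonal_copies_def hyperbolic_plane_def
    by (intro exI[of _ \<phi>])
      (auto simp: \<phi>_def wall_add wall_scale wR case_prod_beta intro!: eq_vecI cong: conj_cong)
qed

text \<open>The hyperbolic form is alternating, so its values on the diagonal are zero; those of the
  unit form are sums of squares, hence squares.\<close>

lemma square_if_isometric: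
  assumes "isometric (wall_space scale q \<tau>) (orthogonal_copies h hyperbolic_plane) \<or>
      isometric (wall_space scale q \<tau>) (orthogonal_copies n unit_space)"
    and x: "x \<in> Res \<tau>"
  shows "\<exists>a. wall_form q \<tau> x x = a\<^sup>2"
  using assms(1)
proof
  assume "isometric (wall_space scale q \<tau>) (orthogonal_copies h hyperbolic_plane)"
  then obtain \<phi> where "\<forall>x\<in>Res \<tau>. \<forall>y\<in>Res \<tau>.
      bform (orthogonal_copies h hyperbolic_plane) (\<phi> x) (\<phi> y) = wall_form q \<tau> x y"
    unfolding isometric_def wall_space_def by auto
  then have "bform (orthogonal_copies h hyperbolic_plane) (\<phi> x) (\<phi> x) = wall_form q \<tau> x x"
    using x by blast
  then have "wall_form q \<tau> x x = 0\<^sup>2"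
    by (simp add: orthogonal_copies_def hyperbolic_plane_def case_prod_beta mult.commute)
  then show ?thesis by blast
next
  assume "isometric (wall_space scale q \<tau>) (orthogonal_copies n unit_space)"
  then obtain \<phi> :: "'v \<Rightarrow> 'f vec" where "\<forall>x\<in>Res \<tau>. \<forall>y\<in>Res \<tau>.
      bform (orthogonal_copies n unit_space) (\<phi> x) (\<phi> y) = wall_form q \<tau> x y"
    unfolding isometric_def wall_space_def by auto
  then have "bform (orthogonal_copies n unit_space) (\<phi> x) (\<phi> x) = wall_form q \<tau> x x"
    using x by blast
  then have "wall_form q \<tau> x x = (\<Sum>i<n. (\<phi> x $ i)\<^sup>2)"
    by (simp add: orthogonal_copies_def unit_space_def power2_eq_square)
  then show ?thesis unfolding sum_squares_char_2[OF char] by blast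
qed

lemma iso_and_isometric_if_square:
  assumes sq: "\<forall>x\<in>Res \<tau>. \<exists>a. wall_form q \<tau> x x = a\<^sup>2" and dim: "dim (UNIV :: 'v set) = 2 * n"
  shows "involution_algebra_iso (clifford_algebra scale q) (clifford_involution scale q \<tau>)
      (module_mat TYPE('f) (2 ^ n) (2 ^ n)) transpose_mat \<and>
    (even n \<and> isometric (wall_space scale q \<tau>) (orthogonal_copies (n div 2) hyperbolic_plane) \<or>
      isometric (wall_space scale q \<tau>) (orthogonal_copies n unit_space))"
proof -
  obtain B where "finite_dimensional_vector_space scale B" using finite_dimensional by blast
  then interpret fd: finite_dimensional_vector_space scale B .
  have pairing_lt: "pairing \<sigma> k < 2 * m" and pairing_inv: "pairing \<sigma> (pairing \<sigma> k) = k"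
    if "\<And>i. i < m \<Longrightarrow> \<sigma> i < m" "\<And>i. i < m \<Longrightarrow> \<sigma> (\<sigma> i) = i" "k < 2 * m" for \<sigma> m k
  proof -
    have k: "k div 2 < m" using that(3) by simp
    then show "pairing \<sigma> k < 2 * m" using that(1)[of "k div 2"] by (auto simp: pairing_def)
    show "pairing \<sigma> (pairing \<sigma> k) = k" using that(2)[OF k] by (auto simp: pairing_def)
  qed
  show ?thesis
  \<comment> \<open>The zero space is counted on the unit side, where the empty family is an
    orthonormal basis.\<close>
  proof (cases "dim (Res \<tau>) = 0 \<or> (\<exists>x\<in>Res \<tau>. wall_form q \<tau> x x \<noteq> 0)")
    case True
    define m where "m = dim (Res \<tau>)"
    obtain w where w: "monomial_basis scale (Res \<tau>) (wall_form q \<tau>) m (\<lambda>i. i) w"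
      using fd.unit_basis_exists[OF char wall_symmetric_form sq True] unfolding m_def by blast
    obtain x where x: "\<And>k. k < 2 * m \<Longrightarrow> \<tau> (x k) = (if odd k then x k + x (k - 1) else x k)"
      "\<And>k l. k < 2 * m \<Longrightarrow> l < 2 * m \<Longrightarrow> polar q (x k) (x l) = (if l = pairing (\<lambda>i. i) k then 1 else 0)"
      "\<And>v. v = (\<Sum>k<2 * m. scale (polar q v (x (pairing (\<lambda>i. i) k))) (x k))"
      "\<And>i. i < m \<Longrightarrow> q (x (2 * i)) = 1"
      using monomial_basis_isotropic_splitting[OF w] by auto
    note pr = pairing_lt[of m "\<lambda>i. i"] pairing_inv[of m "\<lambda>i. i"]
    have "2 * m = 2 * n" using dim_UNIV_basis[OF pr x(2,3)] dim by simp
    then have m: "m = n" by simp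
    obtain G where "clifford_model (2 * m) (2 ^ m) (\<lambda>k. q (x k)) (\<lambda>k l. polar q (x k) (x l)) G"
      using clifford_model_unit[OF char, of m "\<lambda>k. q (x k)" "\<lambda>k l. polar q (x k) (x l)"] x(2,4)
      by (auto simp: pairing_unit)
    then show ?thesis
      using clifford_iso_of_model[OF pr x(2,3) _ _ x(1)] isometric_unit[OF w] m by auto
  next
    case False
    then have alt: "\<forall>x\<in>Res \<tau>. wall_form q \<tau> x x = 0" by blast
    define h where "h = dim (Res \<tau>) div 2"
    have "even (dim (Res \<tau>)) \<and> (\<exists>w. monomial_basis scale (Res \<tau>) (wall_form q \<tau>) (dim (Res \<tau>)) partner w)"
      by (rule fd.symplectic_basis_exists[OF wall_symmetric_form alt])
    moreover from this have "dim (Res \<tau>) = 2 * h" by (simp add: h_def)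
    ultimately obtain w where w: "monomial_basis scale (Res \<tau>) (wall_form q \<tau>) (2 * h) partner w" by auto
    have lt: "partner i < 2 * h" if "i < 2 * h" for i using partner_less that by simp
    have neq: "partner i \<noteq> i" for i by (auto simp: partner_def elim: oddE)
    obtain x where x: "\<And>k. k < 2 * (2 * h) \<Longrightarrow> \<tau> (x k) = (if odd k then x k + x (k - 1) else x k)"
      "\<And>k l. k < 2 * (2 * h) \<Longrightarrow> l < 2 * (2 * h) \<Longrightarrow> polar q (x k) (x l) = (if l = pairing partner k then 1 else 0)"
      "\<And>v. v = (\<Sum>k<2 * (2 * h). scale (polar q v (x (pairing partner k))) (x k))"
      "\<And>i. i < 2 * h \<Longrightarrow> q (x (2 * i)) = 0"
      using monomial_basis_isotropic_splitting[OF w lt] neq by auto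
    note pr = pairing_lt[OF lt] pairing_inv[OF lt]
    \<comment> \<open>The space has twice the dimension of \<open>Res \<tau>\<close>, which is even
      because the Wall form is alternating; this forces \<open>n\<close> to be even.\<close>
    have "2 * (2 * h) = 2 * n" using dim_UNIV_basis[OF pr x(2,3)] dim by simp
    then have n: "n = 2 * h" by simp
    have pow: "(4::nat) ^ h = 2 ^ n" by (simp add: n power_mult)
    obtain G where "clifford_model (4 * h) (4 ^ h) (\<lambda>k. q (x k)) (\<lambda>k l. polar q (x k) (x l)) G"
      using clifford_model_hyperbolic[OF char, of h "\<lambda>k. q (x k)" "\<lambda>k l. polar q (x k) (x l)"] x(2,4)
      by (auto simp: pairing_partner)
    then have G: "clifford_model (2 * (2 * h)) (2 ^ n) (\<lambda>k. q (x k)) (\<lambda>k l. polar q (x k) (x l)) G"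
      by (simp add: pow)
    show ?thesis
      using clifford_iso_of_model[OF pr x(2,3) _ G x(1)] isometric_hyperbolic[OF w] n by auto
  qed
qed

end

theorem theorem4p9:
  fixes scale :: "'f::field \<Rightarrow> 'v::ab_group_add \<Rightarrow> 'v"
    and q :: "'v \<Rightarrow> 'f" and \<tau> :: "'v \<Rightarrow> 'v" and n :: nat
  assumes "CHAR('f) = 2"
    and "quadratic_space scale q"
    and "vector_space.dim scale (UNIV :: 'v set) = 2 * n"
    and "\<tau> \<in> orthogonal_group scale q"
    and "\<tau> \<circ> \<tau> = id"
    and "Res \<tau> = Fix \<tau>"
  shows
    "(involution_algebra_iso
        (clifford_algebra scale q) (clifford_involution scale q \<tau>)
        (module_mat TYPE('f) (2 ^ n) (2 ^ n)) transpose_mat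
      \<longleftrightarrow> (\<forall>x\<in>Res \<tau>. q x \<in> {a\<^sup>2 | a. True})) \<and>
     ((\<forall>x\<in>Res \<tau>. q x \<in> {a\<^sup>2 | a. True})
      \<longleftrightarrow> (\<forall>x\<in>Res \<tau>. wall_form q \<tau> x x \<in> {a\<^sup>2 | a. True})) \<and>
     ((\<forall>x\<in>Res \<tau>. wall_form q \<tau> x x \<in> {a\<^sup>2 | a. True})
      \<longleftrightarrow> (even n \<and> isometric (wall_space scale q \<tau>) (orthogonal_copies (n div 2) hyperbolic_plane)) \<or>
          isometric (wall_space scale q \<tau>) (orthogonal_copies n unit_space))"
    (is "(?iso \<longleftrightarrow> ?q) \<and> (?q \<longleftrightarrow> ?wall) \<and> (?wall \<longleftrightarrow> ?isometric)")
proof -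
  interpret residual_involution scale q \<tau> by unfold_locales fact+
  have q_wall: "?q \<longleftrightarrow> ?wall" by (simp add: wall_self)
  \<comment> \<open>The basis built from the square condition serves both the isomorphism and the
    isometry, so one implication covers conditions (1) and (4).\<close>
  have "?iso \<and> ?isometric" if ?wall
    using iso_and_isometric_if_square[OF _ assms(3)] that by auto
  moreover have ?q if ?iso
    using square_if_involution_algebra_iso[OF char _ orthogonal involution _ that] Res_iff_fixed by auto
  moreover have ?wall if ?isometric
    using square_if_isometric that by blast
  ultimately show ?thesis using q_wall by blast
qed

end
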